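(* (Open Mapping Theorem) Let $K_\Delta$ be a perfectoid $\Delta$-field and let $T:E\to F$ be a surjective morphism of Banach spaces over $K_\Delta$. Then $T$ is an open mapping, i.e., if $U$ is open in $E$, then $T(U)\subset F$ is also open.
   Context: Perfectoid $\Delta$-fields. Fix a prime $p$, $\Delta=\{1,\dots,t\}$, and a $p$-adic field $K_0$; let $\mathbf{C}$ be the completion of an algebraic closure of $K_0$. A perfectoid field is a complete topological field $K$ whose topology is induced by a non-discrete valuation of rank 1 such that Frobenius is surjective on $K^\circ/p$. For $\alpha\in\Delta$ let $K_\alpha$ be a perfectoid field with $K_0\subseteq K_\alpha\subseteq\mathbf{C}$ (absolute values normalized, i.e. compatible with that of $\mathbf{C}$). A perfectoid $\Delta$-field of mixed characteristic is a ring isomorphic to $K_\Delta=K_1\hat\otimes_{K_0}\cdots\hat\otimes_{K_0}K_t$, the completion of the tensor product for the seminorm $|x|_\Delta=\inf\{\max_i|x_{i1}|\cdots|x_{it}|:x=\sum_i x_{i1}\otimes\cdots\otimes x_{it}\}$; $K^\circ_\Delta$ is the similarly defined completion of $\mathcal{O}_{K_1}\otimes_{\mathcal{O}_{K_0}}\cdots\otimes_{\mathcal{O}_{K_0}}\mathcal{O}_{K_t}$. An embedding family is $s=(s_\alpha:K_\alpha\to\mathbf{C})_\alpha$ of continuous $K_0$-embeddings; $K_s$ is the completion of the compositum of the $s_\alpha(K_\alpha)$; $s\sim s'$ if there is a continuous isomorphism $u:K_s\to K_{s'}$ with $s'_\alpha=u\circ s_\alpha$ for all $\alpha$; $\mathfrak{S}$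 is the set of equivalence classes; $\beta_s:K_\Delta\to K_s$ is the continuous homomorphism $\sum x_1\otimes\cdots\otimes x_t\mapsto\sum s_1(x_1)\cdots s_t(x_t)$. With $\varpi_\alpha\in K_\alpha$, $|p|\le|\varpi_\alpha|<1$, viewed in $K_\Delta^\circ$ and $I_\varpi=(\varpi_1,\dots,\varpi_t)$, set $K^{\circ\flat}_\Delta=\varprojlim_{x\mapsto x^p}K^\circ_\Delta/I_\varpi$, identified multiplicatively with $\varprojlim_{x\mapsto x^p}K_\Delta^\circ$. A perfectoid $\Delta$-field of equicharacteristic is a ring isomorphic to the total ring of fractions $K^\flat_\Delta$ of $K^{\circ\flat}_\Delta$; it carries maps $\beta^\flat_s:K^\flat_\Delta\to K^\flat_s$ ($s\in\mathfrak{S}$) induced by $(x^{(n)})_n\mapsto(\beta_s(x^{(n)}))_n$. A perfectoid $\Delta$-field is one of either kind; in the equicharacteristic case $K_\Delta,K_s,\beta_s$ stand for $K^\flat_\Delta,K^\flat_s,\beta^\flat_s$. Put $|\lambda|_s=|\beta_s(\lambda)|$. Banach spaces. A normed space over $K_\Delta$ is a $K_\Delta$-module $M$ with a family of maps $\|\cdot\|_s:M\to\mathbb{R}_{\ge0}$, $s\in\mathfrak{S}$, such that for all $x,y\in M$, $\lambda\in K_\Delta$: (i) $\|x+y\|_s\le\max\{\|x\|_s,\|y\|_s\}$; (ii) $\|\lambda x\|_s=|\lambda|_s\|x\|_s$; (iii) $\bigcap_{s\in\mathfrak{S}}\{x:\|x\|_s=0\}=\{0\}$. Its norm is $\|x\|=\sup_{s\in\mathfrak{S}}\|x\|_s$,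 giving the metric $d(x,y)=\|x-y\|$ and hence a topology. A morphism of normed spaces is a continuous $K_\Delta$-module homomorphism. A Banach space over $K_\Delta$ is a normed space complete for this metric. *)

theory Defs
  imports
    "HOL-Algebra.Algebraic_Closure"
    "HOL-Algebra.Generated_Fields"
    "HOL-Library.Poly_Mapping"
    "HOL-Computational_Algebra.Primes"
    "HOL-Analysis.Abstract_Metric_Spaces"
begin

section \<open>Topologies given by norms\<close>

text \<open>Used for rings and for modules alike. The value off the carrier is set to 0 because
  \<^locale>\<open>Metric_space\<close> asks for symmetry and nonnegativity on the whole type.\<close>

definition norm_dist :: "('a, 'm) ring_scheme \<Rightarrow> ('a \<Rightarrow> real) \<Rightarrow> 'a \<Rightarrow> 'a \<Rightarrow> real" where
  "norm_dist M n x y = (if x \<in> carrier M \<and> y \<in> carrier M then n (x \<ominus>\<^bsub>M\<^esub> y) else 0)"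

definition norm_topology :: "('a, 'm) ring_scheme \<Rightarrow> ('a \<Rightarrow> real) \<Rightarrow> 'a topology" where
  "norm_topology M n = Metric_space.mtopology (carrier M) (norm_dist M n)"

definition norm_complete :: "('a, 'm) ring_scheme \<Rightarrow> ('a \<Rightarrow> real) \<Rightarrow> bool" where
  "norm_complete M n \<longleftrightarrow> Metric_space.mcomplete (carrier M) (norm_dist M n)"


section \<open>Valued fields\<close>

definition nonarch_abs :: "'c ring \<Rightarrow> ('c \<Rightarrow> real) \<Rightarrow> bool" where
  "nonarch_abs C v \<longleftrightarrow>
     (\<forall>x\<in>carrier C. 0 \<le> v x \<and> (v x = 0 \<longleftrightarrow> x = \<zero>\<^bsub>C\<^esub>)) \<and>
     (\<forall>x\<in>carrier C. \<forall>y\<in>carrier C. v (x \<otimes>\<^bsub>C\<^esub> y) = v x * v y) \<and>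
     (\<forall>x\<in>carrier C. \<forall>y\<in>carrier C. v (x \<oplus>\<^bsub>C\<^esub> y) \<le> max (v x) (v y))"

text \<open>The value group, a subgroup of the positive reals, is discrete iff 1 is not a limit point
  of it.\<close>

definition discrete_abs :: "('c \<Rightarrow> real) \<Rightarrow> 'c set \<Rightarrow> bool" where
  "discrete_abs v L \<longleftrightarrow> (\<exists>c<1. \<forall>x\<in>L. \<not> (c < v x \<and> v x < 1))"

definition valuation_ring :: "'c ring \<Rightarrow> ('c \<Rightarrow> real) \<Rightarrow> 'c set \<Rightarrow> 'c ring" where
  "valuation_ring C v L = C\<lparr>carrier := {x \<in> L. v x \<le> 1}\<rparr>"

definition frobenius_surj :: "nat \<Rightarrow> 'a ring \<Rightarrow> bool" where
  "frobenius_surj p S \<longleftrightarrow> (\<lambda>x. x [^]\<^bsub>S\<^esub> p) ` carrier S = carrier S"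

definition p_elem :: "nat \<Rightarrow> 'c ring \<Rightarrow> 'c" where
  "p_elem p C = [p] \<cdot>\<^bsub>C\<^esub> \<one>\<^bsub>C\<^esub>"

text \<open>A \<open>p\<close>-adic field is a complete discretely valued field of characteristic 0 whose residue
  field is perfect of characteristic \<open>p\<close>; finite extensions of the \<open>p\<close>-adic numbers are
  instances.\<close>

definition p_adic_field :: "nat \<Rightarrow> 'c ring \<Rightarrow> ('c \<Rightarrow> real) \<Rightarrow> 'c set \<Rightarrow> bool" where
  "p_adic_field p C v L \<longleftrightarrow>
     subfield L C \<and>
     (\<forall>n::nat. 0 < n \<longrightarrow> [n] \<cdot>\<^bsub>C\<^esub> \<one>\<^bsub>C\<^esub> \<noteq> \<zero>\<^bsub>C\<^esub>) \<and>
     v (p_elem p C) < 1 \<and>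
     norm_complete (C\<lparr>carrier := L\<rparr>) v \<and>
     discrete_abs v L \<and>
     frobenius_surj p (valuation_ring C v L Quot {x \<in> L. v x < 1})"

definition perfectoid_field :: "nat \<Rightarrow> 'c ring \<Rightarrow> ('c \<Rightarrow> real) \<Rightarrow> 'c set \<Rightarrow> bool" where
  "perfectoid_field p C v L \<longleftrightarrow>
     subfield L C \<and>
     norm_complete (C\<lparr>carrier := L\<rparr>) v \<and>
     \<not> discrete_abs v L \<and>
     frobenius_surj p
       (valuation_ring C v L Quot (PIdl\<^bsub>valuation_ring C v L\<^esub> (p_elem p C)))"

definition completed_algebraic_closure :: "'c ring \<Rightarrow> ('c \<Rightarrow> real) \<Rightarrow> 'c set \<Rightarrow> bool" where
  "completed_algebraic_closure C v L \<longleftrightarrow>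
     norm_complete C v \<and>
     (\<exists>L'. subfield L' C \<and> algebraic_closure (C\<lparr>carrier := L'\<rparr>) L \<and>
           norm_topology C v closure_of L' = carrier C)"


section \<open>Completion of a seminormed commutative ring\<close>

definition cauchy_ring :: "'a ring \<Rightarrow> ('a \<Rightarrow> real) \<Rightarrow> (nat \<Rightarrow> 'a) ring" where
  "cauchy_ring S q =
     \<lparr> carrier = {x. (\<forall>n. x n \<in> carrier S) \<and>
                     (\<forall>e>0. \<exists>N. \<forall>m\<ge>N. \<forall>n\<ge>N. q (x m \<ominus>\<^bsub>S\<^esub> x n) < e)},
       monoid.mult = (\<lambda>x y n. x n \<otimes>\<^bsub>S\<^esub> y n), one = (\<lambda>n. \<one>\<^bsub>S\<^esub>),
       zero = (\<lambda>n. \<zero>\<^bsub>S\<^esub>), add = (\<lambda>x y n. x n \<oplus>\<^bsub>S\<^esub> y n) \<rparr>"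

definition null_sequences :: "'a ring \<Rightarrow> ('a \<Rightarrow> real) \<Rightarrow> (nat \<Rightarrow> 'a) set" where
  "null_sequences S q = {x \<in> carrier (cauchy_ring S q). (\<lambda>n. q (x n)) \<longlonglongrightarrow> 0}"

definition completion :: "'a ring \<Rightarrow> ('a \<Rightarrow> real) \<Rightarrow> (nat \<Rightarrow> 'a) set ring" where
  "completion S q = cauchy_ring S q Quot null_sequences S q"

definition completion_norm :: "('a \<Rightarrow> real) \<Rightarrow> (nat \<Rightarrow> 'a) set \<Rightarrow> real" where
  "completion_norm q Z = lim (\<lambda>n. q ((SOME x. x \<in> Z) n))"

definition to_completion :: "'a ring \<Rightarrow> ('a \<Rightarrow> real) \<Rightarrow> 'a \<Rightarrow> (nat \<Rightarrow> 'a) set" where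
  "to_completion S q a = null_sequences S q +>\<^bsub>cauchy_ring S q\<^esub> (\<lambda>n. a)"


section \<open>Tensor products of subrings of a commutative ring\<close>

text \<open>For a finite family of subrings \<open>A \<alpha>\<close> of \<open>C\<close> (\<open>\<alpha> \<in> \<Delta>\<close>, \<open>\<Delta>\<close> nonempty) that contain a subring
  \<open>A0\<close>, the tensor product over \<open>A0\<close> is the free abelian group on the tuples, with the
  product that multiplies tuples componentwise, modulo the relations of additivity in each
  slot and of moving scalars from \<open>A0\<close> between slots.\<close>

type_synonym 'c formal_tensor = "(nat \<Rightarrow> 'c) \<Rightarrow>\<^sub>0 int"
type_synonym 'c tensor = "'c formal_tensor set"

definition formal_tensor_ring ::
    "'c ring \<Rightarrow> nat set \<Rightarrow> (nat \<Rightarrow> 'c set) \<Rightarrow> 'c formal_tensor ring" where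
  "formal_tensor_ring C \<Delta> A =
     \<lparr> carrier = {x. Poly_Mapping.keys x \<subseteq> PiE \<Delta> A},
       monoid.mult = (\<lambda>x y. frag_extend
                 (\<lambda>f. frag_extend (\<lambda>g. frag_of (\<lambda>\<alpha>\<in>\<Delta>. f \<alpha> \<otimes>\<^bsub>C\<^esub> g \<alpha>)) y) x),
       one = frag_of (\<lambda>\<alpha>\<in>\<Delta>. \<one>\<^bsub>C\<^esub>), zero = 0, add = (+) \<rparr>"

definition tensor_relations ::
    "'c ring \<Rightarrow> nat set \<Rightarrow> 'c set \<Rightarrow> (nat \<Rightarrow> 'c set) \<Rightarrow> 'c formal_tensor set" where
  "tensor_relations C \<Delta> A0 A =
     {frag_of (f(\<alpha> := a \<oplus>\<^bsub>C\<^esub> b)) - frag_of (f(\<alpha> := a)) - frag_of (f(\<alpha> := b)) |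
        f \<alpha> a b. f \<in> PiE \<Delta> A \<and> \<alpha> \<in> \<Delta> \<and> a \<in> A \<alpha> \<and> b \<in> A \<alpha>} \<union>
     {frag_of (f(\<alpha> := k \<otimes>\<^bsub>C\<^esub> f \<alpha>)) - frag_of (f(\<beta> := k \<otimes>\<^bsub>C\<^esub> f \<beta>)) |
        f \<alpha> \<beta> k. f \<in> PiE \<Delta> A \<and> \<alpha> \<in> \<Delta> \<and> \<beta> \<in> \<Delta> \<and> k \<in> A0}"

definition tensor_ideal ::
    "'c ring \<Rightarrow> nat set \<Rightarrow> 'c set \<Rightarrow> (nat \<Rightarrow> 'c set) \<Rightarrow> 'c formal_tensor set" where
  "tensor_ideal C \<Delta> A0 A = Idl\<^bsub>formal_tensor_ring C \<Delta> A\<^esub> (tensor_relations C \<Delta> A0 A)"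

definition tensor_ring ::
    "'c ring \<Rightarrow> nat set \<Rightarrow> 'c set \<Rightarrow> (nat \<Rightarrow> 'c set) \<Rightarrow> 'c tensor ring" where
  "tensor_ring C \<Delta> A0 A = formal_tensor_ring C \<Delta> A Quot tensor_ideal C \<Delta> A0 A"

text \<open>A list \<open>fs\<close> of tuples stands for the sum of the elementary tensors of its entries. The
  inserted 0 is the value of the empty maximum.\<close>

definition tensor_seminorm ::
    "('c \<Rightarrow> real) \<Rightarrow> nat set \<Rightarrow> (nat \<Rightarrow> 'c set) \<Rightarrow> 'c tensor \<Rightarrow> real" where
  "tensor_seminorm v \<Delta> A Z =
     Inf {Max (insert 0 ((\<lambda>f. \<Prod>\<alpha>\<in>\<Delta>. v (f \<alpha>)) ` set fs)) | fs.
            set fs \<subseteq> PiE \<Delta> A \<and> sum_list (map frag_of fs) \<in> Z}"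

definition completed_tensor ::
    "'c ring \<Rightarrow> ('c \<Rightarrow> real) \<Rightarrow> nat set \<Rightarrow> 'c set \<Rightarrow> (nat \<Rightarrow> 'c set) \<Rightarrow> (nat \<Rightarrow> 'c tensor) set ring"
  where
  "completed_tensor C v \<Delta> A0 A =
     completion (tensor_ring C \<Delta> A0 A) (tensor_seminorm v \<Delta> A)"

definition completed_tensor_norm ::
    "('c \<Rightarrow> real) \<Rightarrow> nat set \<Rightarrow> (nat \<Rightarrow> 'c set) \<Rightarrow> (nat \<Rightarrow> 'c tensor) set \<Rightarrow> real" where
  "completed_tensor_norm v \<Delta> A = completion_norm (tensor_seminorm v \<Delta> A)"

text \<open>The image of the elementary tensor of the tuple \<open>f\<close>.\<close>

definition pure_tensor ::
    "'c ring \<Rightarrow> ('c \<Rightarrow> real) \<Rightarrow> nat set \<Rightarrow> 'c set \<Rightarrow> (nat \<Rightarrow> 'c set) \<Rightarrow> (nat \<Rightarrow> 'c)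
       \<Rightarrow> (nat \<Rightarrow> 'c tensor) set" where
  "pure_tensor C v \<Delta> A0 A f =
     to_completion (tensor_ring C \<Delta> A0 A) (tensor_seminorm v \<Delta> A)
       (tensor_ideal C \<Delta> A0 A +>\<^bsub>formal_tensor_ring C \<Delta> A\<^esub> frag_of f)"


section \<open>Inverse limits along the p-th power map, total rings of fractions\<close>

definition p_compatible :: "nat \<Rightarrow> ('a, 'm) ring_scheme \<Rightarrow> (nat \<Rightarrow> 'a) set" where
  "p_compatible p S = {x. \<forall>n. x n \<in> carrier S \<and> x (Suc n) [^]\<^bsub>S\<^esub> p = x n}"

text \<open>For a ring \<open>S\<close> of characteristic \<open>p\<close>.\<close>

definition frobenius_limit :: "nat \<Rightarrow> 'a ring \<Rightarrow> (nat \<Rightarrow> 'a) ring" where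
  "frobenius_limit p S =
     \<lparr> carrier = p_compatible p S,
       monoid.mult = (\<lambda>x y n. x n \<otimes>\<^bsub>S\<^esub> y n), one = (\<lambda>n. \<one>\<^bsub>S\<^esub>),
       zero = (\<lambda>n. \<zero>\<^bsub>S\<^esub>), add = (\<lambda>x y n. x n \<oplus>\<^bsub>S\<^esub> y n) \<rparr>"

text \<open>The tilt of a perfectoid subfield \<open>L\<close> of \<open>C\<close>, realised on the \<open>p\<close>-power compatible sequences
  \<open>x\<close> in \<open>L\<close>: products are componentwise and the \<open>n\<close>-th component of a sum \<open>x + y\<close> is the limit
  of \<open>(x (n + m) + y (n + m)) ^ (p ^ m)\<close>. The absolute value of \<open>x\<close> is that of \<open>x 0\<close>.\<close>

definition tilt_field :: "nat \<Rightarrow> 'c ring \<Rightarrow> ('c \<Rightarrow> real) \<Rightarrow> 'c set \<Rightarrow> (nat \<Rightarrow> 'c) ring" where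
  "tilt_field p C v L =
     \<lparr> carrier = p_compatible p (C\<lparr>carrier := L\<rparr>),
       monoid.mult = (\<lambda>x y n. x n \<otimes>\<^bsub>C\<^esub> y n), one = (\<lambda>n. \<one>\<^bsub>C\<^esub>),
       zero = (\<lambda>n. \<zero>\<^bsub>C\<^esub>),
       add = (\<lambda>x y n. THE l. limitin (norm_topology C v)
                (\<lambda>m. (x (n + m) \<oplus>\<^bsub>C\<^esub> y (n + m)) [^]\<^bsub>C\<^esub> (p ^ m)) l sequentially) \<rparr>"

definition tilt_abs :: "('c \<Rightarrow> real) \<Rightarrow> (nat \<Rightarrow> 'c) \<Rightarrow> real" where
  "tilt_abs v x = v (x 0)"

definition non_zero_divisors :: "'a ring \<Rightarrow> 'a set" where
  "non_zero_divisors S =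
     {a \<in> carrier S. \<forall>b\<in>carrier S. a \<otimes>\<^bsub>S\<^esub> b = \<zero>\<^bsub>S\<^esub> \<longrightarrow> b = \<zero>\<^bsub>S\<^esub>}"

text \<open>\<open>Q\<close>, together with \<open>i : S \<rightarrow> Q\<close>, is the localisation of \<open>S\<close> at its non-zero-divisors. This
  determines \<open>(Q, i)\<close> up to unique isomorphism, so it also expresses that \<open>Q\<close> is isomorphic to
  the total ring of fractions of \<open>S\<close>.\<close>

definition total_fraction_ring :: "'a ring \<Rightarrow> 'b ring \<Rightarrow> ('a \<Rightarrow> 'b) \<Rightarrow> bool" where
  "total_fraction_ring S Q i \<longleftrightarrow>
     cring Q \<and> i \<in> ring_hom S Q \<and> inj_on i (carrier S) \<and>
     i ` non_zero_divisors S \<subseteq> Units Q \<and>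
     (\<forall>z\<in>carrier Q. \<exists>a\<in>carrier S. \<exists>b\<in>non_zero_divisors S. z = i a \<otimes>\<^bsub>Q\<^esub> inv\<^bsub>Q\<^esub> (i b))"


section \<open>Perfectoid \<open>\<Delta>\<close>-fields\<close>

locale perfectoid_data =
  fixes p t :: nat
    and C :: "'c ring" and v :: "'c \<Rightarrow> real"
    and K0 :: "'c set" and K :: "nat \<Rightarrow> 'c set"
  assumes prime_p: "Factorial_Ring.prime p"
    and t_pos: "1 \<le> t"
    and field_C: "field C"
    and abs_v: "nonarch_abs C v"
    and K0_p_adic: "p_adic_field p C v K0"
    and C_completion: "completed_algebraic_closure C v K0"
    and K_perfectoid: "\<And>\<alpha>. \<alpha> \<in> {1..t} \<Longrightarrow> perfectoid_field p C v (K \<alpha>)"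
    and K0_subset: "\<And>\<alpha>. \<alpha> \<in> {1..t} \<Longrightarrow> K0 \<subseteq> K \<alpha>"
begin

abbreviation Delta :: "nat set" ("\<Delta>") where "\<Delta> \<equiv> {1..t}"

definition O0 :: "'c set" where "O0 = {x \<in> K0. v x \<le> 1}"
definition OK :: "nat \<Rightarrow> 'c set" where "OK \<alpha> = {x \<in> K \<alpha>. v x \<le> 1}"

definition K_Delta :: "(nat \<Rightarrow> 'c tensor) set ring" where
  "K_Delta = completed_tensor C v \<Delta> K0 K"

definition K_Delta_int :: "(nat \<Rightarrow> 'c tensor) set ring" where
  "K_Delta_int = completed_tensor C v \<Delta> O0 OK"

text \<open>Only the values \<open>s \<alpha> x\<close> with \<open>\<alpha> \<in> \<Delta>\<close> and \<open>x \<in> K \<alpha>\<close> matter; families that agree there are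
  identified by \<open>emb_equiv\<close> below.\<close>

definition embeddings :: "(nat \<Rightarrow> 'c \<Rightarrow> 'c) set" where
  "embeddings = {s. \<forall>\<alpha>\<in>\<Delta>. s \<alpha> \<in> ring_hom (C\<lparr>carrier := K \<alpha>\<rparr>) C \<and>
     (\<forall>x\<in>K0. s \<alpha> x = x) \<and>
     continuous_map (norm_topology (C\<lparr>carrier := K \<alpha>\<rparr>) v) (norm_topology C v) (s \<alpha>)}"

text \<open>\<open>C\<close> is complete, so the completion of the compositum is its closure.\<close>

definition K_emb :: "(nat \<Rightarrow> 'c \<Rightarrow> 'c) \<Rightarrow> 'c set" where
  "K_emb s = norm_topology C v closure_of (generate_field C (\<Union>\<alpha>\<in>\<Delta>. s \<alpha> ` K \<alpha>))"

definition emb_equiv :: "((nat \<Rightarrow> 'c \<Rightarrow> 'c) \<times> (nat \<Rightarrow> 'c \<Rightarrow> 'c)) set" where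
  "emb_equiv = {(s, s'). s \<in> embeddings \<and> s' \<in> embeddings \<and>
     (\<exists>u \<in> ring_iso (C\<lparr>carrier := K_emb s\<rparr>) (C\<lparr>carrier := K_emb s'\<rparr>).
        continuous_map (norm_topology (C\<lparr>carrier := K_emb s\<rparr>) v)
          (norm_topology (C\<lparr>carrier := K_emb s'\<rparr>) v) u \<and>
        (\<forall>\<alpha>\<in>\<Delta>. \<forall>x\<in>K \<alpha>. s' \<alpha> x = u (s \<alpha> x)))}"

definition emb_classes :: "(nat \<Rightarrow> 'c \<Rightarrow> 'c) set set" where
  "emb_classes = embeddings // emb_equiv"

text \<open>\<open>b\<close> is the continuous homomorphism to the completed compositum given on elementary tensors
  by multiplying the \<open>s \<alpha> (x \<alpha>)\<close>. For \<open>(A0, A) = (K0, K)\<close> it is \<open>\<beta>\<^sub>s\<close>; for \<open>(A0, A) = (O0, OK)\<close>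
  it is \<open>\<beta>\<^sub>s\<close> on \<open>K_Delta_int\<close>.\<close>

definition is_beta ::
    "'c set \<Rightarrow> (nat \<Rightarrow> 'c set) \<Rightarrow> (nat \<Rightarrow> 'c \<Rightarrow> 'c) \<Rightarrow> ((nat \<Rightarrow> 'c tensor) set \<Rightarrow> 'c) \<Rightarrow> bool" where
  "is_beta A0 A s b \<longleftrightarrow>
     b \<in> ring_hom (completed_tensor C v \<Delta> A0 A) (C\<lparr>carrier := K_emb s\<rparr>) \<and>
     continuous_map
       (norm_topology (completed_tensor C v \<Delta> A0 A) (completed_tensor_norm v \<Delta> A))
       (norm_topology (C\<lparr>carrier := K_emb s\<rparr>) v) b \<and>
     (\<forall>x \<in> PiE \<Delta> A. b (pure_tensor C v \<Delta> A0 A x) = (\<Otimes>\<^bsub>C\<^esub>\<alpha>\<in>\<Delta>. s \<alpha> (x \<alpha>)))"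

text \<open>In both kinds the datum \<open>absR \<sigma> \<lambda>\<close> is the absolute value of \<open>\<beta>\<^sub>s(\<lambda>)\<close> for
  \<open>s\<close> in the class \<open>\<sigma>\<close>; it does not depend on the choice of \<open>s\<close>, because the isomorphism between
  the completed composita of equivalent families is isometric.\<close>

definition mixed_perfectoid_Delta_field ::
    "'r ring \<Rightarrow> ((nat \<Rightarrow> 'c \<Rightarrow> 'c) set \<Rightarrow> 'r \<Rightarrow> real) \<Rightarrow> bool" where
  "mixed_perfectoid_Delta_field R absR \<longleftrightarrow>
     (\<exists>\<phi> b. \<phi> \<in> ring_iso R K_Delta \<and>
        (\<forall>s\<in>embeddings. is_beta K0 K s (b s)) \<and>
        (\<forall>\<sigma>\<in>emb_classes. \<forall>s\<in>\<sigma>. \<forall>l\<in>carrier R. absR \<sigma> l = v (b s (\<phi> l))))"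

definition varpi_family :: "(nat \<Rightarrow> 'c) \<Rightarrow> bool" where
  "varpi_family w \<longleftrightarrow> (\<forall>\<alpha>\<in>\<Delta>. w \<alpha> \<in> K \<alpha> \<and> v (p_elem p C) \<le> v (w \<alpha>) \<and> v (w \<alpha>) < 1)"

definition I_varpi :: "(nat \<Rightarrow> 'c) \<Rightarrow> (nat \<Rightarrow> 'c tensor) set set" where
  "I_varpi w = Idl\<^bsub>K_Delta_int\<^esub>
     ((\<lambda>\<alpha>. pure_tensor C v \<Delta> O0 OK (\<lambda>\<beta>\<in>\<Delta>. if \<beta> = \<alpha> then w \<alpha> else \<one>\<^bsub>C\<^esub>)) ` \<Delta>)"

definition K_Delta_int_flat :: "(nat \<Rightarrow> 'c) \<Rightarrow> (nat \<Rightarrow> (nat \<Rightarrow> 'c tensor) set set) ring" where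
  "K_Delta_int_flat w = frobenius_limit p (K_Delta_int Quot I_varpi w)"

text \<open>\<open>flat_class w y\<close> is the element of \<open>K_Delta_int_flat w\<close> that corresponds to the
  \<open>p\<close>-power compatible sequence \<open>y\<close> in \<open>K_Delta_int\<close> under the multiplicative identification of the
  two inverse limits.\<close>

definition flat_class ::
    "(nat \<Rightarrow> 'c) \<Rightarrow> (nat \<Rightarrow> (nat \<Rightarrow> 'c tensor) set) \<Rightarrow> nat \<Rightarrow> (nat \<Rightarrow> 'c tensor) set set" where
  "flat_class w y = (\<lambda>n. I_varpi w +>\<^bsub>K_Delta_int\<^esub> y n)"

text \<open>The fractions on which \<open>\<beta>\<^sub>s\<close>, extended from \<open>K_Delta_int_flat w\<close>, is defined: those that have
  a denominator with nonzero image. This is all of \<open>R\<close> if \<open>\<beta>\<^sub>s\<close> kills no non-zero-divisor of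
  \<open>K_Delta_int_flat w\<close>, but for \<open>t \<ge> 2\<close> it can be smaller. Here \<open>b\<close> stands for \<open>\<beta>\<^sub>s\<close> on
  \<open>K_Delta_int\<close>.\<close>

definition flat_domain ::
    "(nat \<Rightarrow> 'c) \<Rightarrow> 'r ring \<Rightarrow> ((nat \<Rightarrow> (nat \<Rightarrow> 'c tensor) set set) \<Rightarrow> 'r) \<Rightarrow>
      ((nat \<Rightarrow> 'c tensor) set \<Rightarrow> 'c) \<Rightarrow> 'r set" where
  "flat_domain w R i b =
     {i (flat_class w y) \<otimes>\<^bsub>R\<^esub> inv\<^bsub>R\<^esub> (i (flat_class w z)) | y z.
        y \<in> p_compatible p K_Delta_int \<and> z \<in> p_compatible p K_Delta_int \<and>
        flat_class w z \<in> non_zero_divisors (K_Delta_int_flat w) \<and>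
        (\<lambda>n. b (z n)) \<noteq> (\<lambda>n. \<zero>\<^bsub>C\<^esub>)}"

text \<open>The maps \<open>bf s\<close> are the \<open>\<beta>\<^sub>s\<close> of the equicharacteristic case, with values in the tilt of
  \<open>K_emb s\<close>; they are given on \<open>K_Delta_int_flat w\<close> by applying \<open>\<beta>\<^sub>s\<close> componentwise. Nothing is
  required of \<open>absR\<close> at elements outside \<open>flat_domain\<close>.\<close>

definition equichar_perfectoid_Delta_field ::
    "'r ring \<Rightarrow> ((nat \<Rightarrow> 'c \<Rightarrow> 'c) set \<Rightarrow> 'r \<Rightarrow> real) \<Rightarrow> bool" where
  "equichar_perfectoid_Delta_field R absR \<longleftrightarrow>
     (\<exists>w i b bf. varpi_family w \<and>
        total_fraction_ring (K_Delta_int_flat w) R i \<and>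
        (\<forall>s\<in>embeddings. is_beta O0 OK s (b s)) \<and>
        (\<forall>s\<in>embeddings.
           bf s \<in> ring_hom (R\<lparr>carrier := flat_domain w R i (b s)\<rparr>) (tilt_field p C v (K_emb s)) \<and>
           (\<forall>y \<in> p_compatible p K_Delta_int. bf s (i (flat_class w y)) = (\<lambda>n. b s (y n)))) \<and>
        (\<forall>\<sigma>\<in>emb_classes. \<forall>s\<in>\<sigma>. \<forall>l\<in>flat_domain w R i (b s).
           absR \<sigma> l = tilt_abs v (bf s l)))"

definition perfectoid_Delta_field ::
    "'r ring \<Rightarrow> ((nat \<Rightarrow> 'c \<Rightarrow> 'c) set \<Rightarrow> 'r \<Rightarrow> real) \<Rightarrow> bool" where
  "perfectoid_Delta_field R absR \<longleftrightarrow>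
     mixed_perfectoid_Delta_field R absR \<or> equichar_perfectoid_Delta_field R absR"

end


section \<open>Banach spaces\<close>

text \<open>\<open>R\<close> is the ring of scalars, with seminorms \<open>absR \<sigma>\<close> indexed by \<open>\<sigma> \<in> \<SS>\<close>.\<close>

definition sup_norm :: "'s set \<Rightarrow> ('s \<Rightarrow> 'e \<Rightarrow> real) \<Rightarrow> 'e \<Rightarrow> real" where
  "sup_norm \<SS> nrm x = (SUP \<sigma>\<in>\<SS>. nrm \<sigma> x)"

text \<open>The boundedness condition expresses that \<^const>\<open>sup_norm\<close> is a real-valued norm, so that it
  gives a metric.\<close>

definition normed_space ::
    "'r ring \<Rightarrow> 's set \<Rightarrow> ('s \<Rightarrow> 'r \<Rightarrow> real) \<Rightarrow> ('r, 'e) module \<Rightarrow> ('s \<Rightarrow> 'e \<Rightarrow> real) \<Rightarrow> bool" where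
  "normed_space R \<SS> absR M nrm \<longleftrightarrow>
     module R M \<and>
     (\<forall>\<sigma>\<in>\<SS>. \<forall>x\<in>carrier M. 0 \<le> nrm \<sigma> x) \<and>
     (\<forall>\<sigma>\<in>\<SS>. \<forall>x\<in>carrier M. \<forall>y\<in>carrier M. nrm \<sigma> (x \<oplus>\<^bsub>M\<^esub> y) \<le> max (nrm \<sigma> x) (nrm \<sigma> y)) \<and>
     (\<forall>\<sigma>\<in>\<SS>. \<forall>l\<in>carrier R. \<forall>x\<in>carrier M. nrm \<sigma> (l \<odot>\<^bsub>M\<^esub> x) = absR \<sigma> l * nrm \<sigma> x) \<and>
     (\<Inter>\<sigma>\<in>\<SS>. {x \<in> carrier M. nrm \<sigma> x = 0}) = {\<zero>\<^bsub>M\<^esub>} \<and>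
     (\<forall>x\<in>carrier M. bdd_above ((\<lambda>\<sigma>. nrm \<sigma> x) ` \<SS>))"

definition space_topology :: "'s set \<Rightarrow> ('r, 'e) module \<Rightarrow> ('s \<Rightarrow> 'e \<Rightarrow> real) \<Rightarrow> 'e topology" where
  "space_topology \<SS> M nrm = norm_topology M (sup_norm \<SS> nrm)"

definition banach_space ::
    "'r ring \<Rightarrow> 's set \<Rightarrow> ('s \<Rightarrow> 'r \<Rightarrow> real) \<Rightarrow> ('r, 'e) module \<Rightarrow> ('s \<Rightarrow> 'e \<Rightarrow> real) \<Rightarrow> bool" where
  "banach_space R \<SS> absR M nrm \<longleftrightarrow>
     normed_space R \<SS> absR M nrm \<and> norm_complete M (sup_norm \<SS> nrm)"

definition normed_morphism ::
    "'r ring \<Rightarrow> 's set \<Rightarrow> ('r, 'e) module \<Rightarrow> ('s \<Rightarrow> 'e \<Rightarrow> real) \<Rightarrow>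
      ('r, 'f) module \<Rightarrow> ('s \<Rightarrow> 'f \<Rightarrow> real) \<Rightarrow> ('e \<Rightarrow> 'f) \<Rightarrow> bool" where
  "normed_morphism R \<SS> M nrmM N nrmN T \<longleftrightarrow>
     T \<in> carrier M \<rightarrow> carrier N \<and>
     (\<forall>x\<in>carrier M. \<forall>y\<in>carrier M. T (x \<oplus>\<^bsub>M\<^esub> y) = T x \<oplus>\<^bsub>N\<^esub> T y) \<and>
     (\<forall>l\<in>carrier R. \<forall>x\<in>carrier M. T (l \<odot>\<^bsub>M\<^esub> x) = l \<odot>\<^bsub>N\<^esub> T x) \<and>
     continuous_map (space_topology \<SS> M nrmM) (space_topology \<SS> N nrmN) T"

end

(* The classical proof by Baire's theorem works as soon as there is one invertible scalar l with
   0 < c <= |l|_s <= theta < 1 for all s: multiplication by l and its inverse rescales balls.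

   In mixed characteristic l = p. In equicharacteristic a perfectoid field contains a sequence
   (x_n) with x_(n+1)^p = x_n and 0 < |x_0| < 1, and l is the image of (x_n) in the first tensor
   factor. It remains to see that l is not a zero divisor of lim K_Delta_int / I. First,
   multiplication by x_n is injective on the completed tensor product of the valuation rings O_i:
   the algebraic tensor product is torsion-free, because finitely generated submodules of the O_i
   are free with coordinates that extend to K0-linear functionals on the K_i, and multiplication by
   x_n is bounded below for the tensor seminorm. Second, if x_n a_n lies in I for a compatible
   sequence (a_n), then for large k the element x_n a_(n+k)^(p^k) = (x_(n+k) a_(n+k))^(p^k) lies in
   x_n I, because a power of I is contained in x_n I; so a_n = a_(n+k)^(p^k) = 0 modulo I. *)

theory Submission
  imports
    Defs
    "HOL-Algebra.Free_Abelian_Groups"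
    "HOL-Analysis.Urysohn"
begin

section \<open>Ultrametric norms on abelian groups\<close>

text \<open>The norm of a space is a supremum over all classes s, so the scalar l has to be
  controlled uniformly in s. Embeddings are only assumed to be continuous and to fix K0, hence p;
  comparing powers of x_0 with powers of p gives bounds common to all of them. In equicharacteristic
  the scalars form a ring of fractions, so a unit is obtained from a non-zero-divisor, and
  \<open>absR\<close> is prescribed only on \<open>flat_domain\<close>; l is therefore written with
  denominator 1, which every beta_s maps to 1. Injectivity of multiplication on the algebraic tensor
  product need not survive completion, since a Cauchy sequence could become null after
  multiplication. Hence the quantitative form: a tensor with a small multiple is small. Its constant
  carries one factor |p| per slot, because only scalars from K0 move between slots and powers of p
  match the absolute values in K_i only up to a factor |p|.\<close>

locale ultraseminormed_group = abelian_group M for M (structure) +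
  fixes n :: "'a \<Rightarrow> real"
  assumes norm_nonneg: "x \<in> carrier M \<Longrightarrow> 0 \<le> n x"
    and norm_zero [simp]: "n \<zero> = 0"
    and norm_minus_le: "x \<in> carrier M \<Longrightarrow> y \<in> carrier M \<Longrightarrow> n (x \<ominus> y) \<le> max (n x) (n y)"
begin

lemma norm_neg [simp]: assumes "x \<in> carrier M" shows "n (\<ominus> x) = n x"
proof -
  have le: "n (\<ominus> y) \<le> n y" if "y \<in> carrier M" for y
    using norm_minus_le[of \<zero> y] norm_nonneg[OF that] that
    by (simp add: minus_eq l_zero)
  from le[OF assms] le[of "\<ominus> x"] assms show ?thesis by simp
qed

lemma norm_add_le:
  assumes "x \<in> carrier M" "y \<in> carrier M" shows "n (x \<oplus> y) \<le> max (n x) (n y)"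
  using norm_minus_le[of x "\<ominus> y"] assms by (simp add: minus_eq)

lemma norm_minus_commute:
  assumes "x \<in> carrier M" "y \<in> carrier M" shows "n (x \<ominus> y) = n (y \<ominus> x)"
proof -
  have "\<ominus> (x \<ominus> y) = y \<ominus> x" using assms by (simp add: minus_eq minus_add a_comm)
  then show ?thesis using norm_neg[of "x \<ominus> y"] assms by simp
qed

lemma minus_self [simp]: "x \<in> carrier M \<Longrightarrow> x \<ominus> x = \<zero>"
  by (simp add: minus_eq r_neg)

lemma minus_zero_right [simp]: "x \<in> carrier M \<Longrightarrow> x \<ominus> \<zero> = x"
  by (simp add: minus_eq)

lemma add_minus_cancel_right [simp]:
  "x \<in> carrier M \<Longrightarrow> y \<in> carrier M \<Longrightarrow> (x \<oplus> y) \<ominus> y = x"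
  by (simp add: minus_eq a_assoc r_neg)

lemma add_minus_cancel_left [simp]:
  "x \<in> carrier M \<Longrightarrow> y \<in> carrier M \<Longrightarrow> (x \<oplus> y) \<ominus> x = y"
  using add_minus_cancel_right[of y x] by (simp add: a_comm)

lemma minus_add_cancel [simp]:
  "x \<in> carrier M \<Longrightarrow> y \<in> carrier M \<Longrightarrow> (x \<ominus> y) \<oplus> y = x"
  by (simp add: minus_eq a_assoc l_neg)

lemma minus_add_eq:
  "x \<in> carrier M \<Longrightarrow> y \<in> carrier M \<Longrightarrow> z \<in> carrier M \<Longrightarrow> x \<ominus> (y \<oplus> z) = (x \<ominus> y) \<ominus> z"
  by (simp add: minus_eq minus_add a_assoc)

text \<open>Bookkeeping for moving the centre of a ball to 0 in the Baire step: approximants a of x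
  + y and b of y give the approximant a - b of x, with the difference of the two errors.\<close>

lemma minus_minus_minus:
  assumes "x \<in> carrier M" "y \<in> carrier M" "a \<in> carrier M" "b \<in> carrier M"
  shows "((x \<oplus> y) \<ominus> a) \<ominus> (y \<ominus> b) = x \<ominus> (a \<ominus> b)"
proof -
  have "((x \<oplus> y) \<ominus> a) \<ominus> (y \<ominus> b) = x \<oplus> (\<ominus> a \<oplus> (\<ominus> y \<oplus> (y \<oplus> b)))"
    using assms a_lcomm[of "\<ominus> a" "\<ominus> y" b] a_lcomm[of y "\<ominus> a" "\<ominus> y \<oplus> b"]
    by (simp add: minus_eq minus_add a_assoc r_neg1 r_neg2)
  also have "\<dots> = x \<ominus> (a \<ominus> b)"
    using assms by (simp add: r_neg1 minus_eq minus_add)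
  finally show ?thesis .
qed

lemma minus_eq_zero_iff:
  assumes "x \<in> carrier M" "y \<in> carrier M" shows "x \<ominus> y = \<zero> \<longleftrightarrow> x = y"
proof
  assume "x \<ominus> y = \<zero>"
  moreover have "x = (x \<ominus> y) \<oplus> y" using assms by (simp add: minus_eq a_assoc l_neg)
  ultimately show "x = y" using assms by simp
qed (use assms in simp)

lemma minus_split:
  assumes "x \<in> carrier M" "y \<in> carrier M" "z \<in> carrier M"
  shows "x \<ominus> z = (x \<ominus> y) \<oplus> (y \<ominus> z)"
  using assms by (simp add: minus_eq a_assoc r_neg1)

lemma norm_minus_trans:
  assumes "x \<in> carrier M" "y \<in> carrier M" "z \<in> carrier M"
  shows "n (x \<ominus> z) \<le> max (n (x \<ominus> y)) (n (y \<ominus> z))"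
  using norm_add_le[of "x \<ominus> y" "y \<ominus> z"] minus_split[OF assms] assms by simp

text \<open>Ultrametric triangles are isosceles. This later identifies the absolute value of a limit
  with that of an approximation.\<close>

lemma norm_eq_if_close:
  assumes "x \<in> carrier M" "y \<in> carrier M" "n (x \<ominus> y) < n y"
  shows "n x = n y"
proof (rule antisym)
  have "x = (x \<ominus> y) \<oplus> y" using assms(1,2) by (simp add: minus_eq a_assoc l_neg)
  then show "n x \<le> n y" using norm_add_le[of "x \<ominus> y" y] assms by simp
  have "y = x \<ominus> (x \<ominus> y)" using assms(1,2)
    by (simp add: minus_eq minus_add a_assoc[symmetric] r_neg)
  then show "n y \<le> n x" using norm_minus_le[of x "x \<ominus> y"] assms by simp
qed

end

locale ultranormed_group = ultraseminormed_group +
  assumes norm_zeroD: "x \<in> carrier M \<Longrightarrow> n x = 0 \<Longrightarrow> x = \<zero>"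
begin

lemma norm_zero_iff: "x \<in> carrier M \<Longrightarrow> n x = 0 \<longleftrightarrow> x = \<zero>"
  using norm_zeroD by auto

sublocale MS: Metric_space "carrier M" "norm_dist M n"
proof
  fix x y z
  show "0 \<le> norm_dist M n x y" by (simp add: norm_dist_def norm_nonneg)
  show "norm_dist M n x y = norm_dist M n y x"
    by (simp add: norm_dist_def norm_minus_commute)
  assume x: "x \<in> carrier M" and y: "y \<in> carrier M"
  then show "norm_dist M n x y = 0 \<longleftrightarrow> x = y"
    by (auto simp: norm_dist_def norm_zero_iff minus_eq_zero_iff)
  assume z: "z \<in> carrier M"
  show "norm_dist M n x z \<le> norm_dist M n x y + norm_dist M n y z"
    using norm_minus_trans[OF x y z] norm_nonneg[of "x \<ominus> y"] norm_nonneg[of "y \<ominus> z"] x y z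
    by (simp add: norm_dist_def)
qed

lemma norm_topology_eq: "norm_topology M n = MS.mtopology"
  by (simp add: norm_topology_def)

lemma topspace_norm_topology [simp]: "topspace (norm_topology M n) = carrier M"
  by (simp add: norm_topology_eq)

lemma limitin_norm_iff:
  assumes "range s \<subseteq> carrier M"
  shows "limitin (norm_topology M n) s l sequentially \<longleftrightarrow>
    l \<in> carrier M \<and> (\<forall>e>0. \<exists>N. \<forall>k\<ge>N. n (s k \<ominus> l) < e)"
  using assms
  by (auto simp: norm_topology_eq MS.limitin_metric eventually_sequentially norm_dist_def image_subset_iff)

lemma openin_norm_iff:
  "openin (norm_topology M n) U \<longleftrightarrow>
     U \<subseteq> carrier M \<and> (\<forall>x\<in>U. \<exists>r>0. \<forall>y\<in>carrier M. n (y \<ominus> x) < r \<longrightarrow> y \<in> U)"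
proof -
  have "MS.mball x r \<subseteq> U \<longleftrightarrow> (\<forall>y\<in>carrier M. n (y \<ominus> x) < r \<longrightarrow> y \<in> U)" if "x \<in> carrier M" for x r
    using that by (auto simp: norm_dist_def norm_minus_commute subset_iff)
  then show ?thesis
    unfolding norm_topology_eq MS.openin_mtopology by (meson subsetD)
qed

text \<open>For an ultrametric norm, increments tending to 0 already make a Cauchy sequence, and the
  distance from \<open>s k\<close> to a later term is at most the largest increment in between.
  Monotonicity of \<open>b\<close> turns this into the bound \<open>b k\<close>, which passes to the
  limit.\<close>

lemma convergent_if_increments_null:
  assumes compl: "norm_complete M n"
    and s: "range s \<subseteq> carrier M" and b: "b \<longlonglongrightarrow> (0::real)" and "decseq b"
    and inc: "\<And>k. n (s (Suc k) \<ominus> s k) \<le> b k"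
  obtains l where "l \<in> carrier M" "limitin (norm_topology M n) s l sequentially"
    "\<And>k. n (l \<ominus> s k) \<le> b k"
proof -
  have sc: "s k \<in> carrier M" for k using s by auto
  have b0: "0 \<le> b k" for k using inc[of k] norm_nonneg[of "s (Suc k) \<ominus> s k"] sc by (meson minus_closed order_trans)
  have diff: "n (s (k + j) \<ominus> s k) \<le> b k" for k j
  proof (induction j)
    case 0 then show ?case using b0[of k] sc[of k] by simp
  next
    case (Suc j)
    have "n (s (Suc (k + j)) \<ominus> s (k + j)) \<le> b k"
      using inc[of "k + j"] decseqD[OF \<open>decseq b\<close>, of k "k + j"] by simp
    then show ?case using Suc norm_minus_trans[OF sc sc sc, of "Suc (k + j)" k "k + j"] by simp
  qed
  have "MS.MCauchy s"
    unfolding MS.MCauchy_def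
  proof (intro conjI s allI impI)
    fix e :: real assume "e > 0"
    then obtain N where N: "b N < e"
      using order_tendstoD(2)[OF b \<open>e > 0\<close>] by (auto simp: eventually_sequentially)
    have "norm_dist M n (s i) (s j) < e" if "N \<le> i" "N \<le> j" for i j
    proof -
      have ij: "i = N + (i - N)" "j = N + (j - N)" using that by simp_all
      have "n (s i \<ominus> s j) \<le> max (n (s i \<ominus> s N)) (n (s j \<ominus> s N))"
        using norm_minus_trans[OF sc sc sc, of i j N] norm_minus_commute[OF sc sc, of N j] by simp
      then show ?thesis using diff[of N "i - N"] diff[of N "j - N"] N ij sc by (simp add: norm_dist_def)
    qed
    then show "\<exists>N. \<forall>i j. N \<le> i \<longrightarrow> N \<le> j \<longrightarrow> norm_dist M n (s i) (s j) < e" by blast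
  qed
  then obtain l where lim: "limitin (norm_topology M n) s l sequentially"
    using compl by (auto simp: norm_complete_def MS.mcomplete_def norm_topology_eq)
  then have l: "l \<in> carrier M" and L: "\<forall>e>0. \<exists>N. \<forall>k\<ge>N. n (s k \<ominus> l) < e"
    using limitin_norm_iff[OF s] by auto
  have "n (l \<ominus> s k) \<le> b k" for k
  proof (rule field_le_epsilon)
    fix e :: real assume "0 < e"
    then obtain N where N: "\<forall>j\<ge>N. n (s j \<ominus> l) < e" using L by blast
    have "n (l \<ominus> s (k + N)) < e" using N norm_minus_commute[OF l sc] by simp
    then show "n (l \<ominus> s k) \<le> b k + e"
      using norm_minus_trans[OF l sc sc, of k "k + N"] diff[of k N] b0[of k] \<open>0 < e\<close> by linarith
  qed
  with l lim show thesis using that by blast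
qed

end

section \<open>An open mapping theorem with one scaling operator\<close>

text \<open>\<open>lamF\<close> and its inverse \<open>muF\<close> play the role that the powers of a small scalar play over a
  nontrivially valued field.\<close>

locale scaled_epimorphism =
  E: ultranormed_group E nE + F: ultranormed_group F nF
  for E :: "('a, 'm) ring_scheme" and nE and F :: "('b, 'n) ring_scheme" and nF +
  fixes T :: "'a \<Rightarrow> 'b" and lamE :: "'a \<Rightarrow> 'a" and lamF muF :: "'b \<Rightarrow> 'b" and \<theta> c :: real
  assumes E_complete: "norm_complete E nE" and F_complete: "norm_complete F nF"
    and T_add: "x \<in> carrier E \<Longrightarrow> x' \<in> carrier E \<Longrightarrow> T (x \<oplus>\<^bsub>E\<^esub> x') = T x \<oplus>\<^bsub>F\<^esub> T x'"
    and T_surj: "T ` carrier E = carrier F"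
    and T_cont: "continuous_map (norm_topology E nE) (norm_topology F nF) T"
    and lamE_props: "x \<in> carrier E \<Longrightarrow> lamE x \<in> carrier E" "x \<in> carrier E \<Longrightarrow> nE (lamE x) \<le> \<theta> * nE x"
    and T_lam: "x \<in> carrier E \<Longrightarrow> T (lamE x) = lamF (T x)"
    and lamF_props: "y \<in> carrier F \<Longrightarrow> lamF y \<in> carrier F"
      "y \<in> carrier F \<Longrightarrow> z \<in> carrier F \<Longrightarrow> lamF (y \<ominus>\<^bsub>F\<^esub> z) = lamF y \<ominus>\<^bsub>F\<^esub> lamF z"
      "y \<in> carrier F \<Longrightarrow> nF (lamF y) \<le> nF y"
    and muF_props: "y \<in> carrier F \<Longrightarrow> muF y \<in> carrier F" "y \<in> carrier F \<Longrightarrow> lamF (muF y) = y"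
      "y \<in> carrier F \<Longrightarrow> c * nF (muF y) \<le> nF y"
    and theta: "0 \<le> \<theta>" "\<theta> < 1" and c: "0 < c" "c < 1"
begin

lemma T_closed: "x \<in> carrier E \<Longrightarrow> T x \<in> carrier F"
  using T_surj by blast

lemma T_minus: assumes "x \<in> carrier E" "y \<in> carrier E" shows "T (x \<ominus>\<^bsub>E\<^esub> y) = T x \<ominus>\<^bsub>F\<^esub> T y"
proof -
  have "T (x \<ominus>\<^bsub>E\<^esub> y) \<oplus>\<^bsub>F\<^esub> T y = T x"
    using T_add[of "x \<ominus>\<^bsub>E\<^esub> y" y] assms by simp
  then show ?thesis using F.add_minus_cancel_right T_closed assms by (metis E.minus_closed)
qed

text \<open>Baire: the closures of the images of the balls of integer radius cover \<open>F\<close>,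
  so one of them contains a ball around some y0. Subtracting an approximant of y0 keeps the radius k
  because the norm is ultrametric, so the centre moves to 0 without loss.\<close>

lemma almost_open_unit:
  obtains k r where "0 < r" "0 \<le> k"
    "\<And>y e. y \<in> carrier F \<Longrightarrow> nF y < r \<Longrightarrow> 0 < e \<Longrightarrow>
       \<exists>x\<in>carrier E. nE x \<le> k \<and> nF (y \<ominus>\<^bsub>F\<^esub> T x) < e"
proof -
  define B where "B k = {x \<in> carrier E. nE x \<le> real k}" for k :: nat
  define G where "G k = F.MS.mtopology closure_of (T ` B k)" for k
  have "carrier F \<subseteq> \<Union>(range G)"
  proof
    fix y assume "y \<in> carrier F"
    then obtain x where x: "x \<in> carrier E" "y = T x" using T_surj by blast
    obtain k :: nat where "nE x \<le> real k" using real_arch_simple by blast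
    then have "y \<in> T ` B k" using x by (auto simp: B_def)
    moreover have "T ` B k \<subseteq> topspace F.MS.mtopology" using T_closed by (auto simp: B_def)
    ultimately have "y \<in> G k" unfolding G_def by (meson closure_of_subset subsetD)
    then show "y \<in> \<Union>(range G)" by blast
  qed
  moreover have "\<Union>(range G) \<subseteq> carrier F"
    using closure_of_subset_topspace[of F.MS.mtopology] by (auto simp: G_def)
  ultimately have G: "\<Union>(range G) = topspace F.MS.mtopology"
    unfolding F.MS.topspace_mtopology by (rule subset_antisym[rotated])
  \<comment> \<open>Countably many closed sets with empty interior would have a union with empty
    interior, but here the union is the whole space, which contains 0.\<close>
  have "F.MS.mtopology interior_of \<Union>(range G) \<noteq> {}"
    unfolding G interior_of_topspace using F.zero_closed by auto
  moreover have "closedin F.MS.mtopology (G k)" for k by (simp add: G_def)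
  ultimately have "\<exists>k. F.MS.mtopology interior_of G k \<noteq> {}"
    using F.MS.metric_Baire_category_alt[of "range G"] F_complete
    unfolding norm_complete_def by fastforce
  then obtain k y0 where "y0 \<in> F.MS.mtopology interior_of G k" by blast
  then obtain V where V: "openin F.MS.mtopology V" "y0 \<in> V" "V \<subseteq> G k"
    by (auto simp: interior_of_def)
  then obtain r where r: "r > 0" "y0 \<in> carrier F" "F.MS.mball y0 r \<subseteq> G k"
    unfolding F.MS.openin_mtopology by blast
  have near: "\<exists>x\<in>carrier E. nE x \<le> k \<and> nF (y \<ominus>\<^bsub>F\<^esub> T x) < e"
    if "y \<in> carrier F" "nF (y \<ominus>\<^bsub>F\<^esub> y0) < r" "0 < e" for y e
  proof -
    have "y \<in> F.MS.mball y0 r" using that r by (simp add: norm_dist_def F.norm_minus_commute)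
    then have "y \<in> G k" using r by blast
    then obtain z where "z \<in> T ` B k" "z \<in> F.MS.mball y e"
      unfolding G_def F.MS.metric_closure_of using \<open>0 < e\<close> by blast
    then show ?thesis by (auto simp: B_def norm_dist_def T_closed)
  qed
  have "\<exists>x\<in>carrier E. nE x \<le> k \<and> nF (y \<ominus>\<^bsub>F\<^esub> T x) < e"
    if y: "y \<in> carrier F" "nF y < r" "0 < e" for y e
  proof -
    \<comment> \<open>Both y + y0 and y0 lie in the ball around y0, and y is their
      difference.\<close>
    have "(y \<oplus>\<^bsub>F\<^esub> y0) \<ominus>\<^bsub>F\<^esub> y0 = y" using y r by simp
    then obtain a where a: "a \<in> carrier E" "nE a \<le> k" "nF ((y \<oplus>\<^bsub>F\<^esub> y0) \<ominus>\<^bsub>F\<^esub> T a) < e"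
      using near[of "y \<oplus>\<^bsub>F\<^esub> y0" e] y r by auto
    obtain b where b: "b \<in> carrier E" "nE b \<le> k" "nF (y0 \<ominus>\<^bsub>F\<^esub> T b) < e"
      using near[of y0 e] y r by auto
    have "y \<ominus>\<^bsub>F\<^esub> T (a \<ominus>\<^bsub>E\<^esub> b) = ((y \<oplus>\<^bsub>F\<^esub> y0) \<ominus>\<^bsub>F\<^esub> T a) \<ominus>\<^bsub>F\<^esub> (y0 \<ominus>\<^bsub>F\<^esub> T b)"
      using F.minus_minus_minus T_minus T_closed a(1) b(1) y(1) r(2) by simp
    moreover have "nF (((y \<oplus>\<^bsub>F\<^esub> y0) \<ominus>\<^bsub>F\<^esub> T a) \<ominus>\<^bsub>F\<^esub> (y0 \<ominus>\<^bsub>F\<^esub> T b)) < e"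
      using F.norm_minus_le[of "(y \<oplus>\<^bsub>F\<^esub> y0) \<ominus>\<^bsub>F\<^esub> T a" "y0 \<ominus>\<^bsub>F\<^esub> T b"] a b y r T_closed by auto
    moreover have "nE (a \<ominus>\<^bsub>E\<^esub> b) \<le> k" using E.norm_minus_le[of a b] a b by auto
    ultimately show ?thesis using a b by (metis E.minus_closed)
  qed
  then show thesis using that[of r "real k"] r by simp
qed

text \<open>Induction on m: y is divided by l, approximated, and the approximant is multiplied by l.
  Division may enlarge norms by 1/c, which costs a factor c in the radius; multiplication shrinks
  the approximant by \<theta> and does not enlarge the error.\<close>

lemma almost_open:
  obtains k r where "0 < r" "0 \<le> k"
    "\<And>m y e. y \<in> carrier F \<Longrightarrow> nF y < c ^ m * r \<Longrightarrow> 0 < e \<Longrightarrow>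
       \<exists>x\<in>carrier E. nE x \<le> \<theta> ^ m * k \<and> nF (y \<ominus>\<^bsub>F\<^esub> T x) < e"
proof -
  obtain k r where r: "0 < r" "0 \<le> k" and *: "\<And>y e. y \<in> carrier F \<Longrightarrow> nF y < r \<Longrightarrow> 0 < e \<Longrightarrow>
       \<exists>x\<in>carrier E. nE x \<le> k \<and> nF (y \<ominus>\<^bsub>F\<^esub> T x) < e"
    using almost_open_unit by metis
  have "\<exists>x\<in>carrier E. nE x \<le> \<theta> ^ m * k \<and> nF (y \<ominus>\<^bsub>F\<^esub> T x) < e"
    if "y \<in> carrier F" "nF y < c ^ m * r" "0 < e" for m y e
    using that
  proof (induction m arbitrary: y)
    case 0 then show ?case using * by simp
  next
    case (Suc m)
    have "c * nF (muF y) < c * (c ^ m * r)" using muF_props(3)[OF Suc.prems(1)] Suc.prems(2) by (simp add: mult.assoc)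
    then have "nF (muF y) < c ^ m * r" using c by simp
    then obtain x where x: "x \<in> carrier E" "nE x \<le> \<theta> ^ m * k" "nF (muF y \<ominus>\<^bsub>F\<^esub> T x) < e"
      using Suc.IH[of "muF y"] Suc.prems muF_props(1) by blast
    have "nE (lamE x) \<le> \<theta> ^ Suc m * k"
      using lamE_props(2)[OF x(1)] mult_left_mono[OF x(2) theta(1)] by (simp add: mult.assoc)
    moreover have "nF (y \<ominus>\<^bsub>F\<^esub> T (lamE x)) < e"
    proof -
      have "y \<ominus>\<^bsub>F\<^esub> T (lamE x) = lamF (muF y \<ominus>\<^bsub>F\<^esub> T x)"
        using lamF_props(2) muF_props Suc.prems(1) T_closed x(1) T_lam by simp
      then show ?thesis using lamF_props(3)[of "muF y \<ominus>\<^bsub>F\<^esub> T x"] x muF_props(1) Suc.prems(1) T_closed by simp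
    qed
    ultimately show ?case using lamE_props(1) x(1) by blast
  qed
  with r show thesis using that by blast
qed

text \<open>Successive approximation: the j-th correction works at scale m + j, has norm at most
  \<theta>^(m+j) k and leaves an error below c^(m+j+1) r. In an ultrametric group the first
  correction bounds the whole sum, so m only has to satisfy \<theta>^m k < \<rho>.\<close>

lemma ball_in_image:
  assumes "0 < \<rho>"
  obtains d where "0 < d"
    "\<And>y. y \<in> carrier F \<Longrightarrow> nF y < d \<Longrightarrow> \<exists>x\<in>carrier E. nE x < \<rho> \<and> T x = y"
proof -
  obtain k r where r: "0 < r" "0 \<le> k" and *: "\<And>m y e. y \<in> carrier F \<Longrightarrow> nF y < c ^ m * r \<Longrightarrow>
       0 < e \<Longrightarrow> \<exists>x\<in>carrier E. nE x \<le> \<theta> ^ m * k \<and> nF (y \<ominus>\<^bsub>F\<^esub> T x) < e"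
    using almost_open by metis
  have lim: "(\<lambda>m. \<theta> ^ m * k) \<longlonglongrightarrow> 0"
    using LIMSEQ_power_zero[of \<theta>] theta tendsto_mult_left_zero by auto
  obtain m where m: "\<theta> ^ m * k < \<rho>"
    using order_tendstoD(2)[OF lim \<open>0 < \<rho>\<close>] by (auto simp: eventually_sequentially)
  have "\<exists>x\<in>carrier E. nE x < \<rho> \<and> T x = y" if y: "y \<in> carrier F" "nF y < c ^ m * r" for y
  proof -
    define P where "P j x \<longleftrightarrow> x \<in> carrier E \<and> nF (y \<ominus>\<^bsub>F\<^esub> T x) < c ^ (m + j) * r" for j x
    have zero: "T \<zero>\<^bsub>E\<^esub> = \<zero>\<^bsub>F\<^esub>"
      using T_minus[of "\<zero>\<^bsub>E\<^esub>" "\<zero>\<^bsub>E\<^esub>"] T_closed[of "\<zero>\<^bsub>E\<^esub>"] by simp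
    have P0: "P 0 \<zero>\<^bsub>E\<^esub>" using y zero by (simp add: P_def)
    have step: "\<exists>x'. P (Suc j) x' \<and> nE (x' \<ominus>\<^bsub>E\<^esub> x) \<le> \<theta> ^ (m + j) * k" if "P j x" for j x
    proof -
      have x: "x \<in> carrier E" "nF (y \<ominus>\<^bsub>F\<^esub> T x) < c ^ (m + j) * r" using that by (auto simp: P_def)
      have "0 < c ^ (m + Suc j) * r" using c r by simp
      then obtain w where w: "w \<in> carrier E" "nE w \<le> \<theta> ^ (m + j) * k"
        "nF ((y \<ominus>\<^bsub>F\<^esub> T x) \<ominus>\<^bsub>F\<^esub> T w) < c ^ (m + Suc j) * r"
        using *[of "y \<ominus>\<^bsub>F\<^esub> T x" "m + j"] x y T_closed by blast
      have "y \<ominus>\<^bsub>F\<^esub> T (x \<oplus>\<^bsub>E\<^esub> w) = (y \<ominus>\<^bsub>F\<^esub> T x) \<ominus>\<^bsub>F\<^esub> T w"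
        using x w y T_closed T_add by (simp add: F.minus_add_eq)
      moreover have "(x \<oplus>\<^bsub>E\<^esub> w) \<ominus>\<^bsub>E\<^esub> x = w" using x w by simp
      ultimately show ?thesis using w x by (intro exI[of _ "x \<oplus>\<^bsub>E\<^esub> w"]) (simp add: P_def)
    qed
    obtain s where s: "\<And>j. P j (s j)" "\<And>j. nE (s (Suc j) \<ominus>\<^bsub>E\<^esub> s j) \<le> \<theta> ^ (m + j) * k" "s 0 = \<zero>\<^bsub>E\<^esub>"
    proof -
      obtain f where f: "\<And>j x. P j x \<Longrightarrow> P (Suc j) (f j x) \<and> nE (f j x \<ominus>\<^bsub>E\<^esub> x) \<le> \<theta> ^ (m + j) * k"
        using step by metis
      define s where "s = rec_nat \<zero>\<^bsub>E\<^esub> f"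
      have s_simps: "s 0 = \<zero>\<^bsub>E\<^esub>" "\<And>j. s (Suc j) = f j (s j)" by (simp_all add: s_def)
      have "P j (s j)" for j by (induction j) (use P0 f s_simps in auto)
      then show thesis using that[of s] f s_simps by simp
    qed
    have sc: "range s \<subseteq> carrier E" using s(1) by (auto simp: P_def)
    have b: "(\<lambda>j. \<theta> ^ (m + j) * k) \<longlonglongrightarrow> 0" using LIMSEQ_ignore_initial_segment[OF lim, of m] by (simp add: add.commute)
    have bd: "decseq (\<lambda>j. \<theta> ^ (m + j) * k)"
      using theta r by (intro decseq_SucI mult_right_mono power_decreasing) auto
    obtain x where x: "x \<in> carrier E" "limitin (norm_topology E nE) s x sequentially"
      "\<And>j. nE (x \<ominus>\<^bsub>E\<^esub> s j) \<le> \<theta> ^ (m + j) * k"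
      using E.convergent_if_increments_null[OF E_complete sc b bd] s(2) by metis
    have "nE x < \<rho>" using x(3)[of 0] s(3) x(1) m by simp
    \<comment> \<open>The images of the partial sums converge to \<open>T x\<close> by continuity
      and to y by the error bounds.\<close>
    moreover have "T x = y"
    proof -
      have "limitin (norm_topology F nF) (T \<circ> s) (T x) sequentially"
        by (rule continuous_map_limit[OF T_cont x(2)])
      moreover have "limitin (norm_topology F nF) (T \<circ> s) y sequentially"
      proof -
        have rng: "range (T \<circ> s) \<subseteq> carrier F" using sc T_closed by auto
        have lim0: "(\<lambda>j. c ^ (m + j) * r) \<longlonglongrightarrow> 0"
          using LIMSEQ_ignore_initial_segment[OF LIMSEQ_power_zero[of c], of m] c
          by (intro tendsto_mult_left_zero) (simp add: add.commute)
        have close: "nF (T (s j) \<ominus>\<^bsub>F\<^esub> y) < c ^ (m + j) * r" for j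
          using s(1)[of j] F.norm_minus_commute[of y "T (s j)"] y T_closed by (simp add: P_def)
        have "\<exists>N. \<forall>j\<ge>N. nF (T (s j) \<ominus>\<^bsub>F\<^esub> y) < e" if e: "e > 0" for e
        proof -
          obtain N where "\<forall>j\<ge>N. c ^ (m + j) * r < e"
            using order_tendstoD(2)[OF lim0 e] unfolding eventually_sequentially by blast
          then show ?thesis using close by (meson less_trans)
        qed
        then show ?thesis using y by (simp add: F.limitin_norm_iff[OF rng])
      qed
      ultimately show ?thesis
        unfolding F.norm_topology_eq by (rule F.MS.limitin_metric_unique) simp
    qed
    ultimately show ?thesis using x(1) by blast
  qed
  then show thesis using that[of "c ^ m * r"] c r by simp
qed

theorem open_map_T: "open_map (norm_topology E nE) (norm_topology F nF) T"
  unfolding open_map_def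
proof (intro allI impI)
  fix U assume U: "openin (norm_topology E nE) U"
  then have Uc: "U \<subseteq> carrier E" by (simp add: E.openin_norm_iff)
  show "openin (norm_topology F nF) (T ` U)"
    unfolding F.openin_norm_iff
  proof (intro conjI ballI)
    show "T ` U \<subseteq> carrier F" using Uc T_closed by auto
    fix y assume "y \<in> T ` U"
    then obtain x where x: "x \<in> U" "y = T x" by blast
    then have xc: "x \<in> carrier E" using Uc by blast
    obtain \<rho> where \<rho>: "0 < \<rho>" "\<And>z. z \<in> carrier E \<Longrightarrow> nE (z \<ominus>\<^bsub>E\<^esub> x) < \<rho> \<Longrightarrow> z \<in> U"
      using U x(1) by (auto simp: E.openin_norm_iff)
    obtain d where d: "0 < d"
      "\<And>w. w \<in> carrier F \<Longrightarrow> nF w < d \<Longrightarrow> \<exists>u\<in>carrier E. nE u < \<rho> \<and> T u = w"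
      using ball_in_image[OF \<rho>(1)] by metis
    have "z \<in> T ` U" if z: "z \<in> carrier F" "nF (z \<ominus>\<^bsub>F\<^esub> y) < d" for z
    proof -
      have yc: "y \<in> carrier F" using xc x T_closed by simp
      obtain u where u: "u \<in> carrier E" "nE u < \<rho>" "T u = z \<ominus>\<^bsub>F\<^esub> y"
        using d(2)[of "z \<ominus>\<^bsub>F\<^esub> y"] z yc by auto
      have "(u \<oplus>\<^bsub>E\<^esub> x) \<ominus>\<^bsub>E\<^esub> x = u" using u xc by simp
      then have "u \<oplus>\<^bsub>E\<^esub> x \<in> U" using \<rho>(2) u xc by simp
      moreover have "T (u \<oplus>\<^bsub>E\<^esub> x) = z"
        using T_add[OF u(1) xc] u(3) x(2) yc z(1) by simp
      ultimately show ?thesis by blast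
    qed
    then show "\<exists>r>0. \<forall>z\<in>carrier F. nF (z \<ominus>\<^bsub>F\<^esub> y) < r \<longrightarrow> z \<in> T ` U" using d(1) by blast
  qed
qed

end

section \<open>Cosets in quotient rings\<close>

lemma carrier_FactRing_iff:
  "Z \<in> carrier (R Quot I) \<longleftrightarrow> (\<exists>x\<in>carrier R. Z = I +>\<^bsub>R\<^esub> x)"
  unfolding FactRing_def A_RCOSETS_def RCOSETS_def a_r_coset_def by auto

lemma zero_FactRing [simp]: "\<zero>\<^bsub>R Quot I\<^esub> = I"
  by (simp add: FactRing_def)

lemma (in ideal) mult_FactRing:
  "x \<in> carrier R \<Longrightarrow> y \<in> carrier R \<Longrightarrow> (I +> x) \<otimes>\<^bsub>R Quot I\<^esub> (I +> y) = I +> (x \<otimes> y)"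
  by (simp add: FactRing_def rcoset_mult_add)

lemma (in ideal) coset_eq_ideal_iff:
  assumes "x \<in> carrier R" shows "I +> x = I \<longleftrightarrow> x \<in> I"
  using a_coset_join1[OF _ assms] a_coset_join2[OF assms] a_subgroup by blast

section \<open>Completions of seminormed rings\<close>

locale seminormed_cring = cring S + ultraseminormed_group S q for S :: "'a ring" (structure) and q +
  assumes norm_mult_le: "x \<in> carrier S \<Longrightarrow> y \<in> carrier S \<Longrightarrow> q (x \<otimes> y) \<le> q x * q y"
begin

abbreviation CR where "CR \<equiv> cauchy_ring S q"

lemma cauchy_ring_simps [simp]:
  "x \<otimes>\<^bsub>CR\<^esub> y = (\<lambda>n. x n \<otimes> y n)" "\<one>\<^bsub>CR\<^esub> = (\<lambda>n. \<one>)"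
  "\<zero>\<^bsub>CR\<^esub> = (\<lambda>n. \<zero>)" "x \<oplus>\<^bsub>CR\<^esub> y = (\<lambda>n. x n \<oplus> y n)"
  by (simp_all add: cauchy_ring_def)

lemma in_cauchy_ring_iff:
  "x \<in> carrier CR \<longleftrightarrow> (\<forall>n. x n \<in> carrier S) \<and>
     (\<forall>e>0. \<exists>N. \<forall>m\<ge>N. \<forall>n\<ge>N. q (x m \<ominus> x n) < e)"
  by (simp add: cauchy_ring_def)

lemma cauchy_ringD: "x \<in> carrier CR \<Longrightarrow> x n \<in> carrier S"
  by (simp add: in_cauchy_ring_iff)

lemma cauchy_ring_const [simp]: "a \<in> carrier S \<Longrightarrow> (\<lambda>n. a) \<in> carrier CR"
  by (simp add: in_cauchy_ring_iff)

lemma cauchy_bounded: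
  assumes "x \<in> carrier CR" obtains B where "0 < B" "\<And>n. q (x n) \<le> B"
proof -
  have xc: "x n \<in> carrier S" for n using assms by (rule cauchy_ringD)
  obtain N where N: "\<And>m n. m \<ge> N \<Longrightarrow> n \<ge> N \<Longrightarrow> q (x m \<ominus> x n) < 1"
    using assms zero_less_one unfolding in_cauchy_ring_iff by metis
  define B where "B = Max (insert 1 ((\<lambda>n. q (x n)) ` {..N}))"
  have le: "q (x n) \<le> B" if "n \<le> N" for n
    unfolding B_def by (rule Max_ge) (use that in auto)
  have B1: "1 \<le> B" unfolding B_def by (rule Max_ge) auto
  have "q (x n) \<le> B" for n
  proof (cases "n \<le> N")
    case False
    then have "q (x n) \<le> max (q (x n \<ominus> x N)) (q (x N))"
      using norm_add_le[of "x n \<ominus> x N" "x N"] xc by simp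
    moreover have "q (x n \<ominus> x N) < 1" using N False by simp
    ultimately show ?thesis using le[of N] B1 by simp
  qed (rule le)
  with B1 show thesis using that[of B] by simp
qed

lemma mult_minus_mult:
  assumes "a \<in> carrier S" "b \<in> carrier S" "c \<in> carrier S" "d \<in> carrier S"
  shows "a \<otimes> b \<ominus> c \<otimes> d = a \<otimes> (b \<ominus> d) \<oplus> (a \<ominus> c) \<otimes> d"
  using assms by algebra

lemma cauchy_mult_closed:
  assumes x: "x \<in> carrier CR" and y: "y \<in> carrier CR"
  shows "(\<lambda>n. x n \<otimes> y n) \<in> carrier CR"
  unfolding in_cauchy_ring_iff
proof (intro conjI allI impI)
  note xc = cauchy_ringD[OF x] and yc = cauchy_ringD[OF y]
  show "x n \<otimes> y n \<in> carrier S" for n using xc yc by simp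
  fix e :: real assume "0 < e"
  obtain A where A: "0 < A" "\<And>n. q (x n) \<le> A" using cauchy_bounded[OF x] by metis
  obtain B where B: "0 < B" "\<And>n. q (y n) \<le> B" using cauchy_bounded[OF y] by metis
  obtain N1 where N1: "\<And>m n. m \<ge> N1 \<Longrightarrow> n \<ge> N1 \<Longrightarrow> q (x m \<ominus> x n) < e / B"
    using x \<open>0 < e\<close> B(1) unfolding in_cauchy_ring_iff by (meson divide_pos_pos)
  obtain N2 where N2: "\<And>m n. m \<ge> N2 \<Longrightarrow> n \<ge> N2 \<Longrightarrow> q (y m \<ominus> y n) < e / A"
    using y \<open>0 < e\<close> A(1) unfolding in_cauchy_ring_iff by (meson divide_pos_pos)
  have "q (x m \<otimes> y m \<ominus> x n \<otimes> y n) < e" if m: "m \<ge> max N1 N2" and n: "n \<ge> max N1 N2" for m n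
  proof -
    have "q (x m \<otimes> (y m \<ominus> y n)) \<le> q (x m) * q (y m \<ominus> y n)" using xc yc by (intro norm_mult_le) auto
    also have "\<dots> \<le> A * q (y m \<ominus> y n)" using A yc by (intro mult_right_mono norm_nonneg) auto
    also have "\<dots> < A * (e / A)" using N2[of m n] m n A(1) by (intro mult_strict_left_mono) auto
    finally have 1: "q (x m \<otimes> (y m \<ominus> y n)) < e" using A(1) by simp
    have "q ((x m \<ominus> x n) \<otimes> y n) \<le> q (x m \<ominus> x n) * q (y n)" using xc yc by (intro norm_mult_le) auto
    also have "\<dots> \<le> q (x m \<ominus> x n) * B" using B xc by (intro mult_left_mono norm_nonneg) auto
    also have "\<dots> < (e / B) * B" using N1[of m n] m n B(1) by (intro mult_strict_right_mono) auto
    finally have 2: "q ((x m \<ominus> x n) \<otimes> y n) < e" using B(1) by simp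
    show ?thesis
      using 1 2 norm_add_le[of "x m \<otimes> (y m \<ominus> y n)" "(x m \<ominus> x n) \<otimes> y n"] xc yc
      by (simp add: mult_minus_mult)
  qed
  then show "\<exists>N. \<forall>m\<ge>N. \<forall>n\<ge>N. q (x m \<otimes> y m \<ominus> x n \<otimes> y n) < e" by blast
qed

lemma add_minus_add:
  assumes "a \<in> carrier S" "b \<in> carrier S" "c \<in> carrier S" "d \<in> carrier S"
  shows "(a \<oplus> b) \<ominus> (c \<oplus> d) = (a \<ominus> c) \<oplus> (b \<ominus> d)"
  using assms by algebra

lemma cauchy_add_closed:
  assumes x: "x \<in> carrier CR" and y: "y \<in> carrier CR"
  shows "(\<lambda>n. x n \<oplus> y n) \<in> carrier CR"
  unfolding in_cauchy_ring_iff
proof (intro conjI allI impI)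
  note xc = cauchy_ringD[OF x] and yc = cauchy_ringD[OF y]
  show "x n \<oplus> y n \<in> carrier S" for n using xc yc by simp
  fix e :: real assume "0 < e"
  obtain N1 where N1: "\<And>m n. m \<ge> N1 \<Longrightarrow> n \<ge> N1 \<Longrightarrow> q (x m \<ominus> x n) < e"
    using x \<open>0 < e\<close> unfolding in_cauchy_ring_iff by meson
  obtain N2 where N2: "\<And>m n. m \<ge> N2 \<Longrightarrow> n \<ge> N2 \<Longrightarrow> q (y m \<ominus> y n) < e"
    using y \<open>0 < e\<close> unfolding in_cauchy_ring_iff by meson
  have "q ((x m \<oplus> y m) \<ominus> (x n \<oplus> y n)) < e" if "m \<ge> max N1 N2" "n \<ge> max N1 N2" for m n
    using N1[of m n] N2[of m n] that norm_add_le[of "x m \<ominus> x n" "y m \<ominus> y n"] xc yc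
    by (simp add: add_minus_add)
  then show "\<exists>N. \<forall>m\<ge>N. \<forall>n\<ge>N. q ((x m \<oplus> y m) \<ominus> (x n \<oplus> y n)) < e" by blast
qed

lemma neg_minus_neg:
  assumes "a \<in> carrier S" "b \<in> carrier S" shows "(\<ominus> a) \<ominus> (\<ominus> b) = \<ominus> (a \<ominus> b)"
  using assms by algebra

lemma cauchy_neg_closed:
  assumes x: "x \<in> carrier CR" shows "(\<lambda>n. \<ominus> x n) \<in> carrier CR"
  using assms cauchy_ringD[OF x] by (simp add: in_cauchy_ring_iff neg_minus_neg)

lemma cauchy_ring_cring: "cring CR"
proof (rule cringI)
  show "abelian_group CR"
  proof (rule abelian_groupI)
    fix x assume x: "x \<in> carrier CR"
    show "\<exists>y\<in>carrier CR. y \<oplus>\<^bsub>CR\<^esub> x = \<zero>\<^bsub>CR\<^esub>"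
      using cauchy_ringD[OF x] by (intro bexI[OF _ cauchy_neg_closed[OF x]]) (simp add: l_neg)
  qed (auto simp: cauchy_add_closed cauchy_ringD a_assoc, auto simp: cauchy_ringD a_comm)
  show "comm_monoid CR"
    by (rule comm_monoidI) (auto simp: cauchy_mult_closed cauchy_ringD m_assoc, auto simp: cauchy_ringD m_comm)
qed (simp add: cauchy_ringD l_distr)

lemma cauchy_ring_neg:
  assumes x: "x \<in> carrier CR" shows "\<ominus>\<^bsub>CR\<^esub> x = (\<lambda>n. \<ominus> x n)"
proof -
  interpret CR: cring CR by (rule cauchy_ring_cring)
  show ?thesis
    using x cauchy_neg_closed[OF x] cauchy_ringD[OF x] by (intro CR.minus_equality) (simp_all add: l_neg)
qed

abbreviation NS where "NS \<equiv> null_sequences S q"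

lemma null_sequences_iff: "x \<in> NS \<longleftrightarrow> x \<in> carrier CR \<and> (\<forall>e>0. \<exists>N. \<forall>n\<ge>N. q (x n) < e)"
proof -
  have "(\<lambda>n. q (x n)) \<longlonglongrightarrow> 0 \<longleftrightarrow> (\<forall>e>0. \<exists>N. \<forall>n\<ge>N. q (x n) < e)" if "x \<in> carrier CR"
    using cauchy_ringD[OF that] norm_nonneg by (simp add: LIMSEQ_iff)
  then show ?thesis by (auto simp: null_sequences_def)
qed

text \<open>Cauchy sequences are bounded, so their products with null sequences are null.\<close>

lemma null_sequences_ideal: "ideal NS CR"
proof -
  interpret CR: cring CR by (rule cauchy_ring_cring)
  have mult: "y \<otimes>\<^bsub>CR\<^esub> x \<in> NS" if x: "x \<in> NS" and y: "y \<in> carrier CR" for x y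
  proof -
    have x': "x \<in> carrier CR" using x by (simp add: null_sequences_iff)
    note xc = cauchy_ringD[OF x'] and yc = cauchy_ringD[OF y]
    obtain B where B: "0 < B" "\<And>n. q (y n) \<le> B" using cauchy_bounded[OF y] by metis
    have "\<exists>N. \<forall>n\<ge>N. q (y n \<otimes> x n) < e" if e: "0 < e" for e
    proof -
      obtain N where N: "\<And>n. n \<ge> N \<Longrightarrow> q (x n) < e / B"
        using x e B(1) unfolding null_sequences_iff by (meson divide_pos_pos)
      have "q (y n \<otimes> x n) < e" if "n \<ge> N" for n
      proof -
        have "q (y n \<otimes> x n) \<le> q (y n) * q (x n)" using xc yc by (intro norm_mult_le)
        also have "\<dots> \<le> B * q (x n)" using B xc by (intro mult_right_mono norm_nonneg) auto
        also have "\<dots> < B * (e / B)" using N[OF that] B(1) by (intro mult_strict_left_mono) auto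
        finally show ?thesis using B(1) by simp
      qed
      then show ?thesis by blast
    qed
    then show ?thesis using cauchy_mult_closed[OF y x'] by (simp add: null_sequences_iff)
  qed
  show ?thesis
  proof (rule idealI)
    show "ring CR" by (rule CR.ring_axioms)
    show "subgroup NS (add_monoid CR)"
    proof (rule CR.add.subgroupI)
      show "NS \<subseteq> carrier CR" by (auto simp: null_sequences_iff)
      have "\<zero>\<^bsub>CR\<^esub> \<in> NS" by (simp add: null_sequences_iff)
      then show "NS \<noteq> {}" by blast
      fix a b assume a: "a \<in> NS" and b: "b \<in> NS"
      then have ab: "a \<in> carrier CR" "b \<in> carrier CR" by (auto simp: null_sequences_iff)
      show "\<ominus>\<^bsub>CR\<^esub> a \<in> NS"
        using a cauchy_ringD[OF ab(1)] by (simp add: null_sequences_iff cauchy_ring_neg cauchy_neg_closed)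
      have "\<exists>N. \<forall>n\<ge>N. q (a n \<oplus> b n) < e" if e: "0 < e" for e
      proof -
        obtain N1 where N1: "\<And>n. n \<ge> N1 \<Longrightarrow> q (a n) < e" using a e unfolding null_sequences_iff by meson
        obtain N2 where N2: "\<And>n. n \<ge> N2 \<Longrightarrow> q (b n) < e" using b e unfolding null_sequences_iff by meson
        have "q (a n \<oplus> b n) < e" if "n \<ge> max N1 N2" for n
          using N1[of n] N2[of n] that norm_add_le[of "a n" "b n"] cauchy_ringD ab by auto
        then show ?thesis by blast
      qed
      then show "a \<oplus>\<^bsub>CR\<^esub> b \<in> NS" using cauchy_add_closed ab by (simp add: null_sequences_iff)
    qed
    show "y \<otimes>\<^bsub>CR\<^esub> x \<in> NS" if "x \<in> NS" "y \<in> carrier CR" for x y by (rule mult[OF that])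
    show "x \<otimes>\<^bsub>CR\<^esub> y \<in> NS" if "x \<in> NS" "y \<in> carrier CR" for x y
      using mult[OF that] that CR.m_comm by (metis null_sequences_iff)
  qed
qed

lemma completion_cring: "cring (completion S q)"
  unfolding completion_def
  using ideal.quotient_is_cring[OF null_sequences_ideal cauchy_ring_cring] .

lemma to_completion_hom: "to_completion S q \<in> ring_hom S (completion S q)"
proof -
  have "(\<lambda>a. \<lambda>n::nat. a) \<in> ring_hom S CR" by (rule ring_hom_memI) simp_all
  from ring_hom_trans[OF this ideal.rcos_ring_hom[OF null_sequences_ideal]]
  show ?thesis by (simp add: completion_def to_completion_def[abs_def] comp_def)
qed

text \<open>The hypothesis \<open>bound\<close> says that small multiples by a come only from small
  elements. Applied termwise, it makes a Cauchy sequence null as soon as its multiple by a is null,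
  which injectivity of multiplication on S alone would not give.\<close>

lemma to_completion_nonzerodivisor:
  assumes a: "a \<in> carrier S"
    and bound: "\<And>d. 0 < d \<Longrightarrow> \<exists>e>0. \<forall>u\<in>carrier S. q (a \<otimes> u) < e \<longrightarrow> q u < d"
  shows "to_completion S q a \<in> non_zero_divisors (completion S q)"
proof -
  interpret CR: cring CR by (rule cauchy_ring_cring)
  interpret I: ideal NS CR by (rule null_sequences_ideal)
  have "Z = \<zero>\<^bsub>completion S q\<^esub>"
    if Z: "Z \<in> carrier (completion S q)" "to_completion S q a \<otimes>\<^bsub>completion S q\<^esub> Z = \<zero>\<^bsub>completion S q\<^esub>" for Z
  proof -
    obtain x where x: "x \<in> carrier CR" "Z = NS +>\<^bsub>CR\<^esub> x"
      using Z(1) by (auto simp: completion_def carrier_FactRing_iff)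
    note xc = cauchy_ringD[OF x(1)]
    have "NS +>\<^bsub>CR\<^esub> (\<lambda>n. a \<otimes> x n) = NS"
      using Z(2) I.mult_FactRing[of "\<lambda>n. a" x] a x
      by (simp add: completion_def to_completion_def)
    then have null: "(\<lambda>n. a \<otimes> x n) \<in> NS"
      using I.coset_eq_ideal_iff[of "\<lambda>n. a \<otimes> x n"] cauchy_mult_closed[OF _ x(1), of "\<lambda>n. a"] a by simp
    have "\<exists>N. \<forall>n\<ge>N. q (x n) < d" if "0 < d" for d
    proof -
      obtain e where "e > 0" "\<forall>u\<in>carrier S. q (a \<otimes> u) < e \<longrightarrow> q u < d" using bound \<open>0 < d\<close> by blast
      then show ?thesis using null xc unfolding null_sequences_iff by meson
    qed
    then have "x \<in> NS" using x(1) by (simp add: null_sequences_iff)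
    then have "NS +>\<^bsub>CR\<^esub> x = NS" using I.coset_eq_ideal_iff[OF x(1)] by simp
    then show ?thesis using x(2) by (simp add: completion_def)
  qed
  then show ?thesis
    using ring_hom_closed[OF to_completion_hom a] by (auto simp: non_zero_divisors_def)
qed

end

section \<open>Tensor products of subrings of a valued field\<close>

lemma (in ring) nat_in_subring: assumes "subring H R" shows "[(n::nat)] \<cdot> \<one> \<in> H"
  by (induction n) (use subringE(2,3,7)[OF assms] in auto)

lemma (in ring) pow_in_subring:
  "subring H R \<Longrightarrow> x \<in> H \<Longrightarrow> x [^] (n::nat) \<in> H"
  by (induction n) (simp_all add: subringE(3,6))

locale valued_field = field C for C :: "'c ring" (structure) +
  fixes v :: "'c \<Rightarrow> real"
  assumes nonarch: "nonarch_abs C v"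
begin

lemma v_nonneg: "x \<in> carrier C \<Longrightarrow> 0 \<le> v x"
  and v_eq_0_iff: "x \<in> carrier C \<Longrightarrow> v x = 0 \<longleftrightarrow> x = \<zero>"
  and v_mult: "x \<in> carrier C \<Longrightarrow> y \<in> carrier C \<Longrightarrow> v (x \<otimes> y) = v x * v y"
  and v_add_le: "x \<in> carrier C \<Longrightarrow> y \<in> carrier C \<Longrightarrow> v (x \<oplus> y) \<le> max (v x) (v y)"
  using nonarch by (auto simp: nonarch_abs_def)

lemma v_zero [simp]: "v \<zero> = 0"
  by (simp add: v_eq_0_iff)

lemma v_one [simp]: "v \<one> = 1"
  using v_mult[of \<one> \<one>] v_eq_0_iff[of \<one>] by simp

lemma v_neg [simp]: assumes "x \<in> carrier C" shows "v (\<ominus> x) = v x"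
proof -
  have "v (\<ominus> \<one>) * v (\<ominus> \<one>) = 1"
    using v_mult[of "\<ominus> \<one>" "\<ominus> \<one>"] by (simp add: l_minus)
  then have "v (\<ominus> \<one>) = 1"
    using v_nonneg[of "\<ominus> \<one>"] square_eq_1_iff[of "v (\<ominus> \<one>)"] by auto
  then show ?thesis using v_mult[of "\<ominus> \<one>" x] assms by (simp add: l_minus)
qed

lemma v_minus_le: "x \<in> carrier C \<Longrightarrow> y \<in> carrier C \<Longrightarrow> v (x \<ominus> y) \<le> max (v x) (v y)"
  using v_add_le[of x "\<ominus> y"] by (simp add: minus_eq)

lemma v_pow: "x \<in> carrier C \<Longrightarrow> v (x [^] (n::nat)) = v x ^ n"
  by (induction n) (auto simp: v_mult)

lemma v_inv: assumes "x \<in> carrier C" "x \<noteq> \<zero>" shows "v (inv x) = inverse (v x)"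
proof -
  have "x \<in> Units C" using assms field_Units by auto
  then have "v x * v (inv x) = 1" using v_mult[of x "inv x"] assms by simp
  then show ?thesis by (metis inverse_unique)
qed

lemma v_pos: "x \<in> carrier C \<Longrightarrow> x \<noteq> \<zero> \<Longrightarrow> 0 < v x"
  using v_nonneg[of x] v_eq_0_iff[of x] by linarith

lemma subring_unit_ball:
  assumes "subfield L C" shows "subring {x \<in> L. v x \<le> 1} C"
proof -
  note L = subringE[OF subfieldE(1)[OF assms]]
  have c: "x \<in> L \<Longrightarrow> x \<in> carrier C" for x using L(1) by auto
  show ?thesis
  proof (rule subringI)
    fix a b assume ab: "a \<in> {x \<in> L. v x \<le> 1}" "b \<in> {x \<in> L. v x \<le> 1}"
    then show "a \<otimes> b \<in> {x \<in> L. v x \<le> 1}"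
      using L(6) c v_nonneg by (simp add: v_mult mult_le_one)
    have "v (a \<oplus> b) \<le> max (v a) (v b)" using ab c by (intro v_add_le) auto
    also have "\<dots> \<le> 1" using ab by simp
    finally have "v (a \<oplus> b) \<le> 1" .
    then show "a \<oplus> b \<in> {x \<in> L. v x \<le> 1}" using ab L(7) by simp
  qed (use L c in auto)
qed

sublocale vn: ultranormed_group C v
  by unfold_locales (auto simp: v_nonneg v_minus_le v_eq_0_iff)

end

lemma keys_diff_subset: "Poly_Mapping.keys (a - b) \<subseteq> Poly_Mapping.keys a \<union> Poly_Mapping.keys (b :: 'a \<Rightarrow>\<^sub>0 int)"
  using keys_add[of a "- b"] by simp

lemma frag_extend_diff_fun:
  "frag_extend (\<lambda>f. a f - b f) x = frag_extend a x - frag_extend b x"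
proof -
  have "Poly_Mapping.keys x \<subseteq> UNIV" by simp
  then show ?thesis by (induction x rule: frag_induction) (auto simp: frag_extend_diff)
qed

lemma frag_extend_zero_fun: "frag_extend (\<lambda>f. 0) x = 0"
  by (simp add: frag_extend_def)

lemma set_map_closed: "(\<And>f. f \<in> B \<Longrightarrow> g f \<in> B) \<Longrightarrow> set fs \<subseteq> B \<Longrightarrow> set (map g fs) \<subseteq> B"
  by (induction fs) simp_all

lemma set_concat_map_closed:
  "(\<And>f. f \<in> B \<Longrightarrow> set (g f) \<subseteq> B) \<Longrightarrow> set fs \<subseteq> B \<Longrightarrow> set (concat (map g fs)) \<subseteq> B"
  by (induction fs) simp_all

text \<open>Kept general in the subrings because two families occur: the fields \<open>K\<close> in
  mixed characteristic and their valuation rings in equicharacteristic.\<close>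

locale tensor_data = valued_field C v for C :: "'c ring" (structure) and v +
  fixes \<Delta> :: "nat set" and A0 :: "'c set" and A :: "nat \<Rightarrow> 'c set"
  assumes fin: "finite \<Delta>" and nonempty: "\<Delta> \<noteq> {}"
    and subring_A: "\<alpha> \<in> \<Delta> \<Longrightarrow> subring (A \<alpha>) C"
    and A0_subset: "\<alpha> \<in> \<Delta> \<Longrightarrow> A0 \<subseteq> A \<alpha>"
begin

abbreviation FT where "FT \<equiv> formal_tensor_ring C \<Delta> A"
abbreviation TI where "TI \<equiv> tensor_ideal C \<Delta> A0 A"
abbreviation TR where "TR \<equiv> tensor_ring C \<Delta> A0 A"
abbreviation tup where "tup \<equiv> PiE \<Delta> A"

definition tm :: "(nat \<Rightarrow> 'c) \<Rightarrow> (nat \<Rightarrow> 'c) \<Rightarrow> nat \<Rightarrow> 'c" where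
  "tm f g = (\<lambda>\<alpha>\<in>\<Delta>. f \<alpha> \<otimes> g \<alpha>)"

definition t1 :: "nat \<Rightarrow> 'c" where "t1 = (\<lambda>\<alpha>\<in>\<Delta>. \<one>)"

lemma A_carrier: "\<alpha> \<in> \<Delta> \<Longrightarrow> x \<in> A \<alpha> \<Longrightarrow> x \<in> carrier C"
  using subringE(1)[OF subring_A] by auto

lemma A0_mem: "\<alpha> \<in> \<Delta> \<Longrightarrow> k \<in> A0 \<Longrightarrow> k \<in> A \<alpha>"
  using A0_subset by auto

lemma A_zero: "\<alpha> \<in> \<Delta> \<Longrightarrow> \<zero> \<in> A \<alpha>" using subringE(2)[OF subring_A] .
lemma A_one: "\<alpha> \<in> \<Delta> \<Longrightarrow> \<one> \<in> A \<alpha>" using subringE(3)[OF subring_A] .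
lemma A_neg: "\<alpha> \<in> \<Delta> \<Longrightarrow> x \<in> A \<alpha> \<Longrightarrow> \<ominus> x \<in> A \<alpha>" using subringE(5)[OF subring_A] .
lemma A_mult: "\<alpha> \<in> \<Delta> \<Longrightarrow> x \<in> A \<alpha> \<Longrightarrow> y \<in> A \<alpha> \<Longrightarrow> x \<otimes> y \<in> A \<alpha>" using subringE(6)[OF subring_A] .
lemma A_add: "\<alpha> \<in> \<Delta> \<Longrightarrow> x \<in> A \<alpha> \<Longrightarrow> y \<in> A \<alpha> \<Longrightarrow> x \<oplus> y \<in> A \<alpha>" using subringE(7)[OF subring_A] .

lemma tup_mem: "f \<in> tup \<Longrightarrow> \<alpha> \<in> \<Delta> \<Longrightarrow> f \<alpha> \<in> A \<alpha>" by (rule PiE_mem)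
lemma tup_carrier: "f \<in> tup \<Longrightarrow> \<alpha> \<in> \<Delta> \<Longrightarrow> f \<alpha> \<in> carrier C" using tup_mem A_carrier by blast

lemma tm_closed: "f \<in> tup \<Longrightarrow> g \<in> tup \<Longrightarrow> tm f g \<in> tup"
  by (auto simp: tm_def A_mult tup_mem intro!: restrict_PiE_iff[THEN iffD2])

lemma t1_closed: "t1 \<in> tup"
  by (auto simp: t1_def A_one)

lemma upd_closed: "f \<in> tup \<Longrightarrow> \<alpha> \<in> \<Delta> \<Longrightarrow> a \<in> A \<alpha> \<Longrightarrow> f(\<alpha> := a) \<in> tup"
  by (auto simp: PiE_iff extensional_def)

lemma tm_commute: "f \<in> tup \<Longrightarrow> g \<in> tup \<Longrightarrow> tm f g = tm g f"
  by (auto simp: tm_def tup_carrier m_comm fun_eq_iff)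

lemma tm_assoc: "f \<in> tup \<Longrightarrow> g \<in> tup \<Longrightarrow> h \<in> tup \<Longrightarrow> tm (tm f g) h = tm f (tm g h)"
  by (auto simp: tm_def tup_carrier m_assoc fun_eq_iff)

lemma tm_one: assumes "f \<in> tup" shows "tm t1 f = f"
proof
  fix \<alpha> show "tm t1 f \<alpha> = f \<alpha>"
    by (cases "\<alpha> \<in> \<Delta>") (use assms in \<open>simp_all add: tm_def t1_def tup_carrier PiE_arb[OF assms]\<close>)
qed

lemma FT_simps [simp]:
  "\<zero>\<^bsub>FT\<^esub> = 0" "x \<oplus>\<^bsub>FT\<^esub> y = x + y" "\<one>\<^bsub>FT\<^esub> = frag_of t1"
  by (simp_all add: formal_tensor_ring_def t1_def)

lemma FT_mult: "x \<otimes>\<^bsub>FT\<^esub> y = frag_extend (\<lambda>f. frag_extend (\<lambda>g. frag_of (tm f g)) y) x"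
  by (simp add: formal_tensor_ring_def tm_def)

lemma FT_carrier: "x \<in> carrier FT \<longleftrightarrow> Poly_Mapping.keys x \<subseteq> tup"
  by (simp add: formal_tensor_ring_def)

lemma FT_carrier_of [simp]: "f \<in> tup \<Longrightarrow> frag_of f \<in> carrier FT"
  by (simp add: FT_carrier)

lemma FT_carrier_0 [simp]: "0 \<in> carrier FT" by (simp add: FT_carrier)

lemma FT_carrier_diff: "x \<in> carrier FT \<Longrightarrow> y \<in> carrier FT \<Longrightarrow> x - y \<in> carrier FT"
  unfolding FT_carrier using keys_diff_subset[of x y] by blast

lemma FT_carrier_add: "x \<in> carrier FT \<Longrightarrow> y \<in> carrier FT \<Longrightarrow> x + y \<in> carrier FT"
  unfolding FT_carrier using keys_add[of x y] by blast

text \<open>Tuples generate the free abelian group under differences, so identities that are linear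
  in x need only be checked on tuples.\<close>

lemma FT_induct [consumes 1, case_names zero of diff]:
  assumes "x \<in> carrier FT" and "P 0" and "\<And>f. f \<in> tup \<Longrightarrow> P (frag_of f)"
    and "\<And>a b. a \<in> carrier FT \<Longrightarrow> b \<in> carrier FT \<Longrightarrow> P a \<Longrightarrow> P b \<Longrightarrow> P (a - b)"
  shows "P x"
proof -
  have "x \<in> carrier FT \<and> P x"
    using assms(1)[unfolded FT_carrier]
    by (induction x rule: frag_induction) (use assms(2-4) FT_carrier_diff in auto)
  then show ?thesis by simp
qed

lemma FT_mult_bilinear [simp]:
  "(x - x') \<otimes>\<^bsub>FT\<^esub> y = x \<otimes>\<^bsub>FT\<^esub> y - x' \<otimes>\<^bsub>FT\<^esub> y"
  "x \<otimes>\<^bsub>FT\<^esub> (y - y') = x \<otimes>\<^bsub>FT\<^esub> y - x \<otimes>\<^bsub>FT\<^esub> y'"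
  "0 \<otimes>\<^bsub>FT\<^esub> y = 0" "x \<otimes>\<^bsub>FT\<^esub> 0 = 0"
  "frag_of f \<otimes>\<^bsub>FT\<^esub> frag_of g = frag_of (tm f g)"
  by (simp_all add: FT_mult frag_extend_diff frag_extend_diff_fun frag_extend_zero_fun)

lemma FT_mult_closed:
  assumes "x \<in> carrier FT" "y \<in> carrier FT" shows "x \<otimes>\<^bsub>FT\<^esub> y \<in> carrier FT"
  using assms(1)
proof (induction x rule: FT_induct)
  case (of f)
  show ?case using assms(2)
    by (induction y rule: FT_induct) (use of in \<open>auto simp: tm_closed FT_carrier_diff\<close>)
qed (auto simp: FT_carrier_diff)

lemma FT_mult_commute:
  assumes "x \<in> carrier FT" "y \<in> carrier FT" shows "x \<otimes>\<^bsub>FT\<^esub> y = y \<otimes>\<^bsub>FT\<^esub> x"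
  using assms(1)
proof (induction x rule: FT_induct)
  case (of f)
  show ?case using assms(2)
    by (induction y rule: FT_induct) (use of in \<open>auto simp: tm_commute\<close>)
qed auto

lemma FT_mult_assoc:
  assumes "x \<in> carrier FT" "y \<in> carrier FT" "z \<in> carrier FT"
  shows "(x \<otimes>\<^bsub>FT\<^esub> y) \<otimes>\<^bsub>FT\<^esub> z = x \<otimes>\<^bsub>FT\<^esub> (y \<otimes>\<^bsub>FT\<^esub> z)"
  using assms(1)
proof (induction x rule: FT_induct)
  case (of f)
  show ?case using assms(2)
  proof (induction y rule: FT_induct)
    case (of g)
    show ?case using assms(3)
      by (induction z rule: FT_induct) (use of \<open>f \<in> tup\<close> in \<open>auto simp: tm_assoc\<close>)
  qed auto
qed auto

lemma FT_one_mult: assumes "x \<in> carrier FT" shows "frag_of t1 \<otimes>\<^bsub>FT\<^esub> x = x"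
  using assms by (induction x rule: FT_induct) (auto simp: tm_one)

lemma FT_cring: "cring FT"
proof (rule cringI)
  show "abelian_group FT"
  proof (rule abelian_groupI)
    fix x assume "x \<in> carrier FT"
    then show "\<exists>y\<in>carrier FT. y \<oplus>\<^bsub>FT\<^esub> x = \<zero>\<^bsub>FT\<^esub>"
      by (intro bexI[of _ "- x"]) (auto simp: FT_carrier)
  qed (auto simp: FT_carrier_add ac_simps)
  show "comm_monoid FT"
  proof (rule comm_monoidI)
    show "x \<otimes>\<^bsub>FT\<^esub> y = y \<otimes>\<^bsub>FT\<^esub> x" if "x \<in> carrier FT" "y \<in> carrier FT" for x y
      using that by (rule FT_mult_commute)
  qed (auto simp: FT_mult_closed FT_mult_assoc t1_closed FT_one_mult)
  show "(x \<oplus>\<^bsub>FT\<^esub> y) \<otimes>\<^bsub>FT\<^esub> z = x \<otimes>\<^bsub>FT\<^esub> z \<oplus>\<^bsub>FT\<^esub> y \<otimes>\<^bsub>FT\<^esub> z" for x y z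
    by (simp add: FT_mult frag_extend_add)
qed

sublocale FT: cring FT by (rule FT_cring)

lemma FT_neg: "x \<in> carrier FT \<Longrightarrow> \<ominus>\<^bsub>FT\<^esub> x = - x"
  by (rule FT.minus_equality) (auto simp: FT_carrier)

lemma FT_minus: "y \<in> carrier FT \<Longrightarrow> x \<ominus>\<^bsub>FT\<^esub> y = x - y"
  by (simp add: a_minus_def FT_neg)

lemma relations_carrier: "tensor_relations C \<Delta> A0 A \<subseteq> carrier FT"
proof -
  have "frag_of (f(\<alpha> := a \<oplus> b)) - frag_of (f(\<alpha> := a)) - frag_of (f(\<alpha> := b)) \<in> carrier FT"
    if "f \<in> tup" "\<alpha> \<in> \<Delta>" "a \<in> A \<alpha>" "b \<in> A \<alpha>" for f \<alpha> a b
    using that by (intro FT_carrier_diff FT_carrier_of upd_closed A_add)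
  moreover have "frag_of (f(\<alpha> := k \<otimes> f \<alpha>)) - frag_of (f(\<beta> := k \<otimes> f \<beta>)) \<in> carrier FT"
    if "f \<in> tup" "\<alpha> \<in> \<Delta>" "\<beta> \<in> \<Delta>" "k \<in> A0" for f \<alpha> \<beta> k
    using that by (simp add: FT_carrier_diff upd_closed A_mult tup_mem A0_mem)
  ultimately show ?thesis unfolding tensor_relations_def by blast
qed

sublocale TI: ideal TI FT
  unfolding tensor_ideal_def by (rule FT.genideal_ideal[OF relations_carrier])

lemma relations_TI: "tensor_relations C \<Delta> A0 A \<subseteq> TI"
  unfolding tensor_ideal_def by (rule FT.genideal_self[OF relations_carrier])

lemma TR_cring: "cring TR"
  unfolding tensor_ring_def by (rule TI.quotient_is_cring[OF FT_cring])

sublocale TR: cring TR by (rule TR_cring)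

definition cls :: "'c formal_tensor \<Rightarrow> 'c tensor" where "cls x = TI +>\<^bsub>FT\<^esub> x"

lemma cls_hom: "cls \<in> ring_hom FT TR"
  unfolding cls_def[abs_def] tensor_ring_def by (rule TI.rcos_ring_hom)

sublocale cls: ring_hom_cring FT TR cls
  by unfold_locales (rule cls_hom)

lemma cls_eq_iff: "x \<in> carrier FT \<Longrightarrow> y \<in> carrier FT \<Longrightarrow> cls x = cls y \<longleftrightarrow> x - y \<in> TI"
  unfolding cls_def using FT.quotient_eq_iff_same_a_r_cos[OF TI.is_ideal] FT_minus by metis

lemma cls_eq_0_iff: "x \<in> carrier FT \<Longrightarrow> cls x = \<zero>\<^bsub>TR\<^esub> \<longleftrightarrow> x \<in> TI"
  using TI.coset_eq_ideal_iff by (simp add: cls_def tensor_ring_def)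

lemma TR_carrierE: assumes "Z \<in> carrier TR" obtains x where "x \<in> carrier FT" "Z = cls x"
  using assms by (auto simp: tensor_ring_def carrier_FactRing_iff cls_def)

lemma cls_diff: "x \<in> carrier FT \<Longrightarrow> y \<in> carrier FT \<Longrightarrow> cls (x - y) = cls x \<ominus>\<^bsub>TR\<^esub> cls y"
  using cls.hom_add[of x "\<ominus>\<^bsub>FT\<^esub> y"] FT_minus[of y x] by (simp add: a_minus_def)

definition tens :: "(nat \<Rightarrow> 'c) \<Rightarrow> 'c tensor" where "tens f = cls (frag_of f)"

lemma tens_closed [simp]: "f \<in> tup \<Longrightarrow> tens f \<in> carrier TR"
  by (simp add: tens_def)

lemma tens_mult: "f \<in> tup \<Longrightarrow> g \<in> tup \<Longrightarrow> tens f \<otimes>\<^bsub>TR\<^esub> tens g = tens (tm f g)"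
  using cls.hom_mult[of "frag_of f" "frag_of g"] by (simp add: tens_def)

lemma tens_one: "tens t1 = \<one>\<^bsub>TR\<^esub>"
  using cls.hom_one by (simp add: tens_def)

lemma tens_add:
  assumes "f \<in> tup" "\<alpha> \<in> \<Delta>" "a \<in> A \<alpha>" "b \<in> A \<alpha>"
  shows "tens (f(\<alpha> := a \<oplus> b)) = tens (f(\<alpha> := a)) \<oplus>\<^bsub>TR\<^esub> tens (f(\<alpha> := b))"
proof -
  have "frag_of (f(\<alpha> := a \<oplus> b)) - frag_of (f(\<alpha> := a)) - frag_of (f(\<alpha> := b)) \<in> TI"
    using assms relations_TI unfolding tensor_relations_def by blast
  then have "cls (frag_of (f(\<alpha> := a \<oplus> b))) = cls (frag_of (f(\<alpha> := a)) + frag_of (f(\<alpha> := b)))"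
    using assms by (subst cls_eq_iff) (simp_all add: FT_carrier_add upd_closed A_add diff_diff_eq)
  also have "\<dots> = tens (f(\<alpha> := a)) \<oplus>\<^bsub>TR\<^esub> tens (f(\<alpha> := b))"
    using cls.hom_add[of "frag_of (f(\<alpha> := a))" "frag_of (f(\<alpha> := b))"] assms
    by (simp add: tens_def upd_closed)
  finally show ?thesis by (simp add: tens_def)
qed

lemma tens_scalar:
  assumes "f \<in> tup" "\<alpha> \<in> \<Delta>" "\<beta> \<in> \<Delta>" "k \<in> A0"
  shows "tens (f(\<alpha> := k \<otimes> f \<alpha>)) = tens (f(\<beta> := k \<otimes> f \<beta>))"
proof -
  have "frag_of (f(\<alpha> := k \<otimes> f \<alpha>)) - frag_of (f(\<beta> := k \<otimes> f \<beta>)) \<in> TI"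
    using assms relations_TI unfolding tensor_relations_def by blast
  then show ?thesis
    using assms unfolding tens_def by (subst cls_eq_iff) (simp_all add: upd_closed A_mult tup_mem A0_mem)
qed

text \<open>Since 0 + 0 = 0, additivity in the slot makes the tensor equal to its own
  double.\<close>

lemma tens_zero:
  assumes "f \<in> tup" "\<alpha> \<in> \<Delta>" "f \<alpha> = \<zero>" shows "tens f = \<zero>\<^bsub>TR\<^esub>"
proof -
  have "f(\<alpha> := \<zero>) = f" using assms(3) by (simp add: fun_upd_idem)
  then have "tens f \<oplus>\<^bsub>TR\<^esub> tens f = tens f"
    using tens_add[of f \<alpha> \<zero> \<zero>] assms A_zero by simp
  then show ?thesis using assms(1) by simp
qed

definition slot :: "nat \<Rightarrow> 'c \<Rightarrow> nat \<Rightarrow> 'c" where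
  "slot \<alpha> a = (\<lambda>\<beta>\<in>\<Delta>. if \<beta> = \<alpha> then a else \<one>)"

text \<open>The canonical ring homomorphism from the factor \<open>A \<alpha>\<close> to the tensor
  product.\<close>

definition inslot :: "nat \<Rightarrow> 'c \<Rightarrow> 'c tensor" where "inslot \<alpha> a = tens (slot \<alpha> a)"

lemma slot_eq: "\<alpha> \<in> \<Delta> \<Longrightarrow> slot \<alpha> a = t1(\<alpha> := a)"
  by (auto simp: slot_def t1_def fun_eq_iff)

lemma slot_closed: "\<alpha> \<in> \<Delta> \<Longrightarrow> a \<in> A \<alpha> \<Longrightarrow> slot \<alpha> a \<in> tup"
  by (simp add: slot_eq upd_closed t1_closed)

lemma inslot_closed [simp]: "\<alpha> \<in> \<Delta> \<Longrightarrow> a \<in> A \<alpha> \<Longrightarrow> inslot \<alpha> a \<in> carrier TR"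
  by (simp add: inslot_def slot_closed)

lemma inslot_mult_tens:
  assumes "\<alpha> \<in> \<Delta>" "a \<in> A \<alpha>" "f \<in> tup"
  shows "inslot \<alpha> a \<otimes>\<^bsub>TR\<^esub> tens f = tens (f(\<alpha> := a \<otimes> f \<alpha>))"
proof -
  have "tm (slot \<alpha> a) f = f(\<alpha> := a \<otimes> f \<alpha>)"
  proof
    fix \<beta> show "tm (slot \<alpha> a) f \<beta> = (f(\<alpha> := a \<otimes> f \<alpha>)) \<beta>"
      by (cases "\<beta> \<in> \<Delta>")
        (use assms in \<open>auto simp: tm_def slot_def tup_carrier PiE_arb[OF assms(3)]\<close>)
  qed
  then show ?thesis using assms by (simp add: inslot_def tens_mult slot_closed)
qed

lemma inslot_one: assumes "\<alpha> \<in> \<Delta>" shows "inslot \<alpha> \<one> = \<one>\<^bsub>TR\<^esub>"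
proof -
  have "t1(\<alpha> := \<one>) = t1" using assms by (auto simp: t1_def fun_eq_iff)
  then show ?thesis using assms by (simp add: inslot_def slot_eq tens_one)
qed

lemma inslot_hom: assumes "\<alpha> \<in> \<Delta>" shows "inslot \<alpha> \<in> ring_hom (C\<lparr>carrier := A \<alpha>\<rparr>) TR"
proof (rule ring_hom_memI)
  fix a b assume ab: "a \<in> carrier (C\<lparr>carrier := A \<alpha>\<rparr>)" "b \<in> carrier (C\<lparr>carrier := A \<alpha>\<rparr>)"
  show "inslot \<alpha> (a \<otimes>\<^bsub>C\<lparr>carrier := A \<alpha>\<rparr>\<^esub> b) = inslot \<alpha> a \<otimes>\<^bsub>TR\<^esub> inslot \<alpha> b"
    using inslot_mult_tens[of \<alpha> a "slot \<alpha> b"] assms ab slot_closed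
    by (simp add: inslot_def slot_eq)
  show "inslot \<alpha> (a \<oplus>\<^bsub>C\<lparr>carrier := A \<alpha>\<rparr>\<^esub> b) = inslot \<alpha> a \<oplus>\<^bsub>TR\<^esub> inslot \<alpha> b"
    using tens_add[of t1 \<alpha> a b] assms ab t1_closed by (simp add: inslot_def slot_eq)
qed (use assms inslot_one in auto)

lemma inslot_mult: "\<alpha> \<in> \<Delta> \<Longrightarrow> a \<in> A \<alpha> \<Longrightarrow> b \<in> A \<alpha> \<Longrightarrow> inslot \<alpha> (a \<otimes> b) = inslot \<alpha> a \<otimes>\<^bsub>TR\<^esub> inslot \<alpha> b"
  using ring_hom_mult[OF inslot_hom] by simp

lemma inslot_scalar:
  assumes "\<alpha> \<in> \<Delta>" "\<beta> \<in> \<Delta>" "k \<in> A0" shows "inslot \<alpha> k = inslot \<beta> k"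
proof -
  have "k \<otimes> t1 \<gamma> = k" if "\<gamma> \<in> \<Delta>" for \<gamma>
    using that A0_mem[OF assms(1,3)] A_carrier[OF assms(1)] by (simp add: t1_def)
  then show ?thesis
    using tens_scalar[OF t1_closed assms] assms by (simp add: inslot_def slot_eq)
qed

subsection \<open>The tensor seminorm\<close>

abbreviation q where "q \<equiv> tensor_seminorm v \<Delta> A"

definition ht :: "(nat \<Rightarrow> 'c) \<Rightarrow> real" where "ht f = (\<Prod>\<alpha>\<in>\<Delta>. v (f \<alpha>))"

text \<open>Lists without coefficients match the representations over which
  \<open>tensor_seminorm\<close> takes its infimum; signs are absorbed into the tuples by
  \<open>neg_tup\<close>.\<close>

definition tsum :: "(nat \<Rightarrow> 'c) list \<Rightarrow> 'c tensor" where
  "tsum fs = cls (sum_list (map frag_of fs))"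

lemma sum_list_closed: "set fs \<subseteq> tup \<Longrightarrow> sum_list (map frag_of fs) \<in> carrier FT"
  by (induction fs) (auto simp: FT_carrier_add)

lemma tsum_closed: "set fs \<subseteq> tup \<Longrightarrow> tsum fs \<in> carrier TR"
  by (simp add: tsum_def sum_list_closed)

lemma tsum_Nil: "tsum [] = \<zero>\<^bsub>TR\<^esub>"
  using cls.hom_zero by (simp add: tsum_def)

lemma tsum_Cons: "f \<in> tup \<Longrightarrow> set fs \<subseteq> tup \<Longrightarrow> tsum (f # fs) = tens f \<oplus>\<^bsub>TR\<^esub> tsum fs"
  using cls.hom_add[of "frag_of f" "sum_list (map frag_of fs)"]
  by (simp add: tsum_def tens_def sum_list_closed)

lemma tsum_append: "set fs \<subseteq> tup \<Longrightarrow> set gs \<subseteq> tup \<Longrightarrow> tsum (fs @ gs) = tsum fs \<oplus>\<^bsub>TR\<^esub> tsum gs"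
  using cls.hom_add[of "sum_list (map frag_of fs)" "sum_list (map frag_of gs)"]
  by (simp add: tsum_def sum_list_closed)

lemma mem_tensor_iff:
  assumes "Z \<in> carrier TR" "set fs \<subseteq> tup"
  shows "sum_list (map frag_of fs) \<in> Z \<longleftrightarrow> Z = tsum fs"
proof -
  obtain x where x: "x \<in> carrier FT" "Z = cls x" using TR_carrierE[OF assms(1)] .
  show ?thesis unfolding x(2) tsum_def cls_def
    using FT.a_repr_independence[OF _ x(1) TI.a_subgroup] TI.a_rcos_self[OF sum_list_closed[OF assms(2)]]
    by auto
qed

text \<open>Negating any one slot negates the tensor and keeps its height. No slot is distinguished,
  so one is chosen.\<close>

definition neg_tup :: "(nat \<Rightarrow> 'c) \<Rightarrow> nat \<Rightarrow> 'c" where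
  "neg_tup f = (let \<alpha> = SOME \<alpha>. \<alpha> \<in> \<Delta> in f(\<alpha> := \<ominus> f \<alpha>))"

lemma neg_tup:
  assumes "f \<in> tup"
  shows "neg_tup f \<in> tup" "tens (neg_tup f) = \<ominus>\<^bsub>TR\<^esub> tens f" "ht (neg_tup f) = ht f"
proof -
  define \<alpha> where "\<alpha> = (SOME \<alpha>. \<alpha> \<in> \<Delta>)"
  have \<alpha>: "\<alpha> \<in> \<Delta>" unfolding \<alpha>_def using nonempty by (simp add: some_in_eq)
  have n: "neg_tup f = f(\<alpha> := \<ominus> f \<alpha>)" by (simp add: neg_tup_def \<alpha>_def Let_def)
  show cl: "neg_tup f \<in> tup" using \<alpha> assms by (simp add: n upd_closed A_neg tup_mem)
  have "tens (f(\<alpha> := \<zero>)) = tens (neg_tup f) \<oplus>\<^bsub>TR\<^esub> tens f"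
    using tens_add[of f \<alpha> "\<ominus> f \<alpha>" "f \<alpha>"] \<alpha> assms by (simp add: n A_neg tup_mem tup_carrier l_neg)
  moreover have "tens (f(\<alpha> := \<zero>)) = \<zero>\<^bsub>TR\<^esub>"
    using tens_zero[of "f(\<alpha> := \<zero>)" \<alpha>] \<alpha> assms by (simp add: upd_closed A_zero)
  ultimately show "tens (neg_tup f) = \<ominus>\<^bsub>TR\<^esub> tens f"
    using TR.minus_equality[of "tens (neg_tup f)" "tens f"] cl assms by simp
  show "ht (neg_tup f) = ht f"
    unfolding ht_def n using \<alpha> assms by (intro prod.cong) (auto simp: tup_carrier)
qed

lemma tsum_neg: "set fs \<subseteq> tup \<Longrightarrow> tsum (map neg_tup fs) = \<ominus>\<^bsub>TR\<^esub> tsum fs"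
proof (induction fs)
  case (Cons f fs)
  have f: "f \<in> tup" "set fs \<subseteq> tup" using Cons.prems by simp_all
  moreover have "set (map neg_tup fs) \<subseteq> tup" by (intro set_map_closed neg_tup(1) f(2))
  ultimately show ?case using Cons.IH neg_tup by (simp add: tsum_Cons TR.minus_add tsum_closed)
qed (simp add: tsum_Nil)

lemma tsum_tm:
  assumes "f \<in> tup" "set gs \<subseteq> tup"
  shows "tsum (map (tm f) gs) = tens f \<otimes>\<^bsub>TR\<^esub> tsum gs"
  using assms(2)
proof (induction gs)
  case (Cons g gs)
  have g: "g \<in> tup" "set gs \<subseteq> tup" using Cons.prems by simp_all
  moreover have "set (map (tm f) gs) \<subseteq> tup" by (intro set_map_closed tm_closed assms(1) g(2))
  ultimately show ?case using Cons.IH assms(1) by (simp add: tsum_Cons tsum_closed TR.r_distr tm_closed tens_mult)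
qed (simp add: tsum_Nil assms)

lemma tsum_mult:
  assumes "set fs \<subseteq> tup" "set gs \<subseteq> tup"
  shows "tsum (concat (map (\<lambda>f. map (tm f) gs) fs)) = tsum fs \<otimes>\<^bsub>TR\<^esub> tsum gs"
  using assms(1)
proof (induction fs)
  case (Cons f fs)
  have f: "f \<in> tup" "set fs \<subseteq> tup" using Cons.prems by simp_all
  have "set (concat (map (\<lambda>f. map (tm f) gs) fs)) \<subseteq> tup"
    by (intro set_concat_map_closed set_map_closed tm_closed assms(2) f(2))
  moreover have "set (map (tm f) gs) \<subseteq> tup"
    by (intro set_map_closed tm_closed assms(2) f(1))
  ultimately show ?case using Cons.IH f assms(2) by (simp add: tsum_append tsum_Cons tsum_tm TR.l_distr tsum_closed)
qed (simp add: tsum_Nil tsum_closed assms)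

lemma tsum_exists: assumes "Z \<in> carrier TR" obtains fs where "set fs \<subseteq> tup" "Z = tsum fs"
proof -
  obtain x where x: "x \<in> carrier FT" "Z = cls x" using TR_carrierE[OF assms] .
  from x(1) have "\<exists>fs. set fs \<subseteq> tup \<and> cls x = tsum fs"
  proof (induction x rule: FT_induct)
    case zero then show ?case by (intro exI[of _ "[]"]) (simp add: tsum_def)
  next
    case (of f) then show ?case by (intro exI[of _ "[f]"]) (simp add: tsum_def)
  next
    case (diff a b)
    then obtain fs gs where fs: "set fs \<subseteq> tup" "cls a = tsum fs" and gs: "set gs \<subseteq> tup" "cls b = tsum gs" by blast
    have "set (map neg_tup gs) \<subseteq> tup" by (intro set_map_closed neg_tup(1) gs(1))
    then have "tsum (fs @ map neg_tup gs) = cls (a - b)"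
      using fs gs diff(1,2) by (simp add: tsum_append tsum_neg cls_diff a_minus_def)
    then show ?case using fs(1) \<open>set (map neg_tup gs) \<subseteq> tup\<close>
      by (intro exI[of _ "fs @ map neg_tup gs"]) auto
  qed
  with x(2) show thesis using that by blast
qed

lemma ht_nonneg: "f \<in> tup \<Longrightarrow> 0 \<le> ht f"
  unfolding ht_def by (intro prod_nonneg) (auto simp: tup_carrier v_nonneg)

lemma ht_tm: "f \<in> tup \<Longrightarrow> g \<in> tup \<Longrightarrow> ht (tm f g) = ht f * ht g"
  unfolding ht_def tm_def by (simp add: prod.distrib[symmetric] tup_carrier v_mult cong: prod.cong)

lemma q_eq:
  assumes "Z \<in> carrier TR"
  shows "q Z = Inf ((\<lambda>fs. Max (insert 0 (ht ` set fs))) ` {fs. set fs \<subseteq> tup \<and> Z = tsum fs})"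
proof -
  have "{Max (insert 0 ((\<lambda>f. \<Prod>\<alpha>\<in>\<Delta>. v (f \<alpha>)) ` set fs)) | fs.
            set fs \<subseteq> tup \<and> sum_list (map frag_of fs) \<in> Z}
       = (\<lambda>fs. Max (insert 0 (ht ` set fs))) ` {fs. set fs \<subseteq> tup \<and> Z = tsum fs}"
    using mem_tensor_iff[OF assms] by (auto simp: ht_def[abs_def])
  then show ?thesis by (simp add: tensor_seminorm_def)
qed

lemma q_nonneg: assumes "Z \<in> carrier TR" shows "0 \<le> q Z"
  unfolding q_eq[OF assms]
proof (rule cInf_greatest)
  obtain fs where "set fs \<subseteq> tup" "Z = tsum fs" using tsum_exists[OF assms] .
  then show "(\<lambda>fs. Max (insert 0 (ht ` set fs))) ` {fs. set fs \<subseteq> tup \<and> Z = tsum fs} \<noteq> {}" by blast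
qed auto

text \<open>A strict bound on an infimum is attained by an actual representation, so later estimates
  can work with lists of small tuples. Positivity of e takes care of the default value 0 in the
  maximum.\<close>

lemma q_less_iff:
  assumes Z: "Z \<in> carrier TR" and e: "0 < e"
  shows "q Z < e \<longleftrightarrow> (\<exists>fs. set fs \<subseteq> tup \<and> Z = tsum fs \<and> (\<forall>f\<in>set fs. ht f < e))"
proof -
  obtain gs where gs: "set gs \<subseteq> tup" "Z = tsum gs" using tsum_exists[OF Z] .
  have bdd: "bdd_below ((\<lambda>fs. Max (insert 0 (ht ` set fs))) ` {fs. set fs \<subseteq> tup \<and> Z = tsum fs})"
    by (rule bdd_belowI[of _ 0]) auto
  show ?thesis
    unfolding q_eq[OF Z] using gs e
    by (subst cInf_less_iff[OF _ bdd]) auto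
qed

lemma tsum_q_less:
  "set fs \<subseteq> tup \<Longrightarrow> \<forall>f\<in>set fs. ht f < e \<Longrightarrow> 0 < e \<Longrightarrow> q (tsum fs) < e"
  using q_less_iff[OF tsum_closed] by blast

lemma q_zero: "q \<zero>\<^bsub>TR\<^esub> = 0"
proof (rule antisym)
  show "q \<zero>\<^bsub>TR\<^esub> \<le> 0"
  proof (rule field_le_epsilon)
    fix e :: real assume "0 < e"
    then show "q \<zero>\<^bsub>TR\<^esub> \<le> 0 + e"
      using tsum_q_less[of "[]" e] tsum_Nil by simp
  qed
qed (simp add: q_nonneg)

lemma q_minus_le:
  assumes W: "W \<in> carrier TR" and Y: "Y \<in> carrier TR"
  shows "q (W \<ominus>\<^bsub>TR\<^esub> Y) \<le> max (q W) (q Y)"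
proof (rule field_le_epsilon)
  fix e :: real assume "0 < e"
  define m where "m = max (q W) (q Y) + e"
  have m: "0 < m" "q W < m" "q Y < m" using \<open>0 < e\<close> q_nonneg[OF W] by (auto simp: m_def)
  obtain fs where fs: "set fs \<subseteq> tup" "W = tsum fs" "\<forall>f\<in>set fs. ht f < m"
    using q_less_iff[OF W m(1)] m by blast
  obtain gs where gs: "set gs \<subseteq> tup" "Y = tsum gs" "\<forall>f\<in>set gs. ht f < m"
    using q_less_iff[OF Y m(1)] m by blast
  have n: "set (map neg_tup gs) \<subseteq> tup" by (intro set_map_closed neg_tup(1) gs(1))
  have n': "\<forall>f\<in>set (map neg_tup gs). ht f < m"
    using gs(1,3) neg_tup(3) by (simp add: subset_iff)
  have "W \<ominus>\<^bsub>TR\<^esub> Y = tsum (fs @ map neg_tup gs)"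
    using fs(1,2) gs(1,2) n by (simp add: tsum_append tsum_neg a_minus_def)
  moreover have "q (tsum (fs @ map neg_tup gs)) < m"
    by (intro tsum_q_less m(1)) (use fs(1,3) n n' in \<open>simp_all add: ball_Un\<close>)
  ultimately have "q (W \<ominus>\<^bsub>TR\<^esub> Y) < m" by simp
  then show "q (W \<ominus>\<^bsub>TR\<^esub> Y) \<le> max (q W) (q Y) + e" by (simp add: m_def)
qed

text \<open>Multiplying two representations term by term multiplies the heights.\<close>

lemma q_mult_less:
  assumes W: "W \<in> carrier TR" "q W < a" and Y: "Y \<in> carrier TR" "q Y < b"
  shows "q (W \<otimes>\<^bsub>TR\<^esub> Y) < a * b"
proof -
  have ab: "0 < a" "0 < b" using assms q_nonneg by (meson le_less_trans)+
  obtain fs where fs: "set fs \<subseteq> tup" "W = tsum fs" "\<forall>f\<in>set fs. ht f < a"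
    using q_less_iff[OF W(1) ab(1)] W(2) by blast
  obtain gs where gs: "set gs \<subseteq> tup" "Y = tsum gs" "\<forall>f\<in>set gs. ht f < b"
    using q_less_iff[OF Y(1) ab(2)] Y(2) by blast
  have "ht (tm f g) < a * b" if "f \<in> set fs" "g \<in> set gs" for f g
  proof -
    have "f \<in> tup" "g \<in> tup" using that fs(1) gs(1) by auto
    then show ?thesis using that fs(3) gs(3) ht_tm ht_nonneg by (simp add: mult_strict_mono')
  qed
  then have "\<forall>h\<in>set (concat (map (\<lambda>f. map (tm f) gs) fs)). ht h < a * b" by auto
  moreover have "set (concat (map (\<lambda>f. map (tm f) gs) fs)) \<subseteq> tup"
    by (intro set_concat_map_closed set_map_closed tm_closed fs(1) gs(1))
  ultimately have "q (tsum (concat (map (\<lambda>f. map (tm f) gs) fs))) < a * b"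
    using ab by (intro tsum_q_less) simp_all
  then show ?thesis using tsum_mult[OF fs(1) gs(1)] fs(2) gs(2) by simp
qed

text \<open>The strict version is applied with slack e in both factors, and e tends to 0 from the
  right.\<close>

lemma q_mult_le:
  assumes W: "W \<in> carrier TR" and Y: "Y \<in> carrier TR"
  shows "q (W \<otimes>\<^bsub>TR\<^esub> Y) \<le> q W * q Y"
proof (rule tendsto_lowerbound)
  show "((\<lambda>e. (q W + e) * (q Y + e)) \<longlongrightarrow> q W * q Y) (at_right 0)"
    by (auto intro!: tendsto_eq_intros)
  show "\<forall>\<^sub>F e in at_right 0. q (W \<otimes>\<^bsub>TR\<^esub> Y) \<le> (q W + e) * (q Y + e)"
    using q_mult_less[OF W _ Y] by (auto simp: eventually_at_right_field intro!: exI[of _ 1] less_imp_le)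
qed simp

sublocale SC: seminormed_cring TR q
  by unfold_locales (auto simp: q_nonneg q_zero q_minus_le q_mult_le)

end

section \<open>Linear functionals on valued fields\<close>

locale valued_extension = valued_field C v for C :: "'c ring" (structure) and v +
  fixes K0 L :: "'c set"
  assumes subfield_K0: "subfield K0 C" and subfield_L: "subfield L C" and K0_subset_L: "K0 \<subseteq> L"
begin

lemma K0_carrier: "k \<in> K0 \<Longrightarrow> k \<in> carrier C"
  and K0_zero: "\<zero> \<in> K0" and K0_one: "\<one> \<in> K0"
  and K0_neg: "k \<in> K0 \<Longrightarrow> \<ominus> k \<in> K0"
  and K0_mult: "k \<in> K0 \<Longrightarrow> l \<in> K0 \<Longrightarrow> k \<otimes> l \<in> K0"
  and K0_add: "k \<in> K0 \<Longrightarrow> l \<in> K0 \<Longrightarrow> k \<oplus> l \<in> K0"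
  using subringE[OF subfieldE(1)[OF subfield_K0]] by auto

lemma K0_inv: "k \<in> K0 \<Longrightarrow> k \<noteq> \<zero> \<Longrightarrow> inv k \<in> K0"
  using subfield_m_inv(1)[OF subfield_K0, of k] by simp

lemma L_carrier: "k \<in> L \<Longrightarrow> k \<in> carrier C"
  and L_zero: "\<zero> \<in> L" and L_one: "\<one> \<in> L"
  and L_mult: "k \<in> L \<Longrightarrow> l \<in> L \<Longrightarrow> k \<otimes> l \<in> L"
  and L_add: "k \<in> L \<Longrightarrow> l \<in> L \<Longrightarrow> k \<oplus> l \<in> L"
  using subringE[OF subfieldE(1)[OF subfield_L]] by auto

lemma L_inv: "k \<in> L \<Longrightarrow> k \<noteq> \<zero> \<Longrightarrow> inv k \<in> L"
  using subfield_m_inv(1)[OF subfield_L, of k] by simp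

definition lin :: "('c \<Rightarrow> 'c) \<Rightarrow> bool" where
  "lin \<phi> \<longleftrightarrow> (\<forall>a\<in>L. \<phi> a \<in> K0) \<and> (\<forall>a\<in>L. \<forall>b\<in>L. \<phi> (a \<oplus> b) = \<phi> a \<oplus> \<phi> b) \<and>
     (\<forall>k\<in>K0. \<forall>a\<in>L. \<phi> (k \<otimes> a) = k \<otimes> \<phi> a)"

lemma linD:
  assumes "lin \<phi>"
  shows "a \<in> L \<Longrightarrow> \<phi> a \<in> K0" "a \<in> L \<Longrightarrow> b \<in> L \<Longrightarrow> \<phi> (a \<oplus> b) = \<phi> a \<oplus> \<phi> b"
    "k \<in> K0 \<Longrightarrow> a \<in> L \<Longrightarrow> \<phi> (k \<otimes> a) = k \<otimes> \<phi> a"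
  using assms by (auto simp: lin_def)

definition subsp :: "'c set \<Rightarrow> bool" where
  "subsp H \<longleftrightarrow> H \<subseteq> L \<and> \<zero> \<in> H \<and> (\<forall>a\<in>H. \<forall>b\<in>H. a \<oplus> b \<in> H) \<and> (\<forall>k\<in>K0. \<forall>a\<in>H. k \<otimes> a \<in> H)"

lemma subspD:
  assumes "subsp H"
  shows "a \<in> H \<Longrightarrow> a \<in> L" "\<zero> \<in> H" "a \<in> H \<Longrightarrow> b \<in> H \<Longrightarrow> a \<oplus> b \<in> H" "k \<in> K0 \<Longrightarrow> a \<in> H \<Longrightarrow> k \<otimes> a \<in> H"
  using assms by (auto simp: subsp_def)

lemma subsp_neg: assumes "subsp H" "a \<in> H" shows "\<ominus> a \<in> H"
proof -
  have "(\<ominus> \<one>) \<otimes> a \<in> H" using subspD(4)[OF assms(1) K0_neg[OF K0_one] assms(2)] .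
  then show ?thesis using L_carrier[OF subspD(1)[OF assms]] by (simp add: l_minus)
qed

lemma subsp_add_line:
  assumes H: "subsp H" and x: "x \<in> L"
  shows "subsp {h \<oplus> k \<otimes> x | h k. h \<in> H \<and> k \<in> K0}" (is "subsp ?S")
proof -
  note Hc = L_carrier[OF subspD(1)[OF H]] and xc = L_carrier[OF x]
  have "?S \<subseteq> L" using subspD(1)[OF H] x K0_subset_L by (auto intro!: L_add L_mult)
  moreover have "\<zero> \<in> ?S"
    using subspD(2)[OF H] K0_zero xc by (auto intro!: exI[of _ \<zero>])
  moreover have "a \<oplus> b \<in> ?S" if "a \<in> ?S" "b \<in> ?S" for a b
  proof -
    obtain h k h' k' where e: "a = h \<oplus> k \<otimes> x" "b = h' \<oplus> k' \<otimes> x" and m: "h \<in> H" "k \<in> K0" "h' \<in> H" "k' \<in> K0"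
      using \<open>a \<in> ?S\<close> \<open>b \<in> ?S\<close> by blast
    have c: "h \<in> carrier C" "h' \<in> carrier C" "k \<in> carrier C" "k' \<in> carrier C"
      using m Hc K0_carrier by auto
    have "a \<oplus> b = (h \<oplus> h') \<oplus> (k \<oplus> k') \<otimes> x" unfolding e using c xc by algebra
    then show ?thesis using m subspD(3)[OF H] K0_add by blast
  qed
  moreover have "l \<otimes> a \<in> ?S" if "l \<in> K0" "a \<in> ?S" for l a
  proof -
    obtain h k where e: "a = h \<oplus> k \<otimes> x" and m: "h \<in> H" "k \<in> K0" using \<open>a \<in> ?S\<close> by blast
    have c: "h \<in> carrier C" "k \<in> carrier C" "l \<in> carrier C" using m that(1) Hc K0_carrier by auto
    have "l \<otimes> a = l \<otimes> h \<oplus> (l \<otimes> k) \<otimes> x" unfolding e using c xc by algebra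
    then show ?thesis using m that(1) subspD(4)[OF H] K0_mult by blast
  qed
  ultimately show ?thesis unfolding subsp_def by blast
qed

text \<open>Zorn: H is maximal among the subspaces that contain W and avoid e. If x is not in H,
  then H + K0 x contains e, and solving for x shows that x lies in H up to a multiple of e. Thus H
  is a hyperplane complementary to the line through e.\<close>

lemma maximal_subsp:
  assumes W: "subsp W" and e: "e \<in> L" "e \<notin> W"
  obtains H where "subsp H" "W \<subseteq> H" "e \<notin> H" "\<And>x. x \<in> L \<Longrightarrow> \<exists>k\<in>K0. x \<oplus> k \<otimes> e \<in> H"
proof -
  define F where "F = {H. subsp H \<and> W \<subseteq> H \<and> e \<notin> H}"
  have "\<exists>H\<in>F. \<forall>G\<in>F. H \<subseteq> G \<longrightarrow> G = H"
  proof (rule subset_Zorn_nonempty)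
    show "F \<noteq> {}" using W e by (auto simp: F_def)
    fix Q assume Q: "Q \<noteq> {}" "subset.chain F Q"
    then have QF: "G \<in> Q \<Longrightarrow> subsp G \<and> W \<subseteq> G \<and> e \<notin> G" for G by (auto simp: subset_chain_def F_def)
    have "a \<oplus> b \<in> \<Union>Q" if ab: "a \<in> \<Union>Q" "b \<in> \<Union>Q" for a b
    proof -
      obtain G G' where G: "G \<in> Q" "a \<in> G" "G' \<in> Q" "b \<in> G'" using ab by blast
      then have "G \<subseteq> G' \<or> G' \<subseteq> G" using Q(2) by (auto simp: subset_chain_def)
      then show ?thesis using G QF subspD(3) by (meson UnionI subsetD)
    qed
    moreover have "k \<otimes> a \<in> \<Union>Q" if ka: "k \<in> K0" "a \<in> \<Union>Q" for k a
      using ka QF subspD(4) by (meson UnionE UnionI)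
    moreover have "\<Union>Q \<subseteq> L" using QF by (auto dest: subspD(1))
    moreover have "\<zero> \<in> \<Union>Q" "W \<subseteq> \<Union>Q" "e \<notin> \<Union>Q" using QF Q(1) subspD(2) by blast+
    ultimately show "\<Union>Q \<in> F" by (simp add: F_def subsp_def)
  qed
  then obtain H where H: "subsp H" "W \<subseteq> H" "e \<notin> H" and max: "\<And>G. G \<in> F \<Longrightarrow> H \<subseteq> G \<Longrightarrow> G = H"
    by (auto simp: F_def)
  note Hc = L_carrier[OF subspD(1)[OF H(1)]]
  have "\<exists>k\<in>K0. x \<oplus> k \<otimes> e \<in> H" if x: "x \<in> L" for x
  proof (cases "x \<in> H")
    case True
    then show ?thesis using K0_zero L_carrier[OF x] L_carrier[OF e(1)] by (auto intro!: bexI[of _ \<zero>])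
  next
    case False
    define S where "S = {h \<oplus> k \<otimes> x | h k. h \<in> H \<and> k \<in> K0}"
    have S: "subsp S" unfolding S_def by (rule subsp_add_line[OF H(1) x])
    have HS: "H \<subseteq> S"
    proof
      fix h assume "h \<in> H"
      then have "h = h \<oplus> \<zero> \<otimes> x" using Hc L_carrier[OF x] by simp
      then show "h \<in> S" unfolding S_def using \<open>h \<in> H\<close> K0_zero by blast
    qed
    have "x = \<zero> \<oplus> \<one> \<otimes> x" using L_carrier[OF x] by simp
    then have "x \<in> S" unfolding S_def using subspD(2)[OF H(1)] K0_one by blast
    then have "S \<noteq> H" using False by blast
    then have "e \<in> S" using max[of S] S HS H(2) by (auto simp: F_def)
    then obtain h k where hk: "e = h \<oplus> k \<otimes> x" "h \<in> H" "k \<in> K0" unfolding S_def by blast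
    have c: "h \<in> carrier C" "k \<in> carrier C" "x \<in> carrier C" "e \<in> carrier C"
      using hk Hc K0_carrier L_carrier x e by auto
    have k0: "k \<noteq> \<zero>"
    proof
      assume "k = \<zero>"
      then have "e = h" using hk(1) c by simp
      then show False using hk(2) H(3) by simp
    qed
    have ki: "inv k \<in> K0" "inv k \<otimes> k = \<one>" "inv k \<in> carrier C"
      using K0_inv[OF hk(3) k0] k0 c field_Units K0_carrier by auto
    have "inv k \<otimes> e = inv k \<otimes> h \<oplus> x"
    proof -
      have "inv k \<otimes> e = inv k \<otimes> h \<oplus> (inv k \<otimes> k) \<otimes> x" unfolding hk(1) using c ki(3) by algebra
      then show ?thesis using ki c by simp
    qed
    then have "x \<oplus> (\<ominus> (inv k)) \<otimes> e = \<ominus> (inv k \<otimes> h)"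
      using c ki(3) by (simp add: l_minus minus_add r_neg1 a_comm r_neg2)
    then show ?thesis using ki(1) K0_neg subsp_neg[OF H(1) subspD(4)[OF H(1) ki(1) hk(2)]] by metis
  qed
  then show thesis using that H by blast
qed

text \<open>The hyperplane H determines a coordinate: \<open>\<psi> x\<close> is the unique k with x
  + k e in H. Two such values would put a nonzero multiple of e, hence e, into H. Linearity of
  \<psi> follows from this uniqueness.\<close>

lemma dual_functional:
  assumes W: "subsp W" and e: "e \<in> L" "e \<notin> W"
  obtains \<phi> where "lin \<phi>" "\<phi> e = \<one>" "\<And>w. w \<in> W \<Longrightarrow> \<phi> w = \<zero>"
proof -
  obtain H where H: "subsp H" "W \<subseteq> H" "e \<notin> H" and ex: "\<And>x. x \<in> L \<Longrightarrow> \<exists>k\<in>K0. x \<oplus> k \<otimes> e \<in> H"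
    using maximal_subsp[OF assms] by metis
  note Hc = L_carrier[OF subspD(1)[OF H(1)]] and ec = L_carrier[OF e(1)]
  have uniq: "k = l" if kl: "k \<in> K0" "l \<in> K0" "x \<in> L" "x \<oplus> k \<otimes> e \<in> H" "x \<oplus> l \<otimes> e \<in> H" for k l x
  proof (rule ccontr)
    assume "k \<noteq> l"
    have c: "k \<in> carrier C" "l \<in> carrier C" "x \<in> carrier C" using kl K0_carrier L_carrier by auto
    then have d: "k \<ominus> l \<noteq> \<zero>" "k \<ominus> l \<in> K0"
      using \<open>k \<noteq> l\<close> r_right_minus_eq kl K0_add K0_neg by (auto simp: minus_eq)
    have "(k \<ominus> l) \<otimes> e = (x \<oplus> k \<otimes> e) \<oplus> (\<ominus> (x \<oplus> l \<otimes> e))" using c ec by algebra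
    then have "(k \<ominus> l) \<otimes> e \<in> H" using kl subspD(3)[OF H(1)] subsp_neg[OF H(1)] by metis
    then have "inv (k \<ominus> l) \<otimes> ((k \<ominus> l) \<otimes> e) \<in> H" using subspD(4)[OF H(1)] K0_inv d by blast
    moreover have "inv (k \<ominus> l) \<otimes> ((k \<ominus> l) \<otimes> e) = e"
    proof -
      have "k \<ominus> l \<in> Units C" using c d(1) field_Units by simp
      then show ?thesis using ec c by (simp add: m_assoc[symmetric])
    qed
    ultimately show False using H(3) by simp
  qed
  define \<psi> where "\<psi> x = (SOME k. k \<in> K0 \<and> x \<oplus> k \<otimes> e \<in> H)" for x
  have \<psi>: "\<psi> x \<in> K0" "x \<oplus> \<psi> x \<otimes> e \<in> H" if "x \<in> L" for x
    using someI_ex[of "\<lambda>k. k \<in> K0 \<and> x \<oplus> k \<otimes> e \<in> H"] ex[OF that] unfolding \<psi>_def by auto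
  have eq: "\<psi> x = k" if "k \<in> K0" "x \<in> L" "x \<oplus> k \<otimes> e \<in> H" for x k
    using uniq \<psi>[OF that(2)] that by blast
  have add: "\<psi> (a \<oplus> b) = \<psi> a \<oplus> \<psi> b" if ab: "a \<in> L" "b \<in> L" for a b
  proof (rule eq)
    have c: "a \<in> carrier C" "b \<in> carrier C" "\<psi> a \<in> carrier C" "\<psi> b \<in> carrier C"
      using ab L_carrier \<psi> K0_carrier by auto
    have "(a \<oplus> b) \<oplus> (\<psi> a \<oplus> \<psi> b) \<otimes> e = (a \<oplus> \<psi> a \<otimes> e) \<oplus> (b \<oplus> \<psi> b \<otimes> e)" using c ec by algebra
    then show "(a \<oplus> b) \<oplus> (\<psi> a \<oplus> \<psi> b) \<otimes> e \<in> H" using \<psi>(2) ab subspD(3)[OF H(1)] by simp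
  qed (use ab \<psi> K0_add L_add in auto)
  have mult: "\<psi> (k \<otimes> a) = k \<otimes> \<psi> a" if ka: "k \<in> K0" "a \<in> L" for k a
  proof (rule eq)
    have c: "a \<in> carrier C" "k \<in> carrier C" "\<psi> a \<in> carrier C"
      using ka L_carrier \<psi> K0_carrier by auto
    have "(k \<otimes> a) \<oplus> (k \<otimes> \<psi> a) \<otimes> e = k \<otimes> (a \<oplus> \<psi> a \<otimes> e)" using c ec by algebra
    then show "(k \<otimes> a) \<oplus> (k \<otimes> \<psi> a) \<otimes> e \<in> H" using \<psi>(2) ka subspD(4)[OF H(1)] by simp
  qed (use ka \<psi> K0_mult L_mult K0_subset_L in auto)
  have "lin (\<lambda>x. \<ominus> \<psi> x)"
    unfolding lin_def using add mult \<psi>(1) K0_neg K0_carrier by (auto simp: minus_add r_minus)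
  \<comment> \<open>Since e + (-1) e = 0 lies in H, the change of sign normalises the functional to
    1 at e.\<close>
  moreover have "\<psi> e = \<ominus> \<one>"
    using eq[of "\<ominus> \<one>" e] K0_neg K0_one e ec subspD(2)[OF H(1)] by (simp add: l_minus r_neg)
  then have "\<ominus> \<psi> e = \<one>" by simp
  moreover have "\<ominus> \<psi> w = \<zero>" if "w \<in> W" for w
  proof -
    have "w \<in> H" "w \<in> L" using that H(2) subspD(1)[OF W] by auto
    then have "\<psi> w = \<zero>" using eq[of \<zero> w] K0_zero ec L_carrier[of w] by simp
    then show ?thesis by simp
  qed
  ultimately show thesis using that by blast
qed

definition O0 :: "'c set" where "O0 = {k \<in> K0. v k \<le> 1}"
definition OL :: "'c set" where "OL = {k \<in> L. v k \<le> 1}"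

definition comb :: "'c set \<Rightarrow> ('c \<Rightarrow> 'c) \<Rightarrow> 'c" where
  "comb B m = (\<Oplus>b\<in>B. m b \<otimes> b)"

lemma comb_closed: "B \<subseteq> L \<Longrightarrow> m ` B \<subseteq> K0 \<Longrightarrow> comb B m \<in> carrier C"
  unfolding comb_def using L_carrier K0_carrier by (intro finsum_closed) (auto simp: Pi_iff image_subset_iff)

lemma comb_insert:
  assumes "finite B" "b \<notin> B" "insert b B \<subseteq> L" "m ` insert b B \<subseteq> K0"
  shows "comb (insert b B) m = m b \<otimes> b \<oplus> comb B m"
  unfolding comb_def using assms L_carrier K0_carrier
  by (subst finsum_insert) (auto simp: Pi_iff image_subset_iff)

lemma comb_split:
  assumes "finite B" "b \<in> B" "B \<subseteq> L" "m ` B \<subseteq> K0"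
  shows "comb B m = m b \<otimes> b \<oplus> comb (B - {b}) m"
  using comb_insert[of "B - {b}" b m] assms by (simp add: insert_absorb)

lemma comb_in_L: "finite B \<Longrightarrow> B \<subseteq> L \<Longrightarrow> m ` B \<subseteq> K0 \<Longrightarrow> comb B m \<in> L"
proof (induction B rule: finite_induct)
  case empty then show ?case by (simp add: comb_def L_zero)
next
  case (insert b B)
  then show ?case using K0_subset_L by (auto simp: comb_insert intro!: L_add L_mult)
qed

text \<open>Stated for k l + m so that sums (k = 1) and scalar multiples (m = 0) are both
  instances.\<close>

lemma comb_add_scaled:
  assumes "finite B" "B \<subseteq> L" "m ` B \<subseteq> K0" "l ` B \<subseteq> K0" "k \<in> K0"
  shows "comb B (\<lambda>b. k \<otimes> l b \<oplus> m b) = k \<otimes> comb B l \<oplus> comb B m"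
  using assms(1-4)
proof (induction B rule: finite_induct)
  case empty then show ?case using K0_carrier[OF assms(5)] by (simp add: comb_def)
next
  case (insert b B)
  have c: "b \<in> carrier C" "l b \<in> carrier C" "m b \<in> carrier C" "k \<in> carrier C"
    "comb B l \<in> carrier C" "comb B m \<in> carrier C"
    using insert.prems L_carrier K0_carrier comb_closed assms(5) by auto
  have "comb (insert b B) (\<lambda>b. k \<otimes> l b \<oplus> m b) = (k \<otimes> l b \<oplus> m b) \<otimes> b \<oplus> (k \<otimes> comb B l \<oplus> comb B m)"
    using insert assms(5) by (subst comb_insert) (auto intro!: K0_add K0_mult)
  also have "\<dots> = k \<otimes> (l b \<otimes> b \<oplus> comb B l) \<oplus> (m b \<otimes> b \<oplus> comb B m)" using c by algebra
  also have "\<dots> = k \<otimes> comb (insert b B) l \<oplus> comb (insert b B) m"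
    using insert.hyps insert.prems by (simp add: comb_insert)
  finally show ?case .
qed

lemma comb_cong: "(\<And>b. b \<in> B \<Longrightarrow> m b = l b) \<Longrightarrow> B \<subseteq> L \<Longrightarrow> l ` B \<subseteq> K0 \<Longrightarrow> comb B m = comb B l"
  unfolding comb_def using L_carrier K0_carrier by (intro finsum_cong') (auto simp: Pi_iff image_subset_iff)

lemma comb_zero: "B \<subseteq> L \<Longrightarrow> comb B (\<lambda>b. \<zero>) = \<zero>"
  unfolding comb_def using L_carrier by (intro add.finprod_one_eqI) auto

lemma subsp_span: assumes "finite B" "B \<subseteq> L" shows "subsp {comb B m | m. m ` B \<subseteq> K0}"
proof -
  have z: "\<zero> = comb B (\<lambda>b. \<zero>)" using comb_zero assms by simp
  have mem: "x \<in> {comb B m | m. m ` B \<subseteq> K0}" if "comb B m = x" "m ` B \<subseteq> K0" for x m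
    using that by blast
  have z0: "(\<lambda>b. \<zero>) ` B \<subseteq> K0" using K0_zero by auto
  have add: "comb B m \<oplus> comb B l \<in> {comb B m | m. m ` B \<subseteq> K0}" if m: "m ` B \<subseteq> K0" and l: "l ` B \<subseteq> K0" for m l
  proof -
    have "comb B (\<lambda>b. \<one> \<otimes> m b \<oplus> l b) = comb B m \<oplus> comb B l"
      using comb_add_scaled[OF assms l m K0_one] comb_closed[OF assms(2)] m by simp
    moreover have "(\<lambda>b. \<one> \<otimes> m b \<oplus> l b) ` B \<subseteq> K0"
      using m l K0_one by (auto intro!: K0_add K0_mult)
    ultimately show ?thesis by (rule mem)
  qed
  have mult: "k \<otimes> comb B m \<in> {comb B m | m. m ` B \<subseteq> K0}" if m: "m ` B \<subseteq> K0" and k: "k \<in> K0" for m k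
  proof -
    have "comb B (\<lambda>b. k \<otimes> m b \<oplus> \<zero>) = k \<otimes> comb B m"
      using comb_add_scaled[OF assms z0 m k] z comb_closed[OF assms(2) m] K0_carrier[OF k] by simp
    moreover have "(\<lambda>b. k \<otimes> m b \<oplus> \<zero>) ` B \<subseteq> K0"
      using m k K0_zero by (auto intro!: K0_add K0_mult)
    ultimately show ?thesis by (rule mem)
  qed
  have 0: "\<zero> \<in> {comb B m | m. m ` B \<subseteq> K0}" by (rule mem[OF z[symmetric] z0])
  have sub: "{comb B m | m. m ` B \<subseteq> K0} \<subseteq> L" using comb_in_L[OF assms] by blast
  show ?thesis
    unfolding subsp_def
  proof (intro conjI ballI sub 0)
    fix a b assume "a \<in> {comb B m | m. m ` B \<subseteq> K0}" "b \<in> {comb B m | m. m ` B \<subseteq> K0}"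
    then show "a \<oplus> b \<in> {comb B m | m. m ` B \<subseteq> K0}" by (elim CollectE exE conjE) (simp only: add)
  next
    fix k a assume "k \<in> K0" "a \<in> {comb B m | m. m ` B \<subseteq> K0}"
    then show "k \<otimes> a \<in> {comb B m | m. m ` B \<subseteq> K0}" by (elim CollectE exE conjE) (simp only: mult)
  qed
qed

text \<open>A minimal generating set of a finitely generated \<open>O0\<close>-submodule of \<open>L\<close> is linearly
  independent: a relation can be normalised so that its coefficient of largest absolute value is 1,
  and then it expresses one generator by the others.\<close>

lemma minimal_generators:
  assumes "finite Y" "Y \<subseteq> OL"
  obtains B where "finite B" "B \<subseteq> OL"
    "\<And>x. x \<in> Y \<Longrightarrow> \<exists>m. m ` B \<subseteq> O0 \<and> x = comb B m"
    "\<And>k b. k ` B \<subseteq> K0 \<Longrightarrow> comb B k = \<zero> \<Longrightarrow> b \<in> B \<Longrightarrow> k b = \<zero>"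
proof -
  define P where "P B \<longleftrightarrow> B \<subseteq> Y \<and> (\<forall>x\<in>Y. \<exists>m. m ` B \<subseteq> O0 \<and> x = comb B m)" for B
  have YL: "Y \<subseteq> L" using assms(2) by (auto simp: OL_def)
  have O0: "\<zero> \<in> O0" "\<one> \<in> O0" "O0 \<subseteq> K0" using K0_zero K0_one by (auto simp: O0_def)
  have "P Y"
    unfolding P_def
  proof (intro conjI ballI)
    fix x assume x: "x \<in> Y"
    let ?m = "\<lambda>b. if b = x then \<one> else \<zero>"
    have m: "?m ` Y \<subseteq> O0" using O0 by auto
    have "comb Y ?m = \<one> \<otimes> x \<oplus> comb (Y - {x}) ?m"
      using comb_split[OF assms(1) x YL order_trans[OF m O0(3)]] by simp
    also have "comb (Y - {x}) ?m = comb (Y - {x}) (\<lambda>b. \<zero>)"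
      using YL K0_zero by (intro comb_cong) auto
    finally have "comb Y ?m = x" using comb_zero[OF subset_trans[OF Diff_subset YL]] L_carrier[OF subsetD[OF YL x]] by simp
    then show "\<exists>m. m ` Y \<subseteq> O0 \<and> x = comb Y m" using m by (intro exI[of _ ?m]) simp
  qed simp
  then obtain B where B: "P B" and min: "\<And>B'. P B' \<Longrightarrow> card B \<le> card B'"
    using ex_has_least_nat[of P Y card] by blast
  have BY: "B \<subseteq> Y" and finB: "finite B" and BL: "B \<subseteq> L"
    using B assms(1) YL finite_subset by (auto simp: P_def)
  have indep: "k b = \<zero>" if k: "k ` B \<subseteq> K0" "comb B k = \<zero>" and b: "b \<in> B" for k b
  proof (rule ccontr)
    assume nz: "k b \<noteq> \<zero>"
    obtain e where e: "e \<in> B" "\<And>b. b \<in> B \<Longrightarrow> v (k b) \<le> v (k e)"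
    proof -
      have "Max ((\<lambda>b. v (k b)) ` B) \<in> (\<lambda>b. v (k b)) ` B" using finB b by (intro Max_in) auto
      then obtain e where "e \<in> B" "v (k e) = Max ((\<lambda>b. v (k b)) ` B)" by auto
      then show thesis using that finB by simp
    qed
    have kc: "k x \<in> carrier C" if "x \<in> B" for x using that k(1) K0_carrier by auto
    have "0 < v (k b)" using nz kc[OF b] v_nonneg v_eq_0_iff by (metis less_eq_real_def)
    then have ve: "0 < v (k e)" using e(2)[OF b] by simp
    then have ke: "k e \<noteq> \<zero>" "k e \<in> K0" using e(1) k(1) by auto
    have ki: "inv (k e) \<in> K0" "inv (k e) \<in> carrier C" "inv (k e) \<otimes> k e = \<one>"
      using K0_inv[OF ke(2,1)] K0_carrier ke kc[OF e(1)] field_Units by auto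
    define B' where "B' = B - {e}"
    have B': "finite B'" "B' \<subseteq> L" "B' \<subseteq> B" "B' \<subseteq> Y" using finB BL BY by (auto simp: B'_def)
    \<comment> \<open>The relation solved for e has the coefficients -k_b / k_e, which are integral
      by the choice of e. The added zero gives them the shape required by
      \<open>comb_add_scaled\<close>.\<close>
    define l where "l b = (\<ominus> (inv (k e))) \<otimes> k b \<oplus> \<zero>" for b
    have l: "l ` B' \<subseteq> O0"
    proof
      fix y assume "y \<in> l ` B'"
      then obtain x where x: "x \<in> B" "y = l x" using B'(3) by blast
      have yl: "y = (\<ominus> (inv (k e))) \<otimes> k x" using x(2) kc[OF x(1)] ki(2) by (simp add: l_def)
      have "v y = inverse (v (k e)) * v (k x)"
        using yl v_mult kc[OF x(1)] kc[OF e(1)] ki(2) v_inv ke(1) by simp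
      also have "\<dots> \<le> 1" using e(2)[OF x(1)] ve by (simp add: field_simps)
      finally show "y \<in> O0" using yl K0_mult K0_neg ki(1) x(1) k(1) by (auto simp: O0_def)
    qed
    have kB': "k ` B' \<subseteq> K0" using k(1) B'(3) by auto
    have ecomb: "e = comb B' l"
    proof -
      have ec: "e \<in> carrier C" "comb B' k \<in> carrier C" using e(1) BL L_carrier comb_closed[OF B'(2) kB'] by auto
      have "comb B' l = (\<ominus> (inv (k e))) \<otimes> comb B' k \<oplus> comb B' (\<lambda>b. \<zero>)"
        unfolding l_def using K0_zero by (intro comb_add_scaled[OF B'(1,2) _ kB' K0_neg[OF ki(1)]]) auto
      then have 1: "comb B' l = (\<ominus> (inv (k e))) \<otimes> comb B' k" using comb_zero[OF B'(2)] ec ki(2) by simp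
      have "k e \<otimes> e \<oplus> comb B' k = \<zero>"
        using comb_split[OF finB e(1) BL k(1)] k(2) by (simp add: B'_def)
      then have "(\<ominus> (inv (k e))) \<otimes> (k e \<otimes> e \<oplus> comb B' k) = \<zero>" using ki(2) by simp
      moreover have "(\<ominus> (inv (k e))) \<otimes> (k e \<otimes> e \<oplus> comb B' k)
          = \<ominus> ((inv (k e) \<otimes> k e) \<otimes> e) \<oplus> (\<ominus> (inv (k e))) \<otimes> comb B' k"
        using ki(2) ec kc[OF e(1)] by algebra
      ultimately have "\<ominus> e \<oplus> comb B' l = \<zero>" using 1 ki(3) ec by simp
      moreover have "comb B' l \<in> carrier C" using comb_closed[OF B'(2)] l O0(3) by auto
      ultimately show ?thesis
        using ec(1) vn.minus_eq_zero_iff[of "comb B' l" e] by (simp add: minus_eq a_comm)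
    qed
    have "P B'"
      unfolding P_def
    proof (intro conjI ballI B'(4))
      fix x assume "x \<in> Y"
      then obtain m where m: "m ` B \<subseteq> O0" "x = comb B m" using B by (auto simp: P_def)
      have mk: "m ` B \<subseteq> K0" "m e \<in> K0" "m ` B' \<subseteq> K0" "l ` B' \<subseteq> K0"
        using m(1) O0(3) e(1) l image_mono[OF B'(3), of m] by blast+
      have "x = m e \<otimes> e \<oplus> comb B' m"
        unfolding m(2) B'_def by (rule comb_split[OF finB e(1) BL mk(1)])
      \<comment> \<open>Only the vector e is replaced; the e inside the coefficient
        \<open>m e\<close> has to stay, so the context of the replacement is given
        explicitly.\<close>
      also have "\<dots> = m e \<otimes> comb B' l \<oplus> comb B' m"
        by (rule arg_cong[OF ecomb, of "\<lambda>z. m e \<otimes> z \<oplus> comb B' m"])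
      also have "\<dots> = comb B' (\<lambda>b. m e \<otimes> l b \<oplus> m b)"
        using comb_add_scaled[OF B'(1,2) mk(3,4,2)] by simp
      finally have "x = comb B' (\<lambda>b. m e \<otimes> l b \<oplus> m b)" .
      moreover have "(\<lambda>b. m e \<otimes> l b \<oplus> m b) ` B' \<subseteq> O0"
      proof
        fix y assume "y \<in> (\<lambda>b. m e \<otimes> l b \<oplus> m b) ` B'"
        then obtain b where b: "b \<in> B'" "y = m e \<otimes> l b \<oplus> m b" by blast
        have o: "m e \<in> O0" "l b \<in> O0" "m b \<in> O0" using m(1) l b(1) e(1) B'(3) by auto
        then have k0: "m e \<in> K0" "l b \<in> K0" "m b \<in> K0" and vs: "v (m e) \<le> 1" "v (l b) \<le> 1" "v (m b) \<le> 1"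
          by (auto simp: O0_def)
        note cc = k0[THEN K0_carrier]
        have "v (m e \<otimes> l b) \<le> 1" using vs cc v_nonneg by (simp add: v_mult mult_le_one)
        then have "max (v (m e \<otimes> l b)) (v (m b)) \<le> 1" using vs by simp
        moreover have "v y \<le> max (v (m e \<otimes> l b)) (v (m b))" unfolding b(2) using cc by (intro v_add_le) auto
        ultimately have "v y \<le> 1" by (rule order_trans[rotated])
        then show "y \<in> O0" using b(2) k0 K0_add K0_mult by (simp add: O0_def)
      qed
      ultimately show "\<exists>m. m ` B' \<subseteq> O0 \<and> x = comb B' m" by blast
    qed
    then have "card B \<le> card B'" by (rule min)
    moreover have "card B' < card B" unfolding B'_def using finB e(1) by (rule card_Diff1_less)
    ultimately show False by simp
  qed
  show thesis
    using that[OF finB] BY assms(2) B indep unfolding P_def by blast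
qed

text \<open>The functional \<open>\<phi> b\<close> is dual to b and kills the span of the other
  generators. It is defined on all of L and is K0-linear, while integrality of the coordinates is
  claimed on Y: the first allows division inside a functional, the second keeps expansions inside
  the tensor product of valuation rings.\<close>

lemma coordinates:
  assumes "finite Y" "Y \<subseteq> OL"
  obtains B \<phi> where "finite B" "B \<subseteq> OL" "\<And>b. b \<in> B \<Longrightarrow> lin (\<phi> b)"
    "\<And>x b. x \<in> Y \<Longrightarrow> b \<in> B \<Longrightarrow> \<phi> b x \<in> O0" "\<And>x. x \<in> Y \<Longrightarrow> x = comb B (\<lambda>b. \<phi> b x)"
proof -
  obtain B where B: "finite B" "B \<subseteq> OL"
    and gen: "\<And>x. x \<in> Y \<Longrightarrow> \<exists>m. m ` B \<subseteq> O0 \<and> x = comb B m"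
    and indep: "\<And>k b. k ` B \<subseteq> K0 \<Longrightarrow> comb B k = \<zero> \<Longrightarrow> b \<in> B \<Longrightarrow> k b = \<zero>"
    using minimal_generators[OF assms] by metis
  have BL: "B \<subseteq> L" using B(2) by (auto simp: OL_def)
  have O0: "O0 \<subseteq> K0" by (auto simp: O0_def)
  have "\<exists>\<phi>. lin \<phi> \<and> (\<forall>m. m ` B \<subseteq> K0 \<longrightarrow> \<phi> (comb B m) = m b)" if b: "b \<in> B" for b
  proof -
    define B' where "B' = B - {b}"
    have B': "finite B'" "B' \<subseteq> L" using B(1) BL by (auto simp: B'_def)
    define W where "W = {comb B' m | m. m ` B' \<subseteq> K0}"
    have bL: "b \<in> L" "b \<in> carrier C" using b BL L_carrier by auto
    have "b \<notin> W"
    proof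
      assume "b \<in> W"
      then obtain m where m: "m ` B' \<subseteq> K0" "b = comb B' m" by (auto simp: W_def)
      define k where "k x = (if x = b then \<ominus> \<one> else m x)" for x
      have k: "k ` B \<subseteq> K0" using m(1) K0_neg K0_one by (auto simp: k_def B'_def)
      have "comb B k = (\<ominus> \<one>) \<otimes> b \<oplus> comb B' k" using comb_split[OF B(1) b BL k] by (simp add: k_def B'_def)
      also have "comb B' k = comb B' m" using B' m(1) by (intro comb_cong) (auto simp: k_def B'_def)
      finally have "comb B k = \<zero>" using m(2) bL(2) by (simp add: l_minus l_neg)
      then have "k b = \<zero>" using indep[OF k _ b] by simp
      then show False by (simp add: k_def)
    qed
    then obtain \<phi> where \<phi>: "lin \<phi>" "\<phi> b = \<one>" "\<And>w. w \<in> W \<Longrightarrow> \<phi> w = \<zero>"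
      using dual_functional[OF subsp_span[OF B', folded W_def] bL(1)] by blast
    have "\<phi> (comb B m) = m b" if m: "m ` B \<subseteq> K0" for m
    proof -
      have mB': "m ` B' \<subseteq> K0" "m b \<in> K0" using m b by (auto simp: B'_def)
      have cL: "comb B' m \<in> L" "m b \<otimes> b \<in> L" using comb_in_L[OF B' mB'(1)] L_mult mB'(2) K0_subset_L bL by auto
      have "\<phi> (comb B m) = \<phi> (m b \<otimes> b) \<oplus> \<phi> (comb B' m)"
        using comb_split[OF B(1) b BL m] linD(2)[OF \<phi>(1)] cL by (simp add: B'_def)
      moreover have "comb B' m \<in> W" unfolding W_def using mB'(1) by blast
      ultimately have "\<phi> (comb B m) = \<phi> (m b \<otimes> b) \<oplus> \<zero>" using \<phi>(3) by simp
      also have "\<dots> = m b"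
        using linD(3)[OF \<phi>(1) mB'(2) bL(1)] \<phi>(2) K0_carrier[OF mB'(2)] by simp
      finally show ?thesis .
    qed
    then show ?thesis using \<phi>(1) by blast
  qed
  then have "\<forall>b\<in>B. \<exists>\<phi>. lin \<phi> \<and> (\<forall>m. m ` B \<subseteq> K0 \<longrightarrow> \<phi> (comb B m) = m b)" by blast
  from bchoice[OF this] obtain \<phi> where \<phi>: "\<And>b. b \<in> B \<Longrightarrow> lin (\<phi> b)"
    "\<And>b m. b \<in> B \<Longrightarrow> m ` B \<subseteq> K0 \<Longrightarrow> \<phi> b (comb B m) = m b" by blast
  have "(\<forall>b\<in>B. \<phi> b x \<in> O0) \<and> x = comb B (\<lambda>b. \<phi> b x)" if x: "x \<in> Y" for x
  proof -
    obtain m where m: "m ` B \<subseteq> O0" "x = comb B m" using gen[OF x] by blast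
    then have "\<phi> b x = m b" if "b \<in> B" for b using \<phi>(2)[OF that, of m] O0 by auto
    moreover from this have "comb B (\<lambda>b. \<phi> b x) = comb B m"
      using BL m(1) O0 by (intro comb_cong) auto
    ultimately show ?thesis using m by auto
  qed
  then have co: "\<And>x b. x \<in> Y \<Longrightarrow> b \<in> B \<Longrightarrow> \<phi> b x \<in> O0"
    "\<And>x. x \<in> Y \<Longrightarrow> x = comb B (\<lambda>b. \<phi> b x)" by blast+
  show thesis by (rule that[OF B \<phi>(1) co])
qed

end

section \<open>Tensor products of valuation rings are torsion-free\<close>

lemma (in cring) finprod_mem_subring:
  assumes H: "subring H R" and "finite D" "\<And>a. a \<in> D \<Longrightarrow> F a \<in> H"
  shows "(\<Otimes>a\<in>D. F a) \<in> H"
  using assms(2,3)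
proof (induction D rule: finite_induct)
  case empty then show ?case using subringE(3)[OF H] by simp
next
  case (insert a D)
  then have "F \<in> D \<rightarrow> carrier R" "F a \<in> carrier R" using subringE(1)[OF H] by auto
  then show ?case using insert subringE(6)[OF H] by simp
qed

locale subfield_family = valued_field C v for C :: "'c ring" (structure) and v +
  fixes \<Delta> :: "nat set" and K0 :: "'c set" and K :: "nat \<Rightarrow> 'c set"
  assumes finite_\<Delta>: "finite \<Delta>" and \<Delta>_nonempty: "\<Delta> \<noteq> {}"
    and subfield_K0: "subfield K0 C" and subfield_K: "\<alpha> \<in> \<Delta> \<Longrightarrow> subfield (K \<alpha>) C"
    and K0_subset_K: "\<alpha> \<in> \<Delta> \<Longrightarrow> K0 \<subseteq> K \<alpha>"
begin

abbreviation O0 where "O0 \<equiv> {x \<in> K0. v x \<le> 1}"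
abbreviation OK where "OK \<alpha> \<equiv> {x \<in> K \<alpha>. v x \<le> 1}"

sublocale T?: tensor_data C v \<Delta> O0 OK
proof (intro tensor_data.intro valued_field_axioms tensor_data_axioms.intro)
  fix \<alpha> assume \<alpha>: "\<alpha> \<in> \<Delta>"
  show "subring (OK \<alpha>) C" by (rule subring_unit_ball[OF subfield_K[OF \<alpha>]])
  show "O0 \<subseteq> OK \<alpha>" using K0_subset_K[OF \<alpha>] by blast
qed (simp_all add: finite_\<Delta> \<Delta>_nonempty)

lemma extension: "\<alpha> \<in> \<Delta> \<Longrightarrow> valued_extension C v K0 (K \<alpha>)"
  by (intro valued_extension.intro valued_field_axioms valued_extension_axioms.intro)
    (simp_all add: subfield_K0 subfield_K K0_subset_K)

lemma K_carrier: "\<alpha> \<in> \<Delta> \<Longrightarrow> x \<in> K \<alpha> \<Longrightarrow> x \<in> carrier C"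
  using valued_extension.L_carrier[OF extension] .

lemma K0_in_K: "\<alpha> \<in> \<Delta> \<Longrightarrow> x \<in> K0 \<Longrightarrow> x \<in> K \<alpha>" using K0_subset_K by blast

lemma O0_subring: "subring O0 C" by (rule subring_unit_ball[OF subfield_K0])

lemma K0_subring: "subring K0 C" using subfieldE(1)[OF subfield_K0] .

lemma K0_carrier: "x \<in> K0 \<Longrightarrow> x \<in> carrier C" using subringE(1)[OF K0_subring] by auto

text \<open>The functionals live on the fields \<open>K \<alpha>\<close>, although the tensors are
  formed over the valuation rings; this is what makes it possible to undo a multiplication by
  x.\<close>

definition fam :: "(nat \<Rightarrow> 'c \<Rightarrow> 'c) \<Rightarrow> bool" where
  "fam \<phi> \<longleftrightarrow> (\<forall>\<alpha>\<in>\<Delta>. valued_extension.lin C K0 (K \<alpha>) (\<phi> \<alpha>))"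

lemma famD:
  assumes "fam \<phi>" "\<alpha> \<in> \<Delta>"
  shows "a \<in> K \<alpha> \<Longrightarrow> \<phi> \<alpha> a \<in> K0"
    "a \<in> K \<alpha> \<Longrightarrow> b \<in> K \<alpha> \<Longrightarrow> \<phi> \<alpha> (a \<oplus> b) = \<phi> \<alpha> a \<oplus> \<phi> \<alpha> b"
    "k \<in> K0 \<Longrightarrow> a \<in> K \<alpha> \<Longrightarrow> \<phi> \<alpha> (k \<otimes> a) = k \<otimes> \<phi> \<alpha> a"
  using assms valued_extension.linD[OF extension[OF assms(2)]] by (auto simp: fam_def)

lemma tup_K: "f \<in> tup \<Longrightarrow> \<alpha> \<in> \<Delta> \<Longrightarrow> f \<alpha> \<in> K \<alpha>" using tup_mem by blast

lemma fam_carrier: "fam \<phi> \<Longrightarrow> f \<in> tup \<Longrightarrow> \<beta> \<in> \<Delta> \<Longrightarrow> \<phi> \<beta> (f \<beta>) \<in> carrier C"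
  using famD(1)[OF _ _ tup_K] K0_carrier by blast

definition pr :: "(nat \<Rightarrow> 'c \<Rightarrow> 'c) \<Rightarrow> (nat \<Rightarrow> 'c) \<Rightarrow> 'c" where
  "pr \<phi> f = (\<Otimes>\<alpha>\<in>\<Delta>. \<phi> \<alpha> (f \<alpha>))"

lemma pr_mem: "fam \<phi> \<Longrightarrow> f \<in> tup \<Longrightarrow> pr \<phi> f \<in> K0"
  unfolding pr_def by (rule finprod_mem_subring[OF K0_subring fin]) (simp add: famD tup_K)

lemma pr_upd:
  assumes "fam \<phi>" "f \<in> tup" "\<alpha> \<in> \<Delta>" "a \<in> OK \<alpha>"
  shows "pr \<phi> (f(\<alpha> := a)) = \<phi> \<alpha> a \<otimes> (\<Otimes>\<beta>\<in>\<Delta> - {\<alpha>}. \<phi> \<beta> (f \<beta>))"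
proof -
  have g: "f(\<alpha> := a) \<in> tup" using assms by (simp add: upd_closed)
  have cl: "\<phi> \<beta> ((f(\<alpha> := a)) \<beta>) \<in> carrier C" if "\<beta> \<in> \<Delta>" for \<beta>
    by (rule fam_carrier[OF assms(1) g that])
  have cl': "\<phi> \<beta> (f \<beta>) \<in> carrier C" if "\<beta> \<in> \<Delta>" for \<beta>
    by (rule fam_carrier[OF assms(1,2) that])
  have "pr \<phi> (f(\<alpha> := a)) = (\<Otimes>\<beta>\<in>insert \<alpha> (\<Delta> - {\<alpha>}). \<phi> \<beta> ((f(\<alpha> := a)) \<beta>))"
    using assms(3) by (simp add: pr_def insert_absorb)
  also have "\<dots> = \<phi> \<alpha> a \<otimes> (\<Otimes>\<beta>\<in>\<Delta> - {\<alpha>}. \<phi> \<beta> ((f(\<alpha> := a)) \<beta>))"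
    using cl cl[OF assms(3)] assms(3) fin by (subst finprod_insert) auto
  also have "(\<Otimes>\<beta>\<in>\<Delta> - {\<alpha>}. \<phi> \<beta> ((f(\<alpha> := a)) \<beta>)) = (\<Otimes>\<beta>\<in>\<Delta> - {\<alpha>}. \<phi> \<beta> (f \<beta>))"
    using cl' by (intro finprod_cong') auto
  finally show ?thesis .
qed

text \<open>The additive extension of the multilinear form \<open>pr \<phi>\<close> to formal sums,
  taken from the universal property of the free abelian group. It serves as a test for the vanishing
  of tensors.\<close>

definition Phi :: "(nat \<Rightarrow> 'c \<Rightarrow> 'c) \<Rightarrow> 'c formal_tensor \<Rightarrow> 'c" where
  "Phi \<phi> = (SOME h. h \<in> hom (free_Abelian_group tup) (add_monoid C) \<and> (\<forall>f\<in>tup. h (frag_of f) = pr \<phi> f))"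

lemma Phi:
  assumes "fam \<phi>"
  shows "Phi \<phi> \<in> hom (free_Abelian_group tup) (add_monoid C)" "f \<in> tup \<Longrightarrow> Phi \<phi> (frag_of f) = pr \<phi> f"
proof -
  have "pr \<phi> ` tup \<subseteq> carrier (add_monoid C)" using pr_mem[OF assms] K0_carrier by auto
  then obtain h where "h \<in> hom (free_Abelian_group tup) (add_monoid C)" "\<And>f. f \<in> tup \<Longrightarrow> h (frag_of f) = pr \<phi> f"
    by (rule comm_group.free_Abelian_group_universal[OF a_comm_group]) (rule that)
  then have "\<exists>h. h \<in> hom (free_Abelian_group tup) (add_monoid C) \<and> (\<forall>f\<in>tup. h (frag_of f) = pr \<phi> f)"
    by blast
  from someI_ex[OF this] show "Phi \<phi> \<in> hom (free_Abelian_group tup) (add_monoid C)"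
    "f \<in> tup \<Longrightarrow> Phi \<phi> (frag_of f) = pr \<phi> f" unfolding Phi_def[symmetric] by auto
qed

lemma Phi_closed: "fam \<phi> \<Longrightarrow> x \<in> carrier FT \<Longrightarrow> Phi \<phi> x \<in> carrier C"
  using hom_in_carrier[OF Phi(1), of \<phi> x] by (simp add: FT_carrier)

lemma Phi_add:
  "fam \<phi> \<Longrightarrow> x \<in> carrier FT \<Longrightarrow> y \<in> carrier FT \<Longrightarrow> Phi \<phi> (x + y) = Phi \<phi> x \<oplus> Phi \<phi> y"
  using hom_mult[OF Phi(1), of \<phi> x y] by (simp add: FT_carrier)

lemma Phi_diff:
  assumes "fam \<phi>" "x \<in> carrier FT" "y \<in> carrier FT" shows "Phi \<phi> (x - y) = Phi \<phi> x \<ominus> Phi \<phi> y"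
proof -
  have "Phi \<phi> x = Phi \<phi> (x - y) \<oplus> Phi \<phi> y"
    using Phi_add[OF assms(1) FT_carrier_diff[OF assms(2,3)] assms(3)] by simp
  then show ?thesis using Phi_closed assms FT_carrier_diff by simp
qed

lemma Phi_0: "fam \<phi> \<Longrightarrow> Phi \<phi> 0 = \<zero>"
  using Phi_diff[of \<phi> 0 0] Phi_closed[of \<phi> 0] by simp

text \<open>The transpose of multiplication by the tuple f, see \<open>Phi_mult\<close>. The entries
  of f may be any elements of the fields, in particular inverses of integral elements.\<close>

definition mulfam :: "(nat \<Rightarrow> 'c) \<Rightarrow> (nat \<Rightarrow> 'c \<Rightarrow> 'c) \<Rightarrow> nat \<Rightarrow> 'c \<Rightarrow> 'c" where
  "mulfam f \<phi> \<alpha> a = \<phi> \<alpha> (f \<alpha> \<otimes> a)"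

lemma mulfam_fam:
  assumes "fam \<phi>" and f: "\<And>\<alpha>. \<alpha> \<in> \<Delta> \<Longrightarrow> f \<alpha> \<in> K \<alpha>" shows "fam (mulfam f \<phi>)"
  unfolding fam_def
proof
  fix \<alpha> assume \<alpha>: "\<alpha> \<in> \<Delta>"
  interpret VE: valued_extension C v K0 "K \<alpha>" by (rule extension[OF \<alpha>])
  note c = K_carrier[OF \<alpha> f[OF \<alpha>]] and D = famD[OF assms(1) \<alpha>]
  have "f \<alpha> \<otimes> (k \<otimes> a) = k \<otimes> (f \<alpha> \<otimes> a)" if "k \<in> K0" "a \<in> K \<alpha>" for k a
    using c K_carrier[OF \<alpha> that(2)] K0_carrier[OF that(1)] by (simp add: m_lcomm)
  moreover have "f \<alpha> \<otimes> (a \<oplus> b) = f \<alpha> \<otimes> a \<oplus> f \<alpha> \<otimes> b" if "a \<in> K \<alpha>" "b \<in> K \<alpha>" for a b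
    using c K_carrier[OF \<alpha>] that by (simp add: r_distr)
  ultimately show "VE.lin (mulfam f \<phi> \<alpha>)"
    unfolding VE.lin_def mulfam_def using D VE.L_mult[OF f[OF \<alpha>]] by simp
qed

lemma Phi_mult:
  assumes "fam \<phi>" "f \<in> tup" "x \<in> carrier FT"
  shows "Phi \<phi> (frag_of f \<otimes>\<^bsub>FT\<^esub> x) = Phi (mulfam f \<phi>) x"
proof -
  have fm: "fam (mulfam f \<phi>)" using mulfam_fam[OF assms(1)] tup_K[OF assms(2)] by blast
  show ?thesis using assms(3)
  proof (induction x rule: FT_induct)
    case zero then show ?case using Phi_0 assms(1) fm by simp
  next
    case (of g)
    have "pr \<phi> (tm f g) = pr (mulfam f \<phi>) g"
      unfolding pr_def mulfam_def
      using fam_carrier[OF assms(1) tm_closed[OF assms(2) of]]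
      by (intro finprod_cong') (auto simp: tm_def)
    then show ?case using Phi(2) assms of fm by (simp add: tm_closed)
  next
    case (diff a b)
    then show ?case using assms fm by (simp add: Phi_diff FT_mult_closed)
  qed
qed

text \<open>The formal sums that no product of K0-linear functionals can see. The two inclusions
  below show that they are exactly the tensor relations \<open>TI\<close>.\<close>

definition ker :: "'c formal_tensor set" where
  "ker = {x \<in> carrier FT. \<forall>\<phi>. fam \<phi> \<longrightarrow> Phi \<phi> x = \<zero>}"

text \<open>Multiplying by a tuple only changes the test family, by \<open>Phi_mult\<close>.\<close>

lemma ker_ideal: "ideal ker FT"
proof (rule idealI)
  have mult: "y \<otimes>\<^bsub>FT\<^esub> x \<in> ker" if x: "x \<in> ker" and y: "y \<in> carrier FT" for x y
    using y
  proof (induction y rule: FT_induct)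
    case zero then show ?case using Phi_0 by (simp add: ker_def)
  next
    case (of f)
    have "Phi \<phi> (frag_of f \<otimes>\<^bsub>FT\<^esub> x) = \<zero>" if "fam \<phi>" for \<phi>
      using Phi_mult[OF that of] mulfam_fam[OF that] tup_K[OF of] x by (simp add: ker_def)
    then show ?case using of x by (simp add: ker_def FT_mult_closed)
  next
    case (diff a b)
    then show ?case using x by (simp add: ker_def FT_carrier_diff Phi_diff)
  qed
  show "ring FT" by (rule FT.ring_axioms)
  show "y \<otimes>\<^bsub>FT\<^esub> x \<in> ker" if "x \<in> ker" "y \<in> carrier FT" for x y by (rule mult[OF that])
  show "x \<otimes>\<^bsub>FT\<^esub> y \<in> ker" if "x \<in> ker" "y \<in> carrier FT" for x y
    using mult[OF that] that FT_mult_commute[of x y] by (simp add: ker_def)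
  show "subgroup ker (add_monoid FT)"
  proof (rule FT.add.subgroupI)
    show "ker \<subseteq> carrier FT" by (auto simp: ker_def)
    have z: "0 \<in> ker" using Phi_0 by (simp add: ker_def)
    then show "ker \<noteq> {}" by blast
    fix a b assume a: "a \<in> ker" and b: "b \<in> ker"
    have diff: "x - y \<in> ker" if "x \<in> ker" "y \<in> ker" for x y
      using that by (simp add: ker_def FT_carrier_diff Phi_diff)
    have "0 - a \<in> ker" using diff z a by blast
    then show "\<ominus>\<^bsub>FT\<^esub> a \<in> ker" using a FT_neg[of a] by (simp add: ker_def)
    show "a \<oplus>\<^bsub>FT\<^esub> b \<in> ker" using a b by (simp add: ker_def Phi_add FT_carrier_add)
  qed
qed

text \<open>The forms \<open>pr \<phi>\<close> are additive in each slot and K0-homogeneous in each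
  slot, so they respect both kinds of relations.\<close>

lemma TI_subset_ker: "TI \<subseteq> ker"
  unfolding tensor_ideal_def
proof (rule FT.genideal_minimal[OF ker_ideal])
  have 1: "frag_of (f(\<alpha> := a \<oplus> b)) - frag_of (f(\<alpha> := a)) - frag_of (f(\<alpha> := b)) \<in> ker"
    if h: "f \<in> tup" "\<alpha> \<in> \<Delta>" "a \<in> OK \<alpha>" "b \<in> OK \<alpha>" for f \<alpha> a b
  proof -
    have ab: "a \<oplus> b \<in> OK \<alpha>" by (rule A_add[OF h(2-4)])
    note u = upd_closed[OF h(1,2) h(3)] upd_closed[OF h(1,2) h(4)] upd_closed[OF h(1,2) ab]
    have "Phi \<phi> (frag_of (f(\<alpha> := a \<oplus> b)) - frag_of (f(\<alpha> := a)) - frag_of (f(\<alpha> := b))) = \<zero>"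
      if \<phi>: "fam \<phi>" for \<phi>
    proof -
      define P where "P = (\<Otimes>\<beta>\<in>\<Delta> - {\<alpha>}. \<phi> \<beta> (f \<beta>))"
      have P: "P \<in> carrier C" unfolding P_def
        by (intro finprod_closed) (simp add: fam_carrier[OF \<phi> h(1)])
      have c: "\<phi> \<alpha> a \<in> carrier C" "\<phi> \<alpha> b \<in> carrier C" "\<phi> \<alpha> (a \<oplus> b) = \<phi> \<alpha> a \<oplus> \<phi> \<alpha> b"
        using famD[OF \<phi> h(2)] h(3,4) K0_carrier by simp_all
      have "(\<phi> \<alpha> a \<oplus> \<phi> \<alpha> b) \<otimes> P \<ominus> \<phi> \<alpha> a \<otimes> P \<ominus> \<phi> \<alpha> b \<otimes> P = \<zero>" using c(1,2) P by algebra
      then show ?thesis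
        using u pr_upd[OF \<phi> h(1,2)] h(3,4) ab c(3) P_def
        by (simp add: Phi_diff[OF \<phi>] Phi(2)[OF \<phi>] FT_carrier_diff del: mem_Collect_eq)
    qed
    then show ?thesis using u by (simp add: ker_def FT_carrier_diff)
  qed
  have 2: "frag_of (f(\<alpha> := k \<otimes> f \<alpha>)) - frag_of (f(\<beta> := k \<otimes> f \<beta>)) \<in> ker"
    if h: "f \<in> tup" "\<alpha> \<in> \<Delta>" "\<beta> \<in> \<Delta>" "k \<in> O0" for f \<alpha> \<beta> k
  proof -
    have m: "k \<otimes> f \<gamma> \<in> OK \<gamma>" if "\<gamma> \<in> \<Delta>" for \<gamma>
      by (rule A_mult[OF that A0_mem[OF that h(4)] tup_mem[OF h(1) that]])
    note u = upd_closed[OF h(1,2) m[OF h(2)]] upd_closed[OF h(1,3) m[OF h(3)]]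
    have "pr \<phi> (f(\<gamma> := k \<otimes> f \<gamma>)) = k \<otimes> pr \<phi> f" if \<phi>: "fam \<phi>" and \<gamma>: "\<gamma> \<in> \<Delta>" for \<phi> \<gamma>
    proof -
      define P where "P = (\<Otimes>\<beta>\<in>\<Delta> - {\<gamma>}. \<phi> \<beta> (f \<beta>))"
      have P: "P \<in> carrier C" unfolding P_def
        by (intro finprod_closed) (simp add: fam_carrier[OF \<phi> h(1)])
      have fg: "f \<gamma> \<in> K \<gamma>" "k \<in> K0" "k \<in> carrier C" using tup_K[OF h(1) \<gamma>] h(4) K0_carrier by auto
      have c: "\<phi> \<gamma> (f \<gamma>) \<in> carrier C" using famD(1)[OF \<phi> \<gamma> fg(1)] K0_carrier by blast
      have "pr \<phi> f = \<phi> \<gamma> (f \<gamma>) \<otimes> P"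
        using pr_upd[OF \<phi> h(1) \<gamma> tup_mem[OF h(1) \<gamma>]] by (simp add: P_def)
      moreover have "pr \<phi> (f(\<gamma> := k \<otimes> f \<gamma>)) = k \<otimes> \<phi> \<gamma> (f \<gamma>) \<otimes> P"
        using pr_upd[OF \<phi> h(1) \<gamma> m[OF \<gamma>]] famD(3)[OF \<phi> \<gamma> fg(2,1)] by (simp add: P_def)
      ultimately show ?thesis using c P fg(3) by (simp add: m_assoc)
    qed
    then have "Phi \<phi> (frag_of (f(\<alpha> := k \<otimes> f \<alpha>)) - frag_of (f(\<beta> := k \<otimes> f \<beta>))) = \<zero>" if \<phi>: "fam \<phi>" for \<phi>
      using u \<phi> h(2,3) pr_mem[OF \<phi> h(1)] K0_carrier h(4) by (simp add: Phi_diff[OF \<phi>] Phi(2)[OF \<phi>])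
    then show ?thesis using u by (simp add: ker_def FT_carrier_diff)
  qed
  show "tensor_relations C \<Delta> O0 OK \<subseteq> ker"
    unfolding tensor_relations_def using 1 2 by blast
qed

end

section \<open>Expansion of tensors in coordinates\<close>

context tensor_data
begin

lemma cls_sum_cong:
  assumes "finite I" "\<And>i. i \<in> I \<Longrightarrow> x i \<in> carrier FT" "\<And>i. i \<in> I \<Longrightarrow> y i \<in> carrier FT"
    "\<And>i. i \<in> I \<Longrightarrow> cls (x i) = cls (y i)"
  shows "(\<Sum>i\<in>I. x i) \<in> carrier FT \<and> (\<Sum>i\<in>I. y i) \<in> carrier FT \<and> cls (\<Sum>i\<in>I. x i) = cls (\<Sum>i\<in>I. y i)"
  using assms
proof (induction I rule: finite_induct)
  case (insert i I)
  then have IH: "(\<Sum>i\<in>I. x i) \<in> carrier FT" "(\<Sum>i\<in>I. y i) \<in> carrier FT"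
    "cls (\<Sum>i\<in>I. x i) = cls (\<Sum>i\<in>I. y i)" by auto
  have h: "x i \<in> carrier FT" "y i \<in> carrier FT" "cls (x i) = cls (y i)" using insert.prems by auto
  show ?case
    using cls.hom_add[OF h(1) IH(1)] cls.hom_add[OF h(2) IH(2)] insert.hyps IH h FT_carrier_add by simp
qed simp

lemma sum_carrier: "finite I \<Longrightarrow> (\<And>i. i \<in> I \<Longrightarrow> x i \<in> carrier FT) \<Longrightarrow> (\<Sum>i\<in>I. x i) \<in> carrier FT"
  using cls_sum_cong[of I x x] by blast

text \<open>One slot at a time, the scalar of slot \<alpha> is pulled out as
  \<open>inslot \<alpha> (c \<alpha>)\<close>, and \<open>inslot_scalar\<close> moves it to slot
  \<beta>. The two membership claims are carried along because the induction step uses them.\<close>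

lemma tens_scalars:
  assumes g: "g \<in> tup" and \<beta>: "\<beta> \<in> \<Delta>" and A0: "subring A0 C"
    and c: "\<And>\<alpha>. \<alpha> \<in> \<Delta> \<Longrightarrow> c \<alpha> \<in> A0" and D: "finite D" "D \<subseteq> \<Delta>"
  shows "(\<lambda>\<alpha>. if \<alpha> \<in> D then c \<alpha> \<otimes> g \<alpha> else g \<alpha>) \<in> tup \<and>
    (\<Otimes>\<alpha>\<in>D. c \<alpha>) \<in> A0 \<and>
    tens (\<lambda>\<alpha>. if \<alpha> \<in> D then c \<alpha> \<otimes> g \<alpha> else g \<alpha>) = inslot \<beta> (\<Otimes>\<alpha>\<in>D. c \<alpha>) \<otimes>\<^bsub>TR\<^esub> tens g"
  using D
proof (induction D rule: finite_induct)
  case empty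
  then show ?case using g inslot_one[OF \<beta>] subringE(3)[OF A0] by simp
next
  case (insert \<alpha> D)
  define h where "h = (\<lambda>\<alpha>. if \<alpha> \<in> D then c \<alpha> \<otimes> g \<alpha> else g \<alpha>)"
  have \<alpha>: "\<alpha> \<in> \<Delta>" and IH: "h \<in> tup" "(\<Otimes>\<alpha>\<in>D. c \<alpha>) \<in> A0"
      "tens h = inslot \<beta> (\<Otimes>\<alpha>\<in>D. c \<alpha>) \<otimes>\<^bsub>TR\<^esub> tens g"
    using insert.IH insert.prems by (auto simp: h_def)
  have cc: "c \<gamma> \<in> carrier C" if "\<gamma> \<in> \<Delta>" for \<gamma> using c[OF that] subringE(1)[OF A0] by auto
  have prod: "(\<Otimes>\<alpha>\<in>insert \<alpha> D. c \<alpha>) = c \<alpha> \<otimes> (\<Otimes>\<alpha>\<in>D. c \<alpha>)"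
    using insert.hyps insert.prems cc by (subst finprod_insert) auto
  have eq: "(\<lambda>\<gamma>. if \<gamma> \<in> insert \<alpha> D then c \<gamma> \<otimes> g \<gamma> else g \<gamma>) = h(\<alpha> := c \<alpha> \<otimes> h \<alpha>)"
    using insert.hyps(2) by (auto simp: h_def fun_eq_iff)
  have "c \<alpha> \<otimes> h \<alpha> \<in> A \<alpha>" by (rule A_mult[OF \<alpha> A0_mem[OF \<alpha> c[OF \<alpha>]] tup_mem[OF IH(1) \<alpha>]])
  then have 1: "h(\<alpha> := c \<alpha> \<otimes> h \<alpha>) \<in> tup" by (rule upd_closed[OF IH(1) \<alpha>])
  have 2: "(\<Otimes>\<alpha>\<in>insert \<alpha> D. c \<alpha>) \<in> A0" unfolding prod by (rule subringE(6)[OF A0 c[OF \<alpha>] IH(2)])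
  have "tens (h(\<alpha> := c \<alpha> \<otimes> h \<alpha>)) = inslot \<alpha> (c \<alpha>) \<otimes>\<^bsub>TR\<^esub> tens h"
    using inslot_mult_tens[OF \<alpha> A0_mem[OF \<alpha> c[OF \<alpha>]] IH(1)] by simp
  also have "\<dots> = inslot \<beta> (c \<alpha>) \<otimes>\<^bsub>TR\<^esub> (inslot \<beta> (\<Otimes>\<alpha>\<in>D. c \<alpha>) \<otimes>\<^bsub>TR\<^esub> tens g)"
    using inslot_scalar[OF \<alpha> \<beta> c[OF \<alpha>]] IH(3) by simp
  also have "\<dots> = inslot \<beta> (c \<alpha> \<otimes> (\<Otimes>\<alpha>\<in>D. c \<alpha>)) \<otimes>\<^bsub>TR\<^esub> tens g"
    using g \<beta> A0_mem[OF \<beta> c[OF \<alpha>]] A0_mem[OF \<beta> IH(2)] by (simp add: inslot_mult TR.m_assoc)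
  finally show ?case using 1 2 unfolding eq prod by blast
qed

end

locale coordinate_system = subfield_family C v \<Delta> K0 K
  for C :: "'c ring" (structure) and v and \<Delta> and K0 and K +
  fixes B :: "nat \<Rightarrow> 'c set" and \<phi> :: "nat \<Rightarrow> 'c \<Rightarrow> 'c \<Rightarrow> 'c"
  assumes finite_B: "\<alpha> \<in> \<Delta> \<Longrightarrow> finite (B \<alpha>)" and B_OK: "\<alpha> \<in> \<Delta> \<Longrightarrow> B \<alpha> \<subseteq> OK \<alpha>"
    and lin_\<phi>: "\<alpha> \<in> \<Delta> \<Longrightarrow> b \<in> B \<alpha> \<Longrightarrow> valued_extension.lin C K0 (K \<alpha>) (\<phi> \<alpha> b)"
begin

text \<open>The coordinate identity is available only for the finitely many entries that were
  supplied to \<open>coordinates\<close>; this singles out the tuples that may be expanded.\<close>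

definition good :: "(nat \<Rightarrow> 'c) \<Rightarrow> bool" where
  "good f \<longleftrightarrow> f \<in> tup \<and> (\<forall>\<alpha>\<in>\<Delta>. (\<forall>b\<in>B \<alpha>. \<phi> \<alpha> b (f \<alpha>) \<in> O0) \<and>
     f \<alpha> = valued_extension.comb C (B \<alpha>) (\<lambda>b. \<phi> \<alpha> b (f \<alpha>)))"

lemma goodD:
  assumes "good f"
  shows "f \<in> tup" "\<alpha> \<in> \<Delta> \<Longrightarrow> b \<in> B \<alpha> \<Longrightarrow> \<phi> \<alpha> b (f \<alpha>) \<in> O0"
    "\<alpha> \<in> \<Delta> \<Longrightarrow> f \<alpha> = valued_extension.comb C (B \<alpha>) (\<lambda>b. \<phi> \<alpha> b (f \<alpha>))"
  using assms unfolding good_def by blast+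

lemma B_tup: "g \<in> PiE \<Delta> B \<Longrightarrow> g \<in> tup"
  using PiE_mono[of \<Delta> B OK] B_OK by blast

lemma OK_scalar: "\<alpha> \<in> \<Delta> \<Longrightarrow> k \<in> O0 \<Longrightarrow> x \<in> OK \<alpha> \<Longrightarrow> k \<otimes> x \<in> OK \<alpha>"
  using A_mult A0_mem by blast

lemma expand_slot:
  assumes f: "f \<in> tup" and \<alpha>: "\<alpha> \<in> \<Delta>" and D: "finite D" "D \<subseteq> OK \<alpha>" "\<And>b. b \<in> D \<Longrightarrow> m b \<in> O0"
  shows "valued_extension.comb C D m \<in> OK \<alpha> \<and>
    cls (frag_of (f(\<alpha> := valued_extension.comb C D m))) = cls (\<Sum>b\<in>D. frag_of (f(\<alpha> := m b \<otimes> b)))"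
  using D
proof (induction D rule: finite_induct)
  case empty
  interpret VE: valued_extension C v K0 "K \<alpha>" by (rule extension[OF \<alpha>])
  have 0: "VE.comb {} m = \<zero>" by (simp add: VE.comb_def)
  have "tens (f(\<alpha> := \<zero>)) = \<zero>\<^bsub>TR\<^esub>" using tens_zero[of "f(\<alpha> := \<zero>)" \<alpha>] upd_closed[OF f \<alpha> A_zero[OF \<alpha>]] \<alpha> by simp
  then show ?case using cls.hom_zero A_zero[OF \<alpha>] unfolding 0 tens_def by (simp del: fun_upd_apply)
next
  case (insert b D)
  interpret VE: valued_extension C v K0 "K \<alpha>" by (rule extension[OF \<alpha>])
  have b: "b \<in> OK \<alpha>" "m b \<in> O0" and D: "D \<subseteq> OK \<alpha>" "\<And>b. b \<in> D \<Longrightarrow> m b \<in> O0" using insert.prems by auto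
  have IH: "VE.comb D m \<in> OK \<alpha>" "cls (frag_of (f(\<alpha> := VE.comb D m))) = cls (\<Sum>b\<in>D. frag_of (f(\<alpha> := m b \<otimes> b)))"
    using insert.IH D by blast+
  have mb: "m b \<otimes> b \<in> OK \<alpha>" by (rule OK_scalar[OF \<alpha> b(2,1)])
  have ci: "VE.comb (insert b D) m = m b \<otimes> b \<oplus> VE.comb D m"
    using insert.hyps insert.prems by (intro VE.comb_insert) auto
  have u: "f(\<alpha> := m b \<otimes> b) \<in> tup" "f(\<alpha> := VE.comb D m) \<in> tup"
    by (rule upd_closed[OF f \<alpha> mb], rule upd_closed[OF f \<alpha> IH(1)])
  have s: "(\<Sum>b\<in>D. frag_of (f(\<alpha> := m b \<otimes> b))) \<in> carrier FT"
  proof (rule sum_carrier[OF insert.hyps(1)])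
    fix x assume "x \<in> D"
    then have "m x \<otimes> x \<in> OK \<alpha>" using D OK_scalar[OF \<alpha>] by blast
    then show "frag_of (f(\<alpha> := m x \<otimes> x)) \<in> carrier FT" by (intro FT_carrier_of upd_closed[OF f \<alpha>])
  qed
  have "tens (f(\<alpha> := m b \<otimes> b \<oplus> VE.comb D m)) = tens (f(\<alpha> := m b \<otimes> b)) \<oplus>\<^bsub>TR\<^esub> tens (f(\<alpha> := VE.comb D m))"
    by (rule tens_add[OF f \<alpha> mb IH(1)])
  also have "\<dots> = cls (frag_of (f(\<alpha> := m b \<otimes> b)) + (\<Sum>b\<in>D. frag_of (f(\<alpha> := m b \<otimes> b))))"
    using cls.hom_add[OF FT_carrier_of[OF u(1)] s] IH(2) by (simp add: tens_def)
  finally show ?case using insert.hyps A_add[OF \<alpha> mb IH(1)] unfolding ci by (simp add: tens_def del: fun_upd_apply)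
qed

text \<open>A term at an intermediate stage of the expansion: the slots in D are already expanded,
  the others still hold the entries of f.\<close>

definition mix :: "nat set \<Rightarrow> (nat \<Rightarrow> 'c) \<Rightarrow> (nat \<Rightarrow> 'c) \<Rightarrow> nat \<Rightarrow> 'c" where
  "mix D g f = (\<lambda>\<alpha>. if \<alpha> \<in> D then \<phi> \<alpha> (g \<alpha>) (f \<alpha>) \<otimes> g \<alpha> else f \<alpha>)"

lemma mix_closed:
  assumes "good f" "D \<subseteq> \<Delta>" "g \<in> PiE D B" shows "mix D g f \<in> tup"
proof (rule PiE_I)
  fix \<alpha> assume \<alpha>: "\<alpha> \<in> \<Delta>"
  show "mix D g f \<alpha> \<in> OK \<alpha>"
  proof (cases "\<alpha> \<in> D")
    case True
    then have "g \<alpha> \<in> B \<alpha>" using assms(3) by (rule PiE_mem[rotated])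
    then have "\<phi> \<alpha> (g \<alpha>) (f \<alpha>) \<otimes> g \<alpha> \<in> OK \<alpha>"
      using B_OK[OF \<alpha>] by (intro OK_scalar[OF \<alpha> goodD(2)[OF assms(1) \<alpha>]]) auto
    then show ?thesis using True by (simp add: mix_def)
  next
    case False
    then show ?thesis using tup_mem[OF goodD(1)[OF assms(1)] \<alpha>] by (simp add: mix_def)
  qed
next
  fix \<alpha> assume "\<alpha> \<notin> \<Delta>"
  then show "mix D g f \<alpha> = undefined"
    using assms(2) PiE_arb[OF goodD(1)[OF assms(1)]] by (auto simp: mix_def)
qed

text \<open>Induction on the set D of expanded slots. Expanding slot \<alpha> replaces each term by
  a sum over \<open>B \<alpha>\<close>, and pairs of a generator b and a choice g on D are the
  choices on the enlarged set.\<close>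

lemma expand_tuple:
  assumes f: "good f" and D: "finite D" "D \<subseteq> \<Delta>"
  shows "cls (frag_of f) = cls (\<Sum>g\<in>PiE D B. frag_of (mix D g f))"
  using D
proof (induction D rule: finite_induct)
  case empty
  show ?case by (simp add: mix_def)
next
  case (insert \<alpha> D)
  have \<alpha>: "\<alpha> \<in> \<Delta>" and D: "D \<subseteq> \<Delta>" using insert.prems by auto
  have fin_D: "finite (PiE D B)" using insert.hyps(1) finite_B D by (intro finite_PiE) auto
  interpret VE: valued_extension C v K0 "K \<alpha>" by (rule extension[OF \<alpha>])
  define s where "s g = (\<Sum>b\<in>B \<alpha>. frag_of (mix (insert \<alpha> D) (g(\<alpha> := b)) f))" for g
  have upd: "mix (insert \<alpha> D) (g(\<alpha> := b)) f = (mix D g f)(\<alpha> := \<phi> \<alpha> b (f \<alpha>) \<otimes> b)" for g b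
    using insert.hyps(2) by (auto simp: mix_def fun_eq_iff)
  have "s g \<in> carrier FT \<and> cls (frag_of (mix D g f)) = cls (s g)" if g: "g \<in> PiE D B" for g
  proof
    show "s g \<in> carrier FT"
      unfolding s_def
    proof (rule sum_carrier[OF finite_B[OF \<alpha>]])
      fix b assume "b \<in> B \<alpha>"
      then have "g(\<alpha> := b) \<in> PiE (insert \<alpha> D) B" using g by (simp add: PiE_fun_upd)
      then show "frag_of (mix (insert \<alpha> D) (g(\<alpha> := b)) f) \<in> carrier FT"
        using mix_closed[OF f insert.prems] by simp
    qed
    have co: "\<And>b. b \<in> B \<alpha> \<Longrightarrow> \<phi> \<alpha> b (f \<alpha>) \<in> O0" by (rule goodD(2)[OF f \<alpha>])
    have "mix D g f \<alpha> = f \<alpha>" using insert.hyps(2) by (simp add: mix_def)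
    then have "mix D g f = (mix D g f)(\<alpha> := VE.comb (B \<alpha>) (\<lambda>b. \<phi> \<alpha> b (f \<alpha>)))"
      using goodD(3)[OF f \<alpha>] by (metis fun_upd_triv)
    moreover have "cls (frag_of ((mix D g f)(\<alpha> := VE.comb (B \<alpha>) (\<lambda>b. \<phi> \<alpha> b (f \<alpha>))))) = cls (s g)"
      unfolding s_def upd
      by (rule conjunct2[OF expand_slot[OF mix_closed[OF f D g] \<alpha> finite_B[OF \<alpha>] B_OK[OF \<alpha>] co]])
    ultimately show "cls (frag_of (mix D g f)) = cls (s g)" by simp
  qed
  then have "cls (\<Sum>g\<in>PiE D B. frag_of (mix D g f)) = cls (\<Sum>g\<in>PiE D B. s g)"
    using cls_sum_cong[OF fin_D, of "\<lambda>g. frag_of (mix D g f)" s] mix_closed[OF f D] by simp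
  also have "(\<Sum>g\<in>PiE D B. s g) = (\<Sum>g\<in>PiE (insert \<alpha> D) B. frag_of (mix (insert \<alpha> D) g f))"
  proof -
    have "(\<Sum>g\<in>PiE (insert \<alpha> D) B. frag_of (mix (insert \<alpha> D) g f)) =
        (\<Sum>(b, g)\<in>B \<alpha> \<times> PiE D B. frag_of (mix (insert \<alpha> D) (g(\<alpha> := b)) f))"
      unfolding PiE_insert_eq
      by (subst sum.reindex[OF inj_combinator[OF insert.hyps(2)]]) (simp add: case_prod_unfold comp_def)
    also have "\<dots> = (\<Sum>b\<in>B \<alpha>. \<Sum>g\<in>PiE D B. frag_of (mix (insert \<alpha> D) (g(\<alpha> := b)) f))"
      by (rule sum.cartesian_product[symmetric])
    also have "\<dots> = (\<Sum>g\<in>PiE D B. s g)" unfolding s_def by (rule sum.swap)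
    finally show ?thesis by simp
  qed
  finally show ?case using insert.IH[OF D] by simp
qed

text \<open>The coefficient of the elementary tensor of generators g. Being a value of
  \<open>Phi\<close>, it vanishes on \<open>ker\<close>.\<close>

definition coef :: "(nat \<Rightarrow> 'c) \<Rightarrow> 'c formal_tensor \<Rightarrow> 'c" where
  "coef g = Phi (\<lambda>\<alpha>. \<phi> \<alpha> (g \<alpha>))"

lemma fam_coef: "g \<in> PiE \<Delta> B \<Longrightarrow> fam (\<lambda>\<alpha>. \<phi> \<alpha> (g \<alpha>))"
  unfolding fam_def using lin_\<phi> PiE_mem by blast

text \<open>After expanding every slot, the coordinates of each term are collected in slot \<beta>,
  where additivity adds up the contributions of different tuples to the same g. Integrality of the
  coefficients is proved alongside, since otherwise the collected tuples would leave the valuation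
  rings.\<close>

lemma expand:
  assumes u: "Poly_Mapping.keys u \<subseteq> {f. good f}" and \<beta>: "\<beta> \<in> \<Delta>"
  shows "u \<in> carrier FT \<and> (\<forall>g\<in>PiE \<Delta> B. coef g u \<in> O0) \<and>
    cls u = cls (\<Sum>g\<in>PiE \<Delta> B. frag_of (g(\<beta> := coef g u \<otimes> g \<beta>)))"
proof -
  have finG: "finite (PiE \<Delta> B)" using fin finite_B by (intro finite_PiE) auto
  have cl: "g(\<beta> := k \<otimes> g \<beta>) \<in> tup" if "g \<in> PiE \<Delta> B" "k \<in> O0" for g k
    by (rule upd_closed[OF B_tup[OF that(1)] \<beta> OK_scalar[OF \<beta> that(2) tup_mem[OF B_tup[OF that(1)] \<beta>]]])
  have c0: "\<zero> \<in> O0" using subringE(2)[OF O0_subring] .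
  from u show ?thesis
  proof (induction u rule: frag_induction)
    case zero
    have "cls (\<Sum>g\<in>PiE \<Delta> B. frag_of (g(\<beta> := coef g 0 \<otimes> g \<beta>))) = cls (\<Sum>g\<in>PiE \<Delta> B. 0)"
    proof (rule conjunct2[OF conjunct2[OF cls_sum_cong[OF finG]]])
      fix g assume g: "g \<in> PiE \<Delta> B"
      have k: "coef g 0 = \<zero>" unfolding coef_def by (rule Phi_0[OF fam_coef[OF g]])
      show 1: "frag_of (g(\<beta> := coef g 0 \<otimes> g \<beta>)) \<in> carrier FT" unfolding k by (rule FT_carrier_of[OF cl[OF g c0]])
      have "tens (g(\<beta> := \<zero> \<otimes> g \<beta>)) = \<zero>\<^bsub>TR\<^esub>"
        by (rule tens_zero[OF cl[OF g c0] \<beta>]) (simp add: tup_carrier[OF B_tup[OF g] \<beta>])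
      then show "cls (frag_of (g(\<beta> := coef g 0 \<otimes> g \<beta>))) = cls 0"
        unfolding k tens_def using cls.hom_zero by simp
    qed simp
    moreover have "coef g 0 \<in> O0" if "g \<in> PiE \<Delta> B" for g
      unfolding coef_def Phi_0[OF fam_coef[OF that]] by (rule c0)
    ultimately show ?case by (simp del: fun_upd_apply)
  next
    case (one f)
    then have f: "good f" by simp
    have ft: "f \<in> tup" by (rule goodD(1)[OF f])
    have k: "coef g (frag_of f) = (\<Otimes>\<alpha>\<in>\<Delta>. \<phi> \<alpha> (g \<alpha>) (f \<alpha>))" if "g \<in> PiE \<Delta> B" for g
      using Phi(2)[OF fam_coef[OF that] ft] by (simp add: coef_def pr_def)
    have s: "coef g (frag_of f) \<in> O0 \<and> tens (mix \<Delta> g f) = tens (g(\<beta> := coef g (frag_of f) \<otimes> g \<beta>))"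
      if g: "g \<in> PiE \<Delta> B" for g
    proof -
      have c: "\<phi> \<alpha> (g \<alpha>) (f \<alpha>) \<in> O0" if "\<alpha> \<in> \<Delta>" for \<alpha>
        by (rule goodD(2)[OF f that PiE_mem[OF g that]])
      \<comment> \<open>Outside \<Delta> both tuples have the value \<open>undefined\<close>, so the
        last branch may be written with g, as \<open>tens_scalars\<close> wants it.\<close>
      have m: "mix \<Delta> g f = (\<lambda>\<alpha>. if \<alpha> \<in> \<Delta> then \<phi> \<alpha> (g \<alpha>) (f \<alpha>) \<otimes> g \<alpha> else g \<alpha>)"
        using PiE_arb[OF ft] PiE_arb[OF g] by (auto simp: mix_def fun_eq_iff)
      have "mix \<Delta> g f \<in> tup \<and> (\<Otimes>\<alpha>\<in>\<Delta>. \<phi> \<alpha> (g \<alpha>) (f \<alpha>)) \<in> O0 \<and>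
        tens (mix \<Delta> g f) = inslot \<beta> (\<Otimes>\<alpha>\<in>\<Delta>. \<phi> \<alpha> (g \<alpha>) (f \<alpha>)) \<otimes>\<^bsub>TR\<^esub> tens g"
        unfolding m by (rule tens_scalars[OF B_tup[OF g] \<beta> O0_subring _ fin subset_refl]) (rule c)
      then show ?thesis
        using inslot_mult_tens[OF \<beta> A0_mem[OF \<beta>] B_tup[OF g]] k[OF g] by simp
    qed
    have "cls (frag_of f) = cls (\<Sum>g\<in>PiE \<Delta> B. frag_of (mix \<Delta> g f))"
      by (rule expand_tuple[OF f fin subset_refl])
    also have "\<dots> = cls (\<Sum>g\<in>PiE \<Delta> B. frag_of (g(\<beta> := coef g (frag_of f) \<otimes> g \<beta>)))"
    proof (rule conjunct2[OF conjunct2[OF cls_sum_cong[OF finG]]])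
      fix g assume g: "g \<in> PiE \<Delta> B"
      show "frag_of (mix \<Delta> g f) \<in> carrier FT" by (rule FT_carrier_of[OF mix_closed[OF f subset_refl g]])
      show "frag_of (g(\<beta> := coef g (frag_of f) \<otimes> g \<beta>)) \<in> carrier FT"
        using s[OF g] by (intro FT_carrier_of cl[OF g]) blast
      show "cls (frag_of (mix \<Delta> g f)) = cls (frag_of (g(\<beta> := coef g (frag_of f) \<otimes> g \<beta>)))"
        using s[OF g] by (simp add: tens_def)
    qed
    finally show ?case using ft s by (simp del: fun_upd_apply)
  next
    case (diff a b)
    let ?s = "\<lambda>u g. frag_of (g(\<beta> := coef g u \<otimes> g \<beta>))"
    have ab: "a \<in> carrier FT" "b \<in> carrier FT" and ca: "\<And>g. g \<in> PiE \<Delta> B \<Longrightarrow> coef g a \<in> O0"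
      and cb: "\<And>g. g \<in> PiE \<Delta> B \<Longrightarrow> coef g b \<in> O0"
      and ea: "cls a = cls (\<Sum>g\<in>PiE \<Delta> B. ?s a g)" and eb: "cls b = cls (\<Sum>g\<in>PiE \<Delta> B. ?s b g)"
      using diff by blast+
    have k: "coef g (a - b) = coef g a \<ominus> coef g b" if "g \<in> PiE \<Delta> B" for g
      unfolding coef_def by (rule Phi_diff[OF fam_coef[OF that] ab])
    have c: "coef g (a - b) \<in> O0" if "g \<in> PiE \<Delta> B" for g
      unfolding k[OF that] minus_eq using ca[OF that] cb[OF that]
      by (intro subringE(7)[OF O0_subring] subringE(5)[OF O0_subring])
    have sa: "?s a g \<in> carrier FT" "?s b g \<in> carrier FT" if "g \<in> PiE \<Delta> B" for g
      by (rule FT_carrier_of[OF cl[OF that ca[OF that]]], rule FT_carrier_of[OF cl[OF that cb[OF that]]])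
    have "cls (\<Sum>g\<in>PiE \<Delta> B. ?s (a - b) g) = cls (\<Sum>g\<in>PiE \<Delta> B. ?s a g - ?s b g)"
    proof (rule conjunct2[OF conjunct2[OF cls_sum_cong[OF finG]]])
      fix g assume g: "g \<in> PiE \<Delta> B"
      show "?s (a - b) g \<in> carrier FT" by (rule FT_carrier_of[OF cl[OF g c[OF g]]])
      show "?s a g - ?s b g \<in> carrier FT" using sa[OF g] by (rule FT_carrier_diff)
      have gb: "g \<beta> \<in> carrier C" "coef g a \<in> carrier C" "coef g b \<in> carrier C"
        using tup_carrier[OF B_tup[OF g] \<beta>] ca[OF g] cb[OF g] K0_carrier by auto
      \<comment> \<open>Written as a sum because \<open>tens_add\<close> speaks of sums in a slot;
        the difference is recovered afterwards.\<close>
      have "coef g a \<otimes> g \<beta> = coef g (a - b) \<otimes> g \<beta> \<oplus> coef g b \<otimes> g \<beta>"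
        unfolding k[OF g] using gb by algebra
      then have "tens (g(\<beta> := coef g a \<otimes> g \<beta>)) =
          tens (g(\<beta> := coef g (a - b) \<otimes> g \<beta>)) \<oplus>\<^bsub>TR\<^esub> tens (g(\<beta> := coef g b \<otimes> g \<beta>))"
        using tens_add[OF B_tup[OF g] \<beta> OK_scalar[OF \<beta> c[OF g]] OK_scalar[OF \<beta> cb[OF g]]]
          tup_mem[OF B_tup[OF g] \<beta>] by simp
      then show "cls (?s (a - b) g) = cls (?s a g - ?s b g)"
        using cls_diff[OF sa[OF g]] tens_closed[OF cl[OF g c[OF g]]] tens_closed[OF cl[OF g cb[OF g]]]
        by (simp add: tens_def)
    qed
    also have "\<dots> = cls a \<ominus>\<^bsub>TR\<^esub> cls b"
      unfolding sum_subtractf ea eb by (intro cls_diff sum_carrier[OF finG] sa)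
    also have "\<dots> = cls (a - b)" using cls_diff[OF ab] by simp
    finally show ?case using c FT_carrier_diff[OF ab] by (simp del: fun_upd_apply)
  qed
qed

end

section \<open>Torsion-freeness of the tensor product\<close>

context subfield_family
begin

text \<open>Only finitely many tuples occur in u, so \<open>coordinates\<close> applies to the
  entries of each slot. In the resulting system u expands with the coefficients
  \<open>coef g u\<close>, and all of these are 0.\<close>

lemma ker_subset_TI: "ker \<subseteq> TI"
proof
  fix u assume u: "u \<in> ker"
  then have uc: "u \<in> carrier FT" by (simp add: ker_def)
  \<comment> \<open>Generators and functionals of a slot are packed into one pair, so that a single
    choice over the slots yields both.\<close>
  have "\<exists>p. finite (fst p) \<and> fst p \<subseteq> OK \<alpha> \<and>
      (\<forall>b\<in>fst p. valued_extension.lin C K0 (K \<alpha>) (snd p b)) \<and>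
      (\<forall>f\<in>Poly_Mapping.keys u. (\<forall>b\<in>fst p. snd p b (f \<alpha>) \<in> O0) \<and>
         f \<alpha> = valued_extension.comb C (fst p) (\<lambda>b. snd p b (f \<alpha>)))" if \<alpha>: "\<alpha> \<in> \<Delta>" for \<alpha>
  proof -
    interpret VE: valued_extension C v K0 "K \<alpha>" by (rule extension[OF \<alpha>])
    have "finite ((\<lambda>f. f \<alpha>) ` Poly_Mapping.keys u)" by simp
    moreover have "(\<lambda>f. f \<alpha>) ` Poly_Mapping.keys u \<subseteq> VE.OL"
      using uc tup_mem[OF _ \<alpha>] by (auto simp: FT_carrier VE.OL_def)
    ultimately obtain D \<psi> where "finite D" "D \<subseteq> VE.OL" "\<And>b. b \<in> D \<Longrightarrow> VE.lin (\<psi> b)"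
      "\<And>x b. x \<in> (\<lambda>f. f \<alpha>) ` Poly_Mapping.keys u \<Longrightarrow> b \<in> D \<Longrightarrow> \<psi> b x \<in> VE.O0"
      "\<And>x. x \<in> (\<lambda>f. f \<alpha>) ` Poly_Mapping.keys u \<Longrightarrow> x = VE.comb D (\<lambda>b. \<psi> b x)"
      by (rule VE.coordinates) (rule that)
    then show ?thesis unfolding VE.OL_def VE.O0_def by (intro exI[of _ "(D, \<psi>)"]) simp
  qed
  then have "\<forall>\<alpha>\<in>\<Delta>. \<exists>p. finite (fst p) \<and> fst p \<subseteq> OK \<alpha> \<and>
      (\<forall>b\<in>fst p. valued_extension.lin C K0 (K \<alpha>) (snd p b)) \<and>
      (\<forall>f\<in>Poly_Mapping.keys u. (\<forall>b\<in>fst p. snd p b (f \<alpha>) \<in> O0) \<and>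
         f \<alpha> = valued_extension.comb C (fst p) (\<lambda>b. snd p b (f \<alpha>)))" by blast
  from bchoice[OF this] obtain P where P: "\<And>\<alpha>. \<alpha> \<in> \<Delta> \<Longrightarrow> finite (fst (P \<alpha>)) \<and> fst (P \<alpha>) \<subseteq> OK \<alpha> \<and>
      (\<forall>b\<in>fst (P \<alpha>). valued_extension.lin C K0 (K \<alpha>) (snd (P \<alpha>) b)) \<and>
      (\<forall>f\<in>Poly_Mapping.keys u. (\<forall>b\<in>fst (P \<alpha>). snd (P \<alpha>) b (f \<alpha>) \<in> O0) \<and>
         f \<alpha> = valued_extension.comb C (fst (P \<alpha>)) (\<lambda>b. snd (P \<alpha>) b (f \<alpha>)))" by blast
  interpret CS: coordinate_system C v \<Delta> K0 K "\<lambda>\<alpha>. fst (P \<alpha>)" "\<lambda>\<alpha>. snd (P \<alpha>)"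
    by (intro coordinate_system.intro subfield_family_axioms coordinate_system_axioms.intro)
      (simp_all add: P)
  obtain \<beta> where \<beta>: "\<beta> \<in> \<Delta>" using nonempty by blast
  have "f \<in> tup" if "f \<in> Poly_Mapping.keys u" for f using that uc by (auto simp: FT_carrier)
  then have good: "Poly_Mapping.keys u \<subseteq> {f. CS.good f}"
    using P unfolding CS.good_def by blast
  have finG: "finite (\<Pi>\<^sub>E \<alpha>\<in>\<Delta>. fst (P \<alpha>))" using fin CS.finite_B by (intro finite_PiE) auto
  have "cls u = cls (\<Sum>g\<in>(\<Pi>\<^sub>E \<alpha>\<in>\<Delta>. fst (P \<alpha>)). frag_of (g(\<beta> := CS.coef g u \<otimes> g \<beta>)))"
    using CS.expand[OF good \<beta>] by blast
  also have "\<dots> = cls (\<Sum>g\<in>(\<Pi>\<^sub>E \<alpha>\<in>\<Delta>. fst (P \<alpha>)). 0)"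
  proof (rule conjunct2[OF conjunct2[OF cls_sum_cong[OF finG]]])
    fix g assume g: "g \<in> (\<Pi>\<^sub>E \<alpha>\<in>\<Delta>. fst (P \<alpha>))"
    have gb: "g \<beta> \<in> carrier C" by (rule tup_carrier[OF CS.B_tup[OF g] \<beta>])
    have "CS.coef g u = \<zero>" unfolding CS.coef_def using u CS.fam_coef[OF g] by (simp add: ker_def)
    then have k: "CS.coef g u \<otimes> g \<beta> = \<zero>" using gb by simp
    have t: "g(\<beta> := \<zero>) \<in> tup" by (rule upd_closed[OF CS.B_tup[OF g] \<beta> A_zero[OF \<beta>]])
    show "frag_of (g(\<beta> := CS.coef g u \<otimes> g \<beta>)) \<in> carrier FT" unfolding k by (rule FT_carrier_of[OF t])
    show "cls (frag_of (g(\<beta> := CS.coef g u \<otimes> g \<beta>))) = cls 0"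
      using tens_zero[OF t \<beta>] cls.hom_zero unfolding k tens_def by simp
  qed simp
  also have "\<dots> = \<zero>\<^bsub>TR\<^esub>" using cls.hom_zero by simp
  finally show "u \<in> TI" using cls_eq_0_iff[OF uc] by simp
qed

text \<open>A test functional for u becomes one for x u by precomposing with multiplication by the
  inverse of x in slot \<beta>, which is possible because functionals are defined on the field. As x
  u passes all tests, so does u.\<close>

lemma inslot_mult_cancel_zero:
  assumes \<beta>: "\<beta> \<in> \<Delta>" and x: "x \<in> OK \<beta>" "x \<noteq> \<zero>" and W: "W \<in> carrier TR"
    and 0: "inslot \<beta> x \<otimes>\<^bsub>TR\<^esub> W = \<zero>\<^bsub>TR\<^esub>"
  shows "W = \<zero>\<^bsub>TR\<^esub>"
proof -
  obtain u where u: "u \<in> carrier FT" "W = cls u" using TR_carrierE[OF W] .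
  have s: "slot \<beta> x \<in> tup" by (rule slot_closed[OF \<beta> x(1)])
  have sc: "frag_of (slot \<beta> x) \<otimes>\<^bsub>FT\<^esub> u \<in> carrier FT" by (rule FT_mult_closed[OF FT_carrier_of[OF s] u(1)])
  have "cls (frag_of (slot \<beta> x) \<otimes>\<^bsub>FT\<^esub> u) = \<zero>\<^bsub>TR\<^esub>"
    using 0 cls.hom_mult[OF FT_carrier_of[OF s] u(1)] u(2) by (simp add: inslot_def tens_def)
  then have k: "frag_of (slot \<beta> x) \<otimes>\<^bsub>FT\<^esub> u \<in> ker"
    using cls_eq_0_iff[OF sc] TI_subset_ker by blast
  have xc: "x \<in> carrier C" by (rule A_carrier[OF \<beta> x(1)])
  interpret VE: valued_extension C v K0 "K \<beta>" by (rule extension[OF \<beta>])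
  have xi: "inv x \<in> K \<beta>" "inv x \<in> carrier C" "inv x \<otimes> x = \<one>"
    using VE.L_inv[of x] x xc field_Units VE.L_carrier by auto
  have "Phi \<phi> u = \<zero>" if \<phi>: "fam \<phi>" for \<phi>
  proof -
    \<comment> \<open>This tuple is generally not integral; \<open>mulfam_fam\<close> only asks for
      entries in the fields.\<close>
    define g where "g = (\<lambda>\<alpha>. if \<alpha> = \<beta> then inv x else \<one>)"
    define \<psi> where "\<psi> = mulfam g \<phi>"
    have g: "g \<alpha> \<in> K \<alpha>" if "\<alpha> \<in> \<Delta>" for \<alpha>
      using xi(1) valued_extension.L_one[OF extension[OF that]] by (simp add: g_def)
    have \<psi>: "fam \<psi>" unfolding \<psi>_def by (rule mulfam_fam[OF \<phi> g])
    have \<psi>s: "fam (mulfam (slot \<beta> x) \<psi>)" by (rule mulfam_fam[OF \<psi> tup_K[OF s]])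
    have "Phi (mulfam (slot \<beta> x) \<psi>) w = Phi \<phi> w" if "w \<in> carrier FT" for w
      using that
    proof (induction w rule: FT_induct)
      case zero then show ?case using Phi_0[OF \<phi>] Phi_0[OF \<psi>s] by simp
    next
      case (of f)
      have "pr (mulfam (slot \<beta> x) \<psi>) f = pr \<phi> f"
        unfolding pr_def
      proof (rule finprod_cong')
        show "(\<lambda>\<alpha>. \<phi> \<alpha> (f \<alpha>)) \<in> \<Delta> \<rightarrow> carrier C" using fam_carrier[OF \<phi> of] by simp
        fix \<alpha> assume \<alpha>: "\<alpha> \<in> \<Delta>"
        have fc: "f \<alpha> \<in> carrier C" by (rule tup_carrier[OF of \<alpha>])
        have "g \<alpha> \<otimes> (slot \<beta> x \<alpha> \<otimes> f \<alpha>) = f \<alpha>"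
          using \<alpha> fc xc xi by (auto simp: g_def slot_def m_assoc[symmetric])
        then show "mulfam (slot \<beta> x) \<psi> \<alpha> (f \<alpha>) = \<phi> \<alpha> (f \<alpha>)" by (simp add: \<psi>_def mulfam_def)
      qed simp
      then show ?case using Phi(2)[OF \<phi> of] Phi(2)[OF \<psi>s of] by simp
    next
      case (diff a b)
      then show ?case using Phi_diff[OF \<phi>] Phi_diff[OF \<psi>s] by simp
    qed
    then have "Phi \<phi> u = Phi \<psi> (frag_of (slot \<beta> x) \<otimes>\<^bsub>FT\<^esub> u)"
      using Phi_mult[OF \<psi> s u(1)] u(1) by simp
    then show ?thesis using k \<psi> by (simp add: ker_def)
  qed
  then have "u \<in> TI" using u(1) ker_subset_TI by (auto simp: ker_def)
  then show ?thesis using cls_eq_0_iff[OF u(1)] u(2) by simp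
qed

lemma inslot_mult_cancel:
  assumes "\<beta> \<in> \<Delta>" "x \<in> OK \<beta>" "x \<noteq> \<zero>" "W \<in> carrier TR" "Y \<in> carrier TR"
    "inslot \<beta> x \<otimes>\<^bsub>TR\<^esub> W = inslot \<beta> x \<otimes>\<^bsub>TR\<^esub> Y"
  shows "W = Y"
proof -
  have xc: "inslot \<beta> x \<in> carrier TR" by (rule inslot_closed[OF assms(1,2)])
  have "inslot \<beta> x \<otimes>\<^bsub>TR\<^esub> (W \<ominus>\<^bsub>TR\<^esub> Y) = inslot \<beta> x \<otimes>\<^bsub>TR\<^esub> W \<ominus>\<^bsub>TR\<^esub> inslot \<beta> x \<otimes>\<^bsub>TR\<^esub> Y"
    using assms(4,5) xc by (simp add: TR.minus_eq TR.r_distr TR.r_minus)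
  also have "\<dots> = \<zero>\<^bsub>TR\<^esub>" using assms(4-6) xc by simp
  finally have "W \<ominus>\<^bsub>TR\<^esub> Y = \<zero>\<^bsub>TR\<^esub>"
    using inslot_mult_cancel_zero[OF assms(1-3)] assms(4,5) by simp
  then show ?thesis using assms(4,5) SC.minus_eq_zero_iff by blast
qed

end

section \<open>Multiplication by an element of one slot is bounded below\<close>

lemma power_bracket:
  fixes r x :: real
  assumes "0 < r" "r < 1" "0 < x" "x \<le> 1"
  obtains n where "r ^ Suc n < x" "x \<le> r ^ n"
proof -
  obtain N where "r ^ N < x" using real_arch_pow_inv[OF assms(3,2)] by blast
  moreover have "r ^ Suc N \<le> r ^ N" using assms(1,2) by (intro power_decreasing) auto
  ultimately have ex: "r ^ Suc N < x" by simp
  define n where "n = (LEAST n. r ^ Suc n < x)"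
  have 1: "r ^ Suc n < x" unfolding n_def by (rule LeastI[of _ N]) (rule ex)
  have 2: "x \<le> r ^ n"
  proof (cases n)
    case 0 then show ?thesis using assms(4) by simp
  next
    case (Suc m)
    then have "\<not> r ^ Suc m < x" unfolding n_def by (intro not_less_Least) simp
    then show ?thesis using Suc by simp
  qed
  show thesis by (rule that[OF 1 2])
qed

context valued_field
begin

lemma v_finprod: "finite D \<Longrightarrow> (\<And>a. a \<in> D \<Longrightarrow> F a \<in> carrier C) \<Longrightarrow> v (\<Otimes>a\<in>D. F a) = (\<Prod>a\<in>D. v (F a))"
proof (induction D rule: finite_induct)
  case (insert a D)
  then have "F \<in> D \<rightarrow> carrier C" "F a \<in> carrier C" by auto
  then show ?case using insert by (simp add: v_mult)
qed simp

end

context subfield_family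
begin

lemma ht_upd:
  assumes "f \<in> tup" "\<alpha> \<in> \<Delta>" "s \<in> OK \<alpha>"
  shows "ht (f(\<alpha> := s \<otimes> f \<alpha>)) = v s * ht f"
proof -
  have "ht (f(\<alpha> := s \<otimes> f \<alpha>)) = v (s \<otimes> f \<alpha>) * (\<Prod>\<beta>\<in>\<Delta> - {\<alpha>}. v ((f(\<alpha> := s \<otimes> f \<alpha>)) \<beta>))"
    unfolding ht_def using prod.remove[OF fin assms(2), of "\<lambda>\<beta>. v ((f(\<alpha> := s \<otimes> f \<alpha>)) \<beta>)"] by simp
  also have "(\<Prod>\<beta>\<in>\<Delta> - {\<alpha>}. v ((f(\<alpha> := s \<otimes> f \<alpha>)) \<beta>)) = (\<Prod>\<beta>\<in>\<Delta> - {\<alpha>}. v (f \<beta>))"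
    by (intro prod.cong) auto
  also have "v (s \<otimes> f \<alpha>) * \<dots> = v s * (v (f \<alpha>) * (\<Prod>\<beta>\<in>\<Delta> - {\<alpha>}. v (f \<beta>)))"
    using v_mult[OF A_carrier[OF assms(2,3)] tup_carrier[OF assms(1,2)]] by simp
  also have "\<dots> = v s * ht f" unfolding ht_def using prod.remove[OF fin assms(2), of "\<lambda>\<beta>. v (f \<beta>)"] by simp
  finally show ?thesis .
qed

lemma ht_le_1: assumes "f \<in> tup" shows "ht f \<le> 1"
  unfolding ht_def
proof (rule prod_le_1)
  fix \<alpha> assume "\<alpha> \<in> \<Delta>"
  then show "0 \<le> v (f \<alpha>) \<and> v (f \<alpha>) \<le> 1"
    using tup_mem[OF assms] v_nonneg[OF tup_carrier[OF assms]] by simp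
qed

text \<open>All but a bounded part of the absolute value of a tuple can be moved into a single slot by
  means of powers of \<open>\<pi>\<close>, one for each slot.\<close>

lemma divide_tuple:
  assumes \<beta>: "\<beta> \<in> \<Delta>" and \<pi>: "\<pi> \<in> K0" "0 < v \<pi>" "v \<pi> < 1" and x: "x \<in> OK \<beta>" "x \<noteq> \<zero>" and "0 < d"
    and f: "f \<in> tup" "ht f < min 1 d * v \<pi> ^ card \<Delta> * v x"
  obtains h where "h \<in> tup" "tens f = inslot \<beta> x \<otimes>\<^bsub>TR\<^esub> tens h" "ht h < d"
proof (cases "\<exists>\<alpha>\<in>\<Delta>. f \<alpha> = \<zero>")
  case True
  then obtain \<alpha> where \<alpha>: "\<alpha> \<in> \<Delta>" "f \<alpha> = \<zero>" by blast
  \<comment> \<open>A tuple with a zero entry represents the zero tensor, so f itself serves as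
    h.\<close>
  have "ht f = 0" unfolding ht_def by (intro prod_zero fin bexI[OF _ \<alpha>(1)]) (simp add: \<alpha>(2))
  then show thesis using that[OF f(1)] tens_zero[OF f(1) \<alpha>] \<open>0 < d\<close> inslot_closed[OF \<beta> x(1)] by simp
next
  case False
  have \<pi>c: "\<pi> \<in> carrier C" "\<pi> \<noteq> \<zero>" using \<pi> K0_carrier by auto
  have "\<exists>n. v \<pi> ^ Suc n < v (f \<alpha>) \<and> v (f \<alpha>) \<le> v \<pi> ^ n" if \<alpha>: "\<alpha> \<in> \<Delta>" for \<alpha>
  proof -
    have "0 < v (f \<alpha>)" "v (f \<alpha>) \<le> 1"
      using False \<alpha> v_pos[OF tup_carrier[OF f(1) \<alpha>]] tup_mem[OF f(1) \<alpha>] by auto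
    then obtain n where "v \<pi> ^ Suc n < v (f \<alpha>)" "v (f \<alpha>) \<le> v \<pi> ^ n"
      by (rule power_bracket[OF \<pi>(2,3)])
    then show ?thesis by blast
  qed
  then have "\<forall>\<alpha>\<in>\<Delta>. \<exists>n. v \<pi> ^ Suc n < v (f \<alpha>) \<and> v (f \<alpha>) \<le> v \<pi> ^ n" by blast
  from bchoice[OF this] obtain n where n: "\<And>\<alpha>. \<alpha> \<in> \<Delta> \<Longrightarrow> v \<pi> ^ Suc (n \<alpha>) < v (f \<alpha>)"
    "\<And>\<alpha>. \<alpha> \<in> \<Delta> \<Longrightarrow> v (f \<alpha>) \<le> v \<pi> ^ n \<alpha>" by blast
  \<comment> \<open>Dividing by \<open>c \<alpha>\<close> leaves an integral entry of absolute value
    greater than |\<pi>|.\<close>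
  define c where "c \<alpha> = \<pi> [^] n \<alpha>" for \<alpha>
  have cK: "c \<alpha> \<in> K0" for \<alpha>
    unfolding c_def by (rule pow_in_subring[OF K0_subring \<pi>(1)])
  note cc = K0_carrier[OF cK]
  have vc: "v (c \<alpha>) = v \<pi> ^ n \<alpha>" for \<alpha> unfolding c_def using \<pi>c(1) by (rule v_pow)
  have c0: "c \<alpha> \<noteq> \<zero>" for \<alpha> using vc[of \<alpha>] \<pi>(2) by (auto simp: power_eq_0_iff)
  have cO: "c \<alpha> \<in> O0" for \<alpha> using cK vc \<pi> by (simp add: power_le_one)
  define g where "g = (\<lambda>\<alpha>\<in>\<Delta>. inv (c \<alpha>) \<otimes> f \<alpha>)"
  have ci: "inv (c \<alpha>) \<in> carrier C" "c \<alpha> \<otimes> inv (c \<alpha>) = \<one>" for \<alpha>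
    using c0 cc field_Units by auto
  have g: "g \<in> tup"
    unfolding g_def
  proof (rule restrict_PiE_iff[THEN iffD2], rule ballI)
    fix \<alpha> assume \<alpha>: "\<alpha> \<in> \<Delta>"
    interpret VE: valued_extension C v K0 "K \<alpha>" by (rule extension[OF \<alpha>])
    have "inv (c \<alpha>) \<otimes> f \<alpha> \<in> K \<alpha>"
      using VE.K0_inv[OF cK c0] K0_in_K[OF \<alpha>] tup_K[OF f(1) \<alpha>] by (intro VE.L_mult) auto
    moreover have "v (inv (c \<alpha>) \<otimes> f \<alpha>) \<le> 1"
    proof -
      have "v (inv (c \<alpha>)) * v (f \<alpha>) \<le> inverse (v (c \<alpha>)) * v (c \<alpha>)"
        unfolding v_inv[OF cc c0] using n(2)[OF \<alpha>] vc \<pi>(2) by (intro mult_left_mono) auto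
      also have "\<dots> \<le> 1" using vc \<pi>(2) by simp
      finally show ?thesis using v_mult[OF ci(1) tup_carrier[OF f(1) \<alpha>]] by simp
    qed
    ultimately show "inv (c \<alpha>) \<otimes> f \<alpha> \<in> OK \<alpha>" by simp
  qed
  have "f \<alpha> = c \<alpha> \<otimes> g \<alpha>" if \<alpha>: "\<alpha> \<in> \<Delta>" for \<alpha>
    using \<alpha> ci tup_carrier[OF f(1) \<alpha>] cc by (simp add: g_def m_assoc[symmetric])
  then have fg: "f = (\<lambda>\<alpha>. if \<alpha> \<in> \<Delta> then c \<alpha> \<otimes> g \<alpha> else g \<alpha>)"
    using PiE_arb[OF f(1)] PiE_arb[OF g] by (auto simp: fun_eq_iff)
  define k where "k = (\<Otimes>\<alpha>\<in>\<Delta>. c \<alpha>)"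
  have "(\<lambda>\<alpha>. if \<alpha> \<in> \<Delta> then c \<alpha> \<otimes> g \<alpha> else g \<alpha>) \<in> tup \<and> (\<Otimes>\<alpha>\<in>\<Delta>. c \<alpha>) \<in> O0 \<and>
    tens (\<lambda>\<alpha>. if \<alpha> \<in> \<Delta> then c \<alpha> \<otimes> g \<alpha> else g \<alpha>) = inslot \<beta> (\<Otimes>\<alpha>\<in>\<Delta>. c \<alpha>) \<otimes>\<^bsub>TR\<^esub> tens g"
    by (rule tens_scalars[OF g \<beta> O0_subring _ fin subset_refl]) (rule cO)
  then have k: "k \<in> O0" "tens f = inslot \<beta> k \<otimes>\<^bsub>TR\<^esub> tens g"
    unfolding k_def fg[symmetric] by blast+
  have kc: "k \<in> carrier C" "k \<in> K \<beta>" using k(1) K0_carrier K0_in_K[OF \<beta>] by auto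
  \<comment> \<open>Each entry exceeds |\<pi>| times the power taken out of its slot. The loss of
    one factor per slot is the origin of \<open>v \<pi> ^ card \<Delta>\<close> in the
    hypothesis.\<close>
  have "v k * v \<pi> ^ card \<Delta> = (\<Prod>\<alpha>\<in>\<Delta>. v \<pi> ^ Suc (n \<alpha>))"
    unfolding k_def using v_finprod[OF fin cc] vc by (simp add: prod.distrib mult.commute)
  also have "\<dots> \<le> ht f" unfolding ht_def using n(1) \<pi>(2) by (intro prod_mono) (auto intro: less_imp_le)
  finally have "v k * v \<pi> ^ card \<Delta> < (min 1 d * v x) * v \<pi> ^ card \<Delta>" using f(2) by (simp add: ac_simps)
  then have vk: "v k < min 1 d * v x" using \<pi>(2) by simp
  have xc: "x \<in> carrier C" by (rule A_carrier[OF \<beta> x(1)])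
  interpret VE: valued_extension C v K0 "K \<beta>" by (rule extension[OF \<beta>])
  \<comment> \<open>All the scalars now sit in k, which is small enough to be divided by x. In
    \<open>min 1 d\<close> the 1 makes the quotient integral and the d makes it small.\<close>
  define s where "s = inv x \<otimes> k"
  have xi: "inv x \<in> K \<beta>" "inv x \<in> carrier C" "x \<otimes> inv x = \<one>"
    using VE.L_inv[of x] x xc field_Units VE.L_carrier by auto
  have vs: "v s < min 1 d"
  proof -
    have "v s = v k / v x"
      unfolding s_def v_mult[OF xi(2) kc(1)] v_inv[OF xc x(2)] by (simp add: divide_inverse mult.commute)
    moreover have "v k / v x < min 1 d" using vk pos_divide_less_eq[OF v_pos[OF xc x(2)]] by blast
    ultimately show ?thesis by (rule ord_eq_less_trans)
  qed
  have s: "s \<in> OK \<beta>" using vs VE.L_mult[OF xi(1) kc(2)] by (simp add: s_def)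
  have "k = x \<otimes> s" using xi xc kc by (simp add: s_def m_assoc[symmetric])
  then have "tens f = inslot \<beta> x \<otimes>\<^bsub>TR\<^esub> (inslot \<beta> s \<otimes>\<^bsub>TR\<^esub> tens g)"
    using k(2) inslot_mult[OF \<beta> x(1) s] inslot_closed[OF \<beta> x(1)] inslot_closed[OF \<beta> s] g by (simp add: TR.m_assoc)
  also have "inslot \<beta> s \<otimes>\<^bsub>TR\<^esub> tens g = tens (g(\<beta> := s \<otimes> g \<beta>))" by (rule inslot_mult_tens[OF \<beta> s g])
  finally have 1: "tens f = inslot \<beta> x \<otimes>\<^bsub>TR\<^esub> tens (g(\<beta> := s \<otimes> g \<beta>))" .
  have 2: "g(\<beta> := s \<otimes> g \<beta>) \<in> tup" by (rule upd_closed[OF g \<beta> A_mult[OF \<beta> s tup_mem[OF g \<beta>]]])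
  have "ht (g(\<beta> := s \<otimes> g \<beta>)) \<le> v s"
    unfolding ht_upd[OF g \<beta> s]
    using ht_le_1[OF g] v_nonneg[OF A_carrier[OF \<beta> s]] by (intro mult_left_le) auto
  then have "ht (g(\<beta> := s \<otimes> g \<beta>)) < d" using vs by simp
  then show thesis using that[OF 2 1] by blast
qed

lemma divide_tsum:
  assumes \<beta>: "\<beta> \<in> \<Delta>" and \<pi>: "\<pi> \<in> K0" "0 < v \<pi>" "v \<pi> < 1" and x: "x \<in> OK \<beta>" "x \<noteq> \<zero>" and d: "0 < d"
    and fs: "set fs \<subseteq> tup" "\<forall>f\<in>set fs. ht f < min 1 d * v \<pi> ^ card \<Delta> * v x"
  shows "\<exists>hs. set hs \<subseteq> tup \<and> (\<forall>h\<in>set hs. ht h < d) \<and> tsum fs = inslot \<beta> x \<otimes>\<^bsub>TR\<^esub> tsum hs"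
  using fs
proof (induction fs)
  case Nil
  then show ?case using inslot_closed[OF \<beta> x(1)] by (intro exI[of _ "[]"]) (simp add: tsum_Nil)
next
  case (Cons f fs)
  have f: "f \<in> tup" "set fs \<subseteq> tup" "ht f < min 1 d * v \<pi> ^ card \<Delta> * v x"
    "\<forall>f\<in>set fs. ht f < min 1 d * v \<pi> ^ card \<Delta> * v x"
    using Cons.prems by simp_all
  obtain hs where hs: "set hs \<subseteq> tup" "\<forall>h\<in>set hs. ht h < d" "tsum fs = inslot \<beta> x \<otimes>\<^bsub>TR\<^esub> tsum hs"
    using Cons.IH[OF f(2,4)] by blast
  obtain h where h: "h \<in> tup" "tens f = inslot \<beta> x \<otimes>\<^bsub>TR\<^esub> tens h" "ht h < d"
    by (rule divide_tuple[OF \<beta> \<pi> x d f(1,3)])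
  have "tsum (f # fs) = inslot \<beta> x \<otimes>\<^bsub>TR\<^esub> tsum (h # hs)"
    using tsum_Cons[OF f(1,2)] tsum_Cons[OF h(1) hs(1)] h(2) hs(3)
      TR.r_distr[OF tens_closed[OF h(1)] tsum_closed[OF hs(1)] inslot_closed[OF \<beta> x(1)]] by simp
  then show ?case using h hs by (intro exI[of _ "h # hs"]) simp
qed

text \<open>A representation of x u by small tuples is divided by x term by term. By cancellation
  the resulting sum is u itself, so u is represented by tuples of height below d.\<close>

lemma inslot_mult_bounded_below:
  assumes \<beta>: "\<beta> \<in> \<Delta>" and \<pi>: "\<pi> \<in> K0" "0 < v \<pi>" "v \<pi> < 1" and x: "x \<in> OK \<beta>" "x \<noteq> \<zero>" and d: "0 < d"
  shows "\<exists>e>0. \<forall>u\<in>carrier TR. q (inslot \<beta> x \<otimes>\<^bsub>TR\<^esub> u) < e \<longrightarrow> q u < d"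
proof -
  define e where "e = min 1 d * v \<pi> ^ card \<Delta> * v x"
  have e: "0 < e" unfolding e_def using d \<pi>(2) v_pos[OF A_carrier[OF \<beta> x(1)] x(2)] by simp
  have "q u < d" if u: "u \<in> carrier TR" and less: "q (inslot \<beta> x \<otimes>\<^bsub>TR\<^esub> u) < e" for u
  proof -
    have c: "inslot \<beta> x \<otimes>\<^bsub>TR\<^esub> u \<in> carrier TR" using u inslot_closed[OF \<beta> x(1)] by simp
    obtain fs where fs: "set fs \<subseteq> tup" "inslot \<beta> x \<otimes>\<^bsub>TR\<^esub> u = tsum fs" "\<forall>f\<in>set fs. ht f < e"
      using q_less_iff[OF c e] less by blast
    obtain hs where hs: "set hs \<subseteq> tup" "\<forall>h\<in>set hs. ht h < d" "tsum fs = inslot \<beta> x \<otimes>\<^bsub>TR\<^esub> tsum hs"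
      using divide_tsum[OF \<beta> \<pi> x d fs(1)] fs(3) unfolding e_def by blast
    have "u = tsum hs"
      using fs(2) hs(3) by (intro inslot_mult_cancel[OF \<beta> x u tsum_closed[OF hs(1)]]) simp
    then show ?thesis using tsum_q_less[OF hs(1,2) d] by simp
  qed
  then show ?thesis using e by blast
qed

theorem slot_nonzerodivisor:
  assumes "\<beta> \<in> \<Delta>" "\<pi> \<in> K0" "0 < v \<pi>" "v \<pi> < 1" "x \<in> OK \<beta>" "x \<noteq> \<zero>"
  shows "to_completion TR q (inslot \<beta> x) \<in> non_zero_divisors (completion TR q)"
  using inslot_mult_bounded_below[OF assms]
  by (intro SC.to_completion_nonzerodivisor inslot_closed[OF assms(1,5)])

end

section \<open>Roots in perfectoid fields\<close>

lemma nat_pow_subset: "x [^]\<^bsub>C\<lparr>carrier := H\<rparr>\<^esub> (n::nat) = x [^]\<^bsub>C\<^esub> n"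
  by (simp add: nat_pow_def)

lemma (in ring) subring_neg:
  assumes "subring H R" "x \<in> H" shows "\<ominus>\<^bsub>R\<lparr>carrier := H\<rparr>\<^esub> x = \<ominus> x"
proof -
  interpret H: ring "R\<lparr>carrier := H\<rparr>" by (rule subring_is_ring[OF assms(1)])
  have "x \<in> carrier R" using subringE(1)[OF assms(1)] assms(2) by blast
  then show ?thesis using assms(2) subringE(5)[OF assms] by (intro H.minus_equality) (simp_all add: l_neg)
qed

lemma (in ring) subring_minus:
  "subring H R \<Longrightarrow> y \<in> H \<Longrightarrow> x \<ominus>\<^bsub>R\<lparr>carrier := H\<rparr>\<^esub> y = x \<ominus> y"
  using subring_neg by (simp add: a_minus_def)

context valued_field
begin

lemma subring_ultranormed: assumes "subring H C" shows "ultranormed_group (C\<lparr>carrier := H\<rparr>) v"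
proof -
  interpret H: ring "C\<lparr>carrier := H\<rparr>" by (rule subring_is_ring[OF assms])
  have c: "x \<in> H \<Longrightarrow> x \<in> carrier C" for x using subringE(1)[OF assms] by blast
  show ?thesis
    by unfold_locales (use c v_nonneg v_minus_le v_eq_0_iff subring_minus[OF assms] in auto)
qed

lemma v_nat_le: "x \<in> carrier C \<Longrightarrow> v ([(n::nat)] \<cdot> x) \<le> v x"
proof (induction n)
  case (Suc n)
  then have "v ([n] \<cdot> x \<oplus> x) \<le> max (v ([n] \<cdot> x)) (v x)" by (intro v_add_le) auto
  then show ?case using Suc by simp
qed (simp add: v_nonneg)

text \<open>The first-order Taylor expansion of the power at b, with remainder (a - b)^2 e and
  integral e. Induction replaces the binomial coefficients.\<close>

lemma power_minus_power:
  assumes a: "a \<in> carrier C" "v a \<le> 1" and b: "b \<in> carrier C" "v b \<le> 1"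
  shows "\<exists>e\<in>carrier C. v e \<le> 1 \<and>
    a [^] Suc n \<ominus> b [^] Suc n = (a \<ominus> b) \<otimes> ([Suc n] \<cdot> (b [^] n) \<oplus> (a \<ominus> b) \<otimes> e)"
proof (induction n)
  case 0
  show ?case using a b by (intro bexI[of _ \<zero>]) auto
next
  case (Suc n)
  then obtain e where e: "e \<in> carrier C" "v e \<le> 1"
    "a [^] Suc n \<ominus> b [^] Suc n = (a \<ominus> b) \<otimes> ([Suc n] \<cdot> (b [^] n) \<oplus> (a \<ominus> b) \<otimes> e)" by blast
  define N where "N = [Suc n] \<cdot> (b [^] n)"
  have N: "N \<in> carrier C" "v N \<le> 1"
    using b v_nat_le[of "b [^] n" "Suc n"] v_pow[OF b(1)] power_le_one[OF v_nonneg[OF b(1)] b(2), of n]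
    by (simp_all add: N_def del: add.nat_pow_Suc)
  define A B where "A = a [^] Suc n" and "B = b [^] Suc n"
  have AB: "A \<in> carrier C" "B \<in> carrier C" using a b by (simp_all add: A_def B_def)
  have NB: "[Suc (Suc n)] \<cdot> (b [^] Suc n) = N \<otimes> b \<oplus> B"
    using b add_pow_ldistr[of "b [^] n" b "Suc n"] by (simp add: N_def B_def del: add.nat_pow_Suc) simp
  have e': "N \<oplus> a \<otimes> e \<in> carrier C" "v (N \<oplus> a \<otimes> e) \<le> 1"
  proof -
    have "v (a \<otimes> e) \<le> 1" using a e v_nonneg by (simp add: v_mult mult_le_one)
    then have "max (v N) (v (a \<otimes> e)) \<le> 1" using N by simp
    then show "v (N \<oplus> a \<otimes> e) \<le> 1" using v_add_le[OF N(1), of "a \<otimes> e"] a e by (meson m_closed order_trans)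
  qed (use N a e in simp)
  have "a [^] Suc (Suc n) \<ominus> b [^] Suc (Suc n) = a \<otimes> A \<ominus> b \<otimes> B"
    using a b AB by (simp add: A_def B_def m_comm)
  also have "\<dots> = a \<otimes> (A \<ominus> B) \<oplus> (a \<ominus> b) \<otimes> B" using a b AB by algebra
  also have "\<dots> = a \<otimes> ((a \<ominus> b) \<otimes> (N \<oplus> (a \<ominus> b) \<otimes> e)) \<oplus> (a \<ominus> b) \<otimes> B"
    using e(3) unfolding A_def B_def N_def by simp
  also have "\<dots> = (a \<ominus> b) \<otimes> ((N \<otimes> b \<oplus> B) \<oplus> (a \<ominus> b) \<otimes> (N \<oplus> a \<otimes> e))"
    using a b AB N e by algebra
  finally show ?case using e' unfolding NB by blast
qed

text \<open>For exponent p the linear coefficient in \<open>power_minus_power\<close> is p times an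
  integral element. Taking p-th powers therefore brings integral elements closer by a factor
  max(|p|, |a - b|).\<close>

lemma v_power_minus_power_le:
  assumes a: "a \<in> carrier C" "v a \<le> 1" and b: "b \<in> carrier C" "v b \<le> 1" and "0 < p"
  shows "v (a [^] p \<ominus> b [^] p) \<le> v (a \<ominus> b) * max (v (p_elem p C)) (v (a \<ominus> b))"
proof -
  obtain n where p: "p = Suc n" using \<open>0 < p\<close> by (cases p) auto
  obtain e where e: "e \<in> carrier C" "v e \<le> 1"
    "a [^] p \<ominus> b [^] p = (a \<ominus> b) \<otimes> ([p] \<cdot> (b [^] n) \<oplus> (a \<ominus> b) \<otimes> e)"
    using power_minus_power[OF a b] unfolding p by blast
  have pb: "[p] \<cdot> (b [^] n) = p_elem p C \<otimes> b [^] n"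
    using b add_pow_ldistr[of \<one> "b [^] n" p] by (simp add: p_elem_def)
  have pe: "p_elem p C \<in> carrier C" by (simp add: p_elem_def)
  have "v (p_elem p C \<otimes> b [^] n) \<le> v (p_elem p C)"
    using b pe power_le_one[OF v_nonneg[OF b(1)] b(2), of n] v_nonneg[OF pe]
    by (simp add: v_mult v_pow mult_left_le)
  moreover have "v ((a \<ominus> b) \<otimes> e) \<le> v (a \<ominus> b)"
    using a b e v_nonneg by (simp add: v_mult mult_left_le)
  moreover have "v (p_elem p C \<otimes> b [^] n \<oplus> (a \<ominus> b) \<otimes> e) \<le> max (v (p_elem p C \<otimes> b [^] n)) (v ((a \<ominus> b) \<otimes> e))"
    using a b e pe by (intro v_add_le) auto
  ultimately have "v (p_elem p C \<otimes> b [^] n \<oplus> (a \<ominus> b) \<otimes> e) \<le> max (v (p_elem p C)) (v (a \<ominus> b))" by linarith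
  then show ?thesis
    using e(1,3) a b pe v_nonneg[of "a \<ominus> b"] unfolding pb by (simp add: v_mult mult_left_mono)
qed

end

locale perfectoid_subfield = valued_field C v for C :: "'c ring" (structure) and v +
  fixes p :: nat and L :: "'c set"
  assumes p_pos: "0 < p" and perfectoid: "perfectoid_field p C v L"
    and p_nonzero: "p_elem p C \<noteq> \<zero>" and p_small: "v (p_elem p C) < 1"
begin

abbreviation r where "r \<equiv> v (p_elem p C)"

lemma L_subfield: "subfield L C" and L_complete: "norm_complete (C\<lparr>carrier := L\<rparr>) v"
  and L_frob: "frobenius_surj p (valuation_ring C v L Quot (PIdl\<^bsub>valuation_ring C v L\<^esub> (p_elem p C)))"
  and L_nondiscrete: "\<not> discrete_abs v L"
  using perfectoid by (auto simp: perfectoid_field_def)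

lemma L_subring: "subring L C" using subfieldE(1)[OF L_subfield] .

lemma L_carrier: "x \<in> L \<Longrightarrow> x \<in> carrier C" using subringE(1)[OF L_subring] by blast

lemma p_carrier: "p_elem p C \<in> carrier C" by (simp add: p_elem_def)

lemma p_L: "p_elem p C \<in> L" unfolding p_elem_def by (rule nat_in_subring[OF L_subring])

lemma r_pos: "0 < r" using v_nonneg[OF p_carrier] v_eq_0_iff[OF p_carrier] p_nonzero by linarith

lemma OL_subring: "subring {x \<in> L. v x \<le> 1} C"
  by (rule subring_unit_ball[OF L_subfield])

text \<open>Surjectivity of Frobenius on the quotient by p, read off on representatives: equal
  cosets differ by an integral multiple of p.\<close>

lemma approximate_root:
  assumes a: "a \<in> L" "v a \<le> 1"
  shows "\<exists>b. b \<in> L \<and> v b \<le> 1 \<and> v (b [^] p \<ominus> a) \<le> r"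
proof -
  define V where "V = valuation_ring C v L"
  have V: "V = C\<lparr>carrier := {x \<in> L. v x \<le> 1}\<rparr>" by (simp add: V_def valuation_ring_def)
  interpret V: cring V
    unfolding V using subring_is_ring[OF OL_subring] subcring_iff[of "{x \<in> L. v x \<le> 1}"] subcringI'[OF OL_subring]
      subringE(1)[OF OL_subring] by blast
  define J where "J = PIdl\<^bsub>V\<^esub> (p_elem p C)"
  have pV: "p_elem p C \<in> carrier V" using p_L p_small by (simp add: V)
  interpret J: ideal J V unfolding J_def by (rule V.cgenideal_ideal[OF pV])
  have aV: "a \<in> carrier V" using a by (simp add: V)
  have "J +>\<^bsub>V\<^esub> a \<in> carrier (V Quot J)" using aV by (auto simp: carrier_FactRing_iff)
  then have "J +>\<^bsub>V\<^esub> a \<in> (\<lambda>x. x [^]\<^bsub>V Quot J\<^esub> p) ` carrier (V Quot J)"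
    using L_frob unfolding frobenius_surj_def V_def[symmetric] J_def[symmetric] by blast
  then obtain b where b: "b \<in> carrier V" "J +>\<^bsub>V\<^esub> a = (J +>\<^bsub>V\<^esub> b) [^]\<^bsub>V Quot J\<^esub> p"
    by (auto simp: carrier_FactRing_iff)
  interpret h: ring_hom_ring V "V Quot J" "(+>\<^bsub>V\<^esub>) J" by (rule J.rcos_ring_hom_ring)
  have "J +>\<^bsub>V\<^esub> a = J +>\<^bsub>V\<^esub> (b [^]\<^bsub>V\<^esub> p)" using h.hom_nat_pow[OF b(1)] b(2) by simp
  moreover have "b [^]\<^bsub>V\<^esub> p \<in> J +>\<^bsub>V\<^esub> (b [^]\<^bsub>V\<^esub> p)" using b(1) by (intro J.a_rcos_self) simp
  ultimately obtain i where i: "i \<in> J" "b [^]\<^bsub>V\<^esub> p = i \<oplus>\<^bsub>V\<^esub> a"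
    by (auto simp: a_r_coset_def')
  then obtain c where c: "c \<in> L" "v c \<le> 1" "b [^] p = c \<otimes> p_elem p C \<oplus> a"
    unfolding J_def cgenideal_def by (auto simp: V nat_pow_subset)
  have b': "b \<in> L" "v b \<le> 1" using b(1) by (auto simp: V)
  have "b [^] p \<ominus> a = c \<otimes> p_elem p C" using c L_carrier a p_carrier by simp
  then have "v (b [^] p \<ominus> a) \<le> r"
    using c L_carrier[OF c(1)] p_carrier r_pos by (simp add: v_mult)
  then show ?thesis using b' by blast
qed

lemma v_power_minus_le:
  assumes "a \<in> carrier C" "v a \<le> 1" "b \<in> carrier C" "v b \<le> 1"
  shows "v (a [^] p \<ominus> b [^] p) \<le> v (a \<ominus> b)"
proof -
  have "max r (v (a \<ominus> b)) \<le> 1" using v_minus_le[of a b] assms p_small by auto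
  then have "v (a \<ominus> b) * max r (v (a \<ominus> b)) \<le> v (a \<ominus> b)" using v_nonneg[of "a \<ominus> b"] assms by (intro mult_left_le) auto
  then show ?thesis using v_power_minus_power_le[OF assms p_pos] by linarith
qed

text \<open>Elements congruent modulo p gain at least one further factor |p| with every p-th
  power.\<close>

lemma v_frobenius_iterate:
  assumes "a \<in> carrier C" "v a \<le> 1" "b \<in> carrier C" "v b \<le> 1" "v (a \<ominus> b) \<le> r"
  shows "v (a [^] (p ^ k) \<ominus> b [^] (p ^ k)) \<le> r ^ Suc k"
proof (induction k)
  case 0 then show ?case using assms by simp
next
  case (Suc k)
  define A B where "A = a [^] (p ^ k)" and "B = b [^] (p ^ k)"
  have A: "A \<in> carrier C" "v A \<le> 1" and B: "B \<in> carrier C" "v B \<le> 1"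
    using assms v_nonneg by (simp_all add: A_def B_def v_pow power_le_one)
  have AB: "v (A \<ominus> B) \<le> r ^ Suc k" using Suc by (simp add: A_def B_def)
  moreover have "r ^ Suc k \<le> r" using power_decreasing[of 1 "Suc k" r] r_pos p_small by simp
  ultimately have "max r (v (A \<ominus> B)) \<le> r" by simp
  then have "v (A \<ominus> B) * max r (v (A \<ominus> B)) \<le> r ^ Suc k * r"
    using AB v_nonneg[of "A \<ominus> B"] A B r_pos by (intro mult_mono) auto
  then have "v (A [^] p \<ominus> B [^] p) \<le> r ^ Suc (Suc k)"
    using v_power_minus_power_le[OF A B p_pos] by (simp add: mult.commute)
  then show ?case using assms(1,3) by (simp add: A_def B_def nat_pow_pow mult.commute)
qed

text \<open>Choose w with |p| < |w| < 1, which exists because the valuation is not discrete, and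
  successive approximate p-th roots a_n of w modulo p. Then x_n is the limit over k of
  a_(n+k)^(p^k). As x_0 is congruent to w modulo p and |w| > |p|, both have the same absolute
  value.\<close>

theorem p_compatible_pseudouniformizer:
  obtains x where "\<And>n. x n \<in> L" "\<And>n. v (x n) \<le> 1" "\<And>n. x (Suc n) [^] p = x n" "0 < v (x 0)" "v (x 0) < 1"
proof -
  obtain w where w: "w \<in> L" "r < v w" "v w < 1"
    using L_nondiscrete p_small unfolding discrete_abs_def by blast
  obtain f where f: "\<And>a. a \<in> L \<Longrightarrow> v a \<le> 1 \<Longrightarrow> f a \<in> L \<and> v (f a) \<le> 1 \<and> v (f a [^] p \<ominus> a) \<le> r"
    using approximate_root by metis
  define a where "a n = (f ^^ n) w" for n
  have a: "a n \<in> L \<and> v (a n) \<le> 1" for n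
    by (induction n) (use w f in \<open>auto simp: a_def\<close>)
  have a_step: "v (a (Suc n) [^] p \<ominus> a n) \<le> r" for n using f a by (simp add: a_def)
  have ac: "a n \<in> carrier C" "v (a n) \<le> 1" for n using a L_carrier by auto
  define b where "b n k = a (n + k) [^] (p ^ k)" for n k
  have bL: "b n k \<in> L" for n k
    unfolding b_def using a by (intro pow_in_subring[OF L_subring]) blast
  have bv: "v (b n k) \<le> 1" for n k using ac v_nonneg by (simp add: b_def v_pow power_le_one)
  have b_step: "v (b n (Suc k) \<ominus> b n k) \<le> r ^ Suc k" for n k
  proof -
    have "b n (Suc k) = (a (Suc (n + k)) [^] p) [^] (p ^ k)"
      using ac by (simp add: b_def nat_pow_pow)
    then show ?thesis
      using v_frobenius_iterate[of "a (Suc (n + k)) [^] p" "a (n + k)" k] ac a_step v_nonneg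
      by (simp add: b_def v_pow power_le_one)
  qed
  interpret UL: ultranormed_group "C\<lparr>carrier := L\<rparr>" v by (rule subring_ultranormed[OF L_subring])
  have lim: "(\<lambda>k. r ^ Suc k) \<longlonglongrightarrow> 0"
    using LIMSEQ_Suc[OF LIMSEQ_power_zero[of r]] r_pos p_small by simp
  have dec: "decseq (\<lambda>k. r ^ Suc k)"
    using r_pos p_small by (intro decseq_SucI power_decreasing) auto
  have "\<exists>l. l \<in> L \<and> (\<forall>k. v (l \<ominus> b n k) \<le> r ^ Suc k)" for n
  proof -
    obtain l where "l \<in> carrier (C\<lparr>carrier := L\<rparr>)" "\<And>k. v (l \<ominus>\<^bsub>C\<lparr>carrier := L\<rparr>\<^esub> b n k) \<le> r ^ Suc k"
    proof (rule UL.convergent_if_increments_null[OF L_complete _ lim dec, of "b n"])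
      show "range (b n) \<subseteq> carrier (C\<lparr>carrier := L\<rparr>)" using bL by auto
      show "v (b n (Suc k) \<ominus>\<^bsub>C\<lparr>carrier := L\<rparr>\<^esub> b n k) \<le> r ^ Suc k" for k
        using b_step bL subring_minus[OF L_subring] by simp
    qed blast
    then show ?thesis using subring_minus[OF L_subring bL] by auto
  qed
  then obtain x where x: "\<And>n. x n \<in> L" "\<And>n k. v (x n \<ominus> b n k) \<le> r ^ Suc k" by metis
  note xc = L_carrier[OF x(1)] and bc = L_carrier[OF bL]
  have xa: "v (x n \<ominus> a n) \<le> r" for n using x(2)[of n 0] ac by (simp add: b_def)
  have xv: "v (x n) \<le> 1" for n
  proof -
    have "v (x n \<ominus> a n \<oplus> a n) \<le> max (v (x n \<ominus> a n)) (v (a n))" using xc ac by (intro v_add_le) auto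
    also have "\<dots> \<le> 1" using xa[of n] p_small ac(2)[of n] by simp
    finally show ?thesis using xc ac by simp
  qed
  \<comment> \<open>The sequence \<open>b n (Suc k)\<close> approximates both x_(n+1)^p and x_n, so
    their distance is below every power of |p|.\<close>
  have root: "x (Suc n) [^] p = x n" for n
  proof -
    have bb: "b (Suc n) k [^] p = b n (Suc k)" for k
      using ac by (simp add: b_def nat_pow_pow mult.commute)
    have "v (x (Suc n) [^] p \<ominus> x n) \<le> r ^ Suc k" for k
    proof -
      have "v (x (Suc n) [^] p \<ominus> b (Suc n) k [^] p) \<le> r ^ Suc k"
        using v_power_minus_le[OF xc xv bc bv, of "Suc n" "Suc n" k] x(2)[of "Suc n" k] by linarith
      moreover have "v (b n (Suc k) \<ominus> x n) \<le> r ^ Suc k"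
      proof -
        have "r ^ Suc (Suc k) \<le> r ^ Suc k" using decseqD[OF dec, of k "Suc k"] by simp
        then show ?thesis using x(2)[of n "Suc k"] vn.norm_minus_commute[OF xc bc, of n n "Suc k"] by linarith
      qed
      ultimately show ?thesis
        using vn.norm_minus_trans[of "x (Suc n) [^] p" "b n (Suc k)" "x n"] xc bc unfolding bb by fastforce
    qed
    then have "v (x (Suc n) [^] p \<ominus> x n) \<le> 0" by (intro LIMSEQ_le_const[OF lim]) auto
    then have "v (x (Suc n) [^] p \<ominus> x n) = 0" using v_nonneg[of "x (Suc n) [^] p \<ominus> x n"] xc by simp
    then show ?thesis using vn.norm_zero_iff vn.minus_eq_zero_iff xc by (meson minus_closed nat_pow_closed)
  qed
  have "v (x 0) = v (a 0)"
    using vn.norm_eq_if_close[OF xc ac(1), of 0 0] xa[of 0] w(2) by (simp add: a_def)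
  then show thesis using that[of x, OF x(1) xv root] w r_pos by (simp add: a_def)
qed

end

section \<open>Powers in an ideal\<close>

context cring
begin

text \<open>The factor \<open>c\<close> makes the induction go through without the binomial theorem.\<close>

lemma ideal_pow_add_aux:
  assumes J: "ideal J R" and ab: "a \<in> carrier R" "b \<in> carrier R"
  shows "c \<in> carrier R \<Longrightarrow> c \<otimes> a [^] (m::nat) \<in> J \<Longrightarrow> c \<otimes> b [^] (n::nat) \<in> J \<Longrightarrow>
    c \<otimes> (a \<oplus> b) [^] (m + n) \<in> J"
proof (induction "m + n" arbitrary: m n c)
  case 0 then show ?case by simp
next
  case (Suc k)
  show ?case
  proof (cases "m = 0 \<or> n = 0")
    case True
    then have "c \<in> J" using Suc.prems by auto
    then show ?thesis using ideal.I_r_closed[OF J] ab by simp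
  next
    case False
    then obtain m' n' where mn: "m = Suc m'" "n = Suc n'" by (meson not0_implies_Suc)
    have ca: "c \<otimes> a \<in> carrier R" "c \<otimes> b \<in> carrier R" using Suc.prems(1) ab by auto
    have 1: "(c \<otimes> a) \<otimes> (a \<oplus> b) [^] (m' + n) \<in> J"
    proof (rule Suc.hyps(1))
      show "k = m' + n" using Suc.hyps(2) mn by simp
      show "(c \<otimes> a) \<otimes> a [^] m' \<in> J" using Suc.prems ab by (simp add: mn m_ac)
      have "a \<otimes> (c \<otimes> b [^] n) \<in> J" by (rule ideal.I_l_closed[OF J Suc.prems(3) ab(1)])
      then show "(c \<otimes> a) \<otimes> b [^] n \<in> J" using Suc.prems(1) ab by (simp add: m_ac del: nat_pow_Suc)
    qed (rule ca)
    have 2: "(c \<otimes> b) \<otimes> (a \<oplus> b) [^] (m + n') \<in> J"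
    proof (rule Suc.hyps(1))
      show "k = m + n'" using Suc.hyps(2) mn by simp
      show "(c \<otimes> b) \<otimes> b [^] n' \<in> J" using Suc.prems ab by (simp add: mn m_ac)
      have "b \<otimes> (c \<otimes> a [^] m) \<in> J" by (rule ideal.I_l_closed[OF J Suc.prems(2) ab(2)])
      then show "(c \<otimes> b) \<otimes> a [^] m \<in> J" using Suc.prems(1) ab by (simp add: m_ac del: nat_pow_Suc)
    qed (rule ca)
    have e: "m + n = Suc k" "m' + n = k" "m + n' = k" using Suc.hyps(2) mn by auto
    define P where "P = (a \<oplus> b) [^] k"
    have P: "P \<in> carrier R" using ab by (simp add: P_def)
    have "c \<otimes> (a \<oplus> b) [^] (m + n) = c \<otimes> (P \<otimes> (a \<oplus> b))" unfolding e P_def by simp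
    also have "\<dots> = (c \<otimes> a) \<otimes> P \<oplus> (c \<otimes> b) \<otimes> P" using Suc.prems(1) ab P by algebra
    finally show ?thesis
      using additive_subgroup.a_closed[OF ideal.axioms(1)[OF J] 1 2] unfolding e P_def by simp
  qed
qed

lemma ideal_pow_add:
  assumes "ideal J R" "a \<in> carrier R" "b \<in> carrier R" "a [^] (m::nat) \<in> J" "b [^] (n::nat) \<in> J"
  shows "(a \<oplus> b) [^] (m + n) \<in> J"
  using ideal_pow_add_aux[OF assms(1-3) one_closed, of m n] assms by simp

text \<open>Each new generator g turns an element into b + x g with b in the old ideal, and the
  exponents for b and g add. The exponent is uniform over the ideal because it depends on the
  generators only.\<close>

lemma genideal_pow_subset:
  assumes J: "ideal J R" and "finite G" "G \<subseteq> carrier R" "\<And>g. g \<in> G \<Longrightarrow> \<exists>n::nat. g [^] n \<in> J"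
  shows "\<exists>n::nat. \<forall>a\<in>Idl G. a [^] n \<in> J"
  using assms(2-4)
proof (induction G rule: finite_induct)
  case empty
  have "Idl {} \<subseteq> {\<zero>}" by (rule genideal_minimal[OF zeroideal]) simp
  moreover have "\<zero> \<in> J" using additive_subgroup.zero_closed[OF ideal.axioms(1)[OF J]] .
  \<comment> \<open>The exponent is 1 rather than 0, since 0^0 = 1.\<close>
  ultimately show ?case by (intro exI[of _ 1]) auto
next
  case (insert g G)
  then have g: "g \<in> carrier R" and G: "G \<subseteq> carrier R" by auto
  obtain m :: nat where m: "\<forall>a\<in>Idl G. a [^] m \<in> J" using insert.IH[OF G] insert.prems(2) by blast
  obtain n :: nat where n: "g [^] n \<in> J" using insert.prems(2) by blast
  have I: "ideal (Idl G) R" "ideal (PIdl g) R" using genideal_ideal[OF G] cgenideal_ideal[OF g] by auto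
  have "Idl (insert g G) \<subseteq> Idl G <+>\<^bsub>R\<^esub> PIdl g"
  proof (rule genideal_minimal[OF add_ideals[OF I]])
    have "\<zero> \<oplus> g \<in> Idl G <+>\<^bsub>R\<^esub> PIdl g"
      using additive_subgroup.zero_closed[OF ideal.axioms(1)[OF I(1)]] cgenideal_self[OF g]
      unfolding set_add_def' by blast
    moreover have "x \<oplus> \<zero> \<in> Idl G <+>\<^bsub>R\<^esub> PIdl g" if "x \<in> G" for x
      using additive_subgroup.zero_closed[OF ideal.axioms(1)[OF I(2)]] genideal_self[OF G] that
      unfolding set_add_def' by blast
    ultimately show "insert g G \<subseteq> Idl G <+>\<^bsub>R\<^esub> PIdl g" using g G by (auto simp: subset_eq)
  qed
  moreover have "a [^] (m + n) \<in> J" if a: "a \<in> Idl G <+>\<^bsub>R\<^esub> PIdl g" for a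
  proof -
    obtain b x where bx: "b \<in> Idl G" "x \<in> carrier R" "a = b \<oplus> x \<otimes> g"
      using a unfolding set_add_def' cgenideal_def by blast
    have bc: "b \<in> carrier R" using ideal.Icarr[OF I(1) bx(1)] .
    have "(x \<otimes> g) [^] n \<in> J"
      using ideal.I_l_closed[OF J n, of "x [^] n"] bx(2) g by (simp add: nat_pow_distrib)
    then show ?thesis unfolding bx(3) using m bx g bc by (intro ideal_pow_add[OF J]) auto
  qed
  ultimately show ?case by blast
qed

end

section \<open>A small unit in a perfectoid \<open>\<Delta>\<close>-field\<close>

lemma obtain_power_less:
  fixes a b :: real
  assumes "0 < a" "a < 1" "0 < b" obtains m :: nat where "0 < m" "a ^ m < b"
proof -
  obtain m where m: "a ^ m < b" using real_arch_pow_inv[OF assms(3,2)] by blast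
  have "a ^ Suc m \<le> a ^ m" using assms by (intro power_decreasing) auto
  then show thesis using that[of "Suc m"] m by simp
qed

context perfectoid_data
begin

sublocale VF: valued_field C v
  by (intro valued_field.intro field_C valued_field_axioms.intro abs_v)

lemma subfield_K0: "subfield K0 C" and p_small: "v (p_elem p C) < 1" and
  char_0: "0 < (n::nat) \<Longrightarrow> [n] \<cdot>\<^bsub>C\<^esub> \<one>\<^bsub>C\<^esub> \<noteq> \<zero>\<^bsub>C\<^esub>"
  using K0_p_adic by (auto simp: p_adic_field_def)

lemma p_pos: "0 < p" using prime_p by (simp add: prime_gt_0_nat)

lemma p_nonzero: "p_elem p C \<noteq> \<zero>\<^bsub>C\<^esub>" unfolding p_elem_def by (rule char_0[OF p_pos])

lemma one_Delta: "1 \<in> \<Delta>" using t_pos by simp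

lemma subfield_K: "\<alpha> \<in> \<Delta> \<Longrightarrow> subfield (K \<alpha>) C"
  using K_perfectoid by (auto simp: perfectoid_field_def)

sublocale SF: subfield_family C v \<Delta> K0 K
  by (intro subfield_family.intro VF.valued_field_axioms subfield_family_axioms.intro)
    (use one_Delta subfield_K0 subfield_K K0_subset in auto)

sublocale KF: tensor_data C v \<Delta> K0 K
  by (intro tensor_data.intro VF.valued_field_axioms tensor_data_axioms.intro)
    (use one_Delta subfieldE(1)[OF subfield_K] K0_subset in auto)

lemma O0_eq: "O0 = {x \<in> K0. v x \<le> 1}" and OK_eq: "OK = (\<lambda>\<alpha>. {x \<in> K \<alpha>. v x \<le> 1})"
  by (auto simp: O0_def OK_def)

lemma p_K0: "p_elem p C \<in> K0"
  unfolding p_elem_def by (rule VF.nat_in_subring[OF SF.K0_subring])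

lemma p_carrier: "p_elem p C \<in> carrier C" by (rule SF.K0_carrier[OF p_K0])

lemma v_p_pos: "0 < v (p_elem p C)" by (rule VF.v_pos[OF p_carrier p_nonzero])

lemma K_carrier: "\<alpha> \<in> \<Delta> \<Longrightarrow> x \<in> K \<alpha> \<Longrightarrow> x \<in> carrier C" by (rule SF.K_carrier)

lemma K_ring: "\<alpha> \<in> \<Delta> \<Longrightarrow> subring (K \<alpha>) C" using subfieldE(1)[OF subfield_K] .

lemma K_mult: "\<alpha> \<in> \<Delta> \<Longrightarrow> x \<in> K \<alpha> \<Longrightarrow> y \<in> K \<alpha> \<Longrightarrow> x \<otimes>\<^bsub>C\<^esub> y \<in> K \<alpha>"
  using subringE(6)[OF K_ring] .

lemma K_pow: "\<alpha> \<in> \<Delta> \<Longrightarrow> x \<in> K \<alpha> \<Longrightarrow> x [^]\<^bsub>C\<^esub> (n::nat) \<in> K \<alpha>"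
  by (rule VF.pow_in_subring[OF K_ring])

lemma K_inv:
  assumes "\<alpha> \<in> \<Delta>" "x \<in> K \<alpha>" "x \<noteq> \<zero>\<^bsub>C\<^esub>"
  shows "inv\<^bsub>C\<^esub> x \<in> K \<alpha>" "x \<otimes>\<^bsub>C\<^esub> inv\<^bsub>C\<^esub> x = \<one>\<^bsub>C\<^esub>" "inv\<^bsub>C\<^esub> x \<otimes>\<^bsub>C\<^esub> x = \<one>\<^bsub>C\<^esub>"
  using valued_extension.L_inv[OF SF.extension[OF assms(1)] assms(2,3)] assms(3)
    K_carrier[OF assms(1,2)] VF.field_Units by auto

section \<open>Absolute values under embeddings\<close>

lemma embedding_hom:
  assumes "s \<in> embeddings" "\<alpha> \<in> \<Delta>"
  shows "ring_hom_ring (C\<lparr>carrier := K \<alpha>\<rparr>) C (s \<alpha>)"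
  using assms VF.subring_is_ring[OF K_ring] VF.ring_axioms
  by (intro ring_hom_ringI2) (auto simp: embeddings_def)

lemma embedding_closed: "s \<in> embeddings \<Longrightarrow> \<alpha> \<in> \<Delta> \<Longrightarrow> x \<in> K \<alpha> \<Longrightarrow> s \<alpha> x \<in> carrier C"
  using ring_hom_ring.homh[OF embedding_hom, of s \<alpha>] ring_hom_closed by fastforce

lemma embedding_mult:
  "s \<in> embeddings \<Longrightarrow> \<alpha> \<in> \<Delta> \<Longrightarrow> x \<in> K \<alpha> \<Longrightarrow> y \<in> K \<alpha> \<Longrightarrow> s \<alpha> (x \<otimes>\<^bsub>C\<^esub> y) = s \<alpha> x \<otimes>\<^bsub>C\<^esub> s \<alpha> y"
  using ring_hom_mult[OF ring_hom_ring.homh[OF embedding_hom, of s \<alpha>], of x y] by simp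

lemma embedding_one: "s \<in> embeddings \<Longrightarrow> \<alpha> \<in> \<Delta> \<Longrightarrow> s \<alpha> \<one>\<^bsub>C\<^esub> = \<one>\<^bsub>C\<^esub>"
  using ring_hom_one[OF ring_hom_ring.homh[OF embedding_hom, of s \<alpha>]] by simp

lemma embedding_pow:
  assumes "s \<in> embeddings" "\<alpha> \<in> \<Delta>" "x \<in> K \<alpha>"
  shows "s \<alpha> (x [^]\<^bsub>C\<^esub> (n::nat)) = s \<alpha> x [^]\<^bsub>C\<^esub> n"
  by (induction n) (use assms in \<open>simp_all add: embedding_one embedding_mult K_pow\<close>)

lemma embedding_K0: "s \<in> embeddings \<Longrightarrow> \<alpha> \<in> \<Delta> \<Longrightarrow> x \<in> K0 \<Longrightarrow> s \<alpha> x = x"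
  by (auto simp: embeddings_def)

text \<open>By continuity, powers of x tending to 0 are sent to powers of
  \<open>s \<alpha> x\<close> tending to 0, which is impossible if its absolute value is at least
  1.\<close>

lemma embedding_small:
  assumes s: "s \<in> embeddings" and \<alpha>: "\<alpha> \<in> \<Delta>" and x: "x \<in> K \<alpha>" "v x < 1"
  shows "v (s \<alpha> x) < 1"
proof -
  interpret U: ultranormed_group "C\<lparr>carrier := K \<alpha>\<rparr>" v by (rule VF.subring_ultranormed[OF K_ring[OF \<alpha>]])
  interpret h: ring_hom_ring "C\<lparr>carrier := K \<alpha>\<rparr>" C "s \<alpha>" by (rule embedding_hom[OF s \<alpha>])
  define f where "f n = x [^]\<^bsub>C\<^esub> n" for n :: nat
  have xc: "x \<in> carrier C" by (rule K_carrier[OF \<alpha> x(1)])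
  have fK: "f n \<in> K \<alpha>" for n unfolding f_def by (rule K_pow[OF \<alpha> x(1)])
  have z: "\<zero>\<^bsub>C\<^esub> \<in> K \<alpha>" by (rule subringE(2)[OF K_ring[OF \<alpha>]])
  have fz: "v (f n \<ominus>\<^bsub>C\<lparr>carrier := K \<alpha>\<rparr>\<^esub> \<zero>\<^bsub>C\<^esub>) = v x ^ n" for n
    using VF.subring_minus[OF K_ring[OF \<alpha>] z] xc by (simp add: f_def VF.v_pow)
  have "\<exists>N. \<forall>n\<ge>N. v x ^ n < e" if "0 < e" for e
    using order_tendstoD(2)[OF LIMSEQ_power_zero[of "v x"] that] x(2) VF.v_nonneg[OF xc]
    by (simp add: eventually_sequentially)
  then have "limitin (norm_topology (C\<lparr>carrier := K \<alpha>\<rparr>) v) f \<zero>\<^bsub>C\<^esub> sequentially"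
    using fK z by (subst U.limitin_norm_iff) (auto simp: fz)
  then have "limitin (norm_topology C v) (s \<alpha> \<circ> f) (s \<alpha> \<zero>\<^bsub>C\<^esub>) sequentially"
    using s \<alpha> by (intro continuous_map_limit[of "norm_topology (C\<lparr>carrier := K \<alpha>\<rparr>) v"])
      (auto simp: embeddings_def)
  moreover have "range (s \<alpha> \<circ> f) \<subseteq> carrier C" using embedding_closed[OF s \<alpha> fK] by auto
  moreover have "s \<alpha> \<zero>\<^bsub>C\<^esub> = \<zero>\<^bsub>C\<^esub>" using h.hom_zero by simp
  ultimately obtain N where "v (s \<alpha> (f N) \<ominus>\<^bsub>C\<^esub> \<zero>\<^bsub>C\<^esub>) < 1"
    using VF.vn.limitin_norm_iff[of "s \<alpha> \<circ> f" "s \<alpha> \<zero>\<^bsub>C\<^esub>"] zero_less_one by (metis comp_apply order_refl)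
  then have "v (s \<alpha> x) ^ N < 1"
    using embedding_pow[OF s \<alpha> x(1)] embedding_closed[OF s \<alpha> x(1)] by (simp add: f_def VF.v_pow)
  then show ?thesis using one_le_power[of "v (s \<alpha> x)" N] by linarith
qed

text \<open>Embeddings fix \<open>p\<close>, so comparing powers of \<open>x\<close> with powers of \<open>p\<close> gives bounds that do not
  depend on the embedding.\<close>

lemma embedding_bounds:
  assumes \<alpha>: "\<alpha> \<in> \<Delta>" and x: "x \<in> K \<alpha>" "0 < v x" "v x < 1"
  obtains c \<theta> where "0 < c" "0 \<le> \<theta>" "\<theta> < 1"
    "\<And>s. s \<in> embeddings \<Longrightarrow> c \<le> v (s \<alpha> x) \<and> v (s \<alpha> x) \<le> \<theta>"
proof -
  let ?\<pi> = "p_elem p C"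
  have xc: "x \<in> carrier C" by (rule K_carrier[OF \<alpha> x(1)])
  have x0: "x \<noteq> \<zero>\<^bsub>C\<^esub>" using x(2) by auto
  have \<pi>K: "?\<pi> \<in> K \<alpha>" using p_K0 K0_subset[OF \<alpha>] by blast
  obtain m where m: "0 < m" "v x ^ m < v ?\<pi>" by (rule obtain_power_less[OF x(2,3) v_p_pos])
  obtain k where k: "0 < k" "v ?\<pi> ^ k < v x" by (rule obtain_power_less[OF v_p_pos p_small x(2)])
  \<comment> \<open>From |x|^m < |p| it will follow that the image of x has m-th power of absolute
    value at most |p|.\<close>
  define \<theta> where "\<theta> = root m (v ?\<pi>)"
  have \<theta>: "0 \<le> \<theta>" "\<theta> ^ m = v ?\<pi>" "\<theta> < 1"
    using m(1) v_p_pos p_small by (simp_all add: \<theta>_def)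
  \<comment> \<open>The quotient y / z has absolute value below 1, and
    \<open>embedding_small\<close> applies to it.\<close>
  have quot: "v (s \<alpha> y) \<le> v (s \<alpha> z)"
    if s: "s \<in> embeddings" and y: "y \<in> K \<alpha>" and z: "z \<in> K \<alpha>" and yz: "v y < v z" for s y z
  proof -
    have c: "y \<in> carrier C" "z \<in> carrier C" using y z K_carrier[OF \<alpha>] by auto
    have z0: "z \<noteq> \<zero>\<^bsub>C\<^esub>" using yz VF.v_nonneg[OF c(1)] by auto
    note zi = K_inv[OF \<alpha> z z0]
    define u where "u = y \<otimes>\<^bsub>C\<^esub> inv\<^bsub>C\<^esub> z"
    have u: "u \<in> K \<alpha>" unfolding u_def by (rule K_mult[OF \<alpha> y zi(1)])
    have zic: "inv\<^bsub>C\<^esub> z \<in> carrier C" by (rule K_carrier[OF \<alpha> zi(1)])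
    have "v u = v y / v z"
      using VF.v_mult[OF c(1) zic] VF.v_inv[OF c(2) z0] by (simp add: u_def divide_inverse)
    then have "v u < 1" using yz VF.v_pos[OF c(2) z0] by (simp add: pos_divide_less_eq)
    then have su: "v (s \<alpha> u) < 1" by (rule embedding_small[OF s \<alpha> u])
    have "u \<otimes>\<^bsub>C\<^esub> z = y" using c zi(3) zic by (simp add: u_def VF.m_assoc)
    then have "v (s \<alpha> y) = v (s \<alpha> u) * v (s \<alpha> z)"
      using embedding_mult[OF s \<alpha> u z] VF.v_mult embedding_closed[OF s \<alpha>] u z by metis
    then show ?thesis
      using su VF.v_nonneg embedding_closed[OF s \<alpha>] u z by (simp add: mult_left_le_one_le)
  qed
  have "v ?\<pi> ^ k \<le> v (s \<alpha> x) \<and> v (s \<alpha> x) \<le> \<theta>" if s: "s \<in> embeddings" for s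
  proof
    have "v (?\<pi> [^]\<^bsub>C\<^esub> k) < v x" using k(2) p_carrier by (simp add: VF.v_pow)
    then have "v (s \<alpha> (?\<pi> [^]\<^bsub>C\<^esub> k)) \<le> v (s \<alpha> x)" by (rule quot[OF s K_pow[OF \<alpha> \<pi>K] x(1)])
    then show "v ?\<pi> ^ k \<le> v (s \<alpha> x)"
      using embedding_pow[OF s \<alpha> \<pi>K] embedding_K0[OF s \<alpha> p_K0] p_carrier by (simp add: VF.v_pow)
    have "v (x [^]\<^bsub>C\<^esub> m) < v ?\<pi>" using m(2) xc by (simp add: VF.v_pow)
    then have "v (s \<alpha> (x [^]\<^bsub>C\<^esub> m)) \<le> v (s \<alpha> ?\<pi>)" by (rule quot[OF s K_pow[OF \<alpha> x(1)] \<pi>K])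
    then have "v (s \<alpha> x) ^ m \<le> \<theta> ^ m"
      using embedding_pow[OF s \<alpha> x(1)] embedding_K0[OF s \<alpha> p_K0] embedding_closed[OF s \<alpha> x(1)] \<theta>(2)
      by (simp add: VF.v_pow)
    then show "v (s \<alpha> x) \<le> \<theta>"
      using power_mono_iff[OF VF.v_nonneg[OF embedding_closed[OF s \<alpha> x(1)]] \<theta>(1) m(1)] by simp
  qed
  then show thesis using that[of "v ?\<pi> ^ k" \<theta>] \<theta>(1,3) v_p_pos by simp
qed

lemma emb_equiv_refl: "s \<in> embeddings \<Longrightarrow> (s, s) \<in> emb_equiv"
  unfolding emb_equiv_def using ring_iso_set_refl by (auto intro!: bexI[of _ id])

lemma emb_classes_inhabited: assumes "\<sigma> \<in> emb_classes" obtains s where "s \<in> \<sigma>" "s \<in> embeddings"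
proof -
  obtain s where s: "s \<in> embeddings" "\<sigma> = emb_equiv `` {s}"
    using assms by (auto simp: emb_classes_def quotient_def)
  then show thesis using that emb_equiv_refl by blast
qed

text \<open>The inclusions of the \<open>K \<alpha>\<close> into \<open>C\<close> form an embedding
  family. Without a class, \<open>sup_norm\<close> would be the supremum of an empty set.\<close>

lemma emb_classes_nonempty: "emb_classes \<noteq> {}"
proof -
  have "continuous_map (norm_topology (C\<lparr>carrier := K \<alpha>\<rparr>) v) (norm_topology C v) (\<lambda>x. x)" if \<alpha>: "\<alpha> \<in> \<Delta>" for \<alpha>
  proof -
    interpret U: ultranormed_group "C\<lparr>carrier := K \<alpha>\<rparr>" v by (rule VF.subring_ultranormed[OF K_ring[OF \<alpha>]])
    have "openin (norm_topology (C\<lparr>carrier := K \<alpha>\<rparr>) v) {x \<in> K \<alpha>. x \<in> W}"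
      if W: "openin (norm_topology C v) W" for W
      unfolding U.openin_norm_iff
    proof (intro conjI ballI)
      fix x assume x: "x \<in> {x \<in> K \<alpha>. x \<in> W}"
      then obtain d where "d > 0" "\<And>y. y \<in> carrier C \<Longrightarrow> v (y \<ominus>\<^bsub>C\<^esub> x) < d \<Longrightarrow> y \<in> W"
        using W unfolding VF.vn.openin_norm_iff by blast
      then show "\<exists>d>0. \<forall>y\<in>carrier (C\<lparr>carrier := K \<alpha>\<rparr>). v (y \<ominus>\<^bsub>C\<lparr>carrier := K \<alpha>\<rparr>\<^esub> x) < d \<longrightarrow> y \<in> {x \<in> K \<alpha>. x \<in> W}"
        using x VF.subring_minus[OF K_ring[OF \<alpha>]] K_carrier[OF \<alpha>] by auto
    qed auto
    then show ?thesis
      unfolding continuous_map_def using K_carrier[OF \<alpha>] by auto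
  qed
  moreover have "(\<lambda>x. x) \<in> ring_hom (C\<lparr>carrier := K \<alpha>\<rparr>) C" if "\<alpha> \<in> \<Delta>" for \<alpha>
    using K_carrier[OF that] by (intro ring_hom_memI) auto
  ultimately have "(\<lambda>\<alpha> x. x) \<in> embeddings" by (simp add: embeddings_def)
  then show ?thesis unfolding emb_classes_def quotient_def by blast
qed

text \<open>The value of beta_s on an element of a single slot: the other factors are images of
  1.\<close>

lemma finprod_slot:
  assumes s: "s \<in> embeddings" and \<beta>: "\<beta> \<in> \<Delta>" and x: "x \<in> K \<beta>"
  shows "(\<Otimes>\<^bsub>C\<^esub>\<alpha>\<in>\<Delta>. s \<alpha> (SF.slot \<beta> x \<alpha>)) = s \<beta> x"
proof -
  have "(\<Otimes>\<^bsub>C\<^esub>\<alpha>\<in>\<Delta>. s \<alpha> (SF.slot \<beta> x \<alpha>)) = (\<Otimes>\<^bsub>C\<^esub>\<alpha>\<in>\<Delta>. if \<beta> = \<alpha> then (\<lambda>_. s \<beta> x) \<alpha> else \<one>\<^bsub>C\<^esub>)"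
    using embedding_closed[OF s \<beta> x] embedding_one[OF s]
    by (intro VF.finprod_cong') (auto simp: SF.slot_def simp del: One_nat_def)
  also have "\<dots> = s \<beta> x"
    using VF.finprod_singleton[OF \<beta>, of "\<lambda>_. s \<beta> x"] embedding_closed[OF s \<beta> x] by simp
  finally show ?thesis .
qed

text \<open>The interface between the arithmetic of the two kinds of perfectoid \<Delta>-fields and
  the open mapping argument.\<close>

definition small_unit :: "'r ring \<Rightarrow> ((nat \<Rightarrow> 'c \<Rightarrow> 'c) set \<Rightarrow> 'r \<Rightarrow> real) \<Rightarrow> bool" where
  "small_unit R absR \<longleftrightarrow> (\<exists>l\<in>Units R. \<exists>c \<theta>. 0 < c \<and> 0 \<le> \<theta> \<and> \<theta> < 1 \<and>
     (\<forall>\<sigma>\<in>emb_classes. c \<le> absR \<sigma> l \<and> absR \<sigma> l \<le> \<theta>))"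

text \<open>The image of p is invertible because it comes from the field \<open>K 1\<close>, and
  every beta_s sends it to p because embeddings fix K0. Both constants are therefore |p|.\<close>

lemma mixed_small_unit:
  assumes "cring R" "mixed_perfectoid_Delta_field R absR"
  shows "small_unit R absR"
proof -
  interpret R: cring R by fact
  obtain \<phi> b where \<phi>: "\<phi> \<in> ring_iso R K_Delta"
    and b: "\<And>s. s \<in> embeddings \<Longrightarrow> is_beta K0 K s (b s)"
    and absR: "\<And>\<sigma> s l. \<sigma> \<in> emb_classes \<Longrightarrow> s \<in> \<sigma> \<Longrightarrow> l \<in> carrier R \<Longrightarrow> absR \<sigma> l = v (b s (\<phi> l))"
    using assms(2) unfolding mixed_perfectoid_Delta_field_def by blast
  have KD: "K_Delta = completion KF.TR KF.q" by (simp add: K_Delta_def completed_tensor_def)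
  define \<kappa> where "\<kappa> x = to_completion KF.TR KF.q (KF.inslot 1 x)" for x
  have \<kappa>_hom: "\<kappa> \<in> ring_hom (C\<lparr>carrier := K 1\<rparr>) K_Delta"
    using ring_hom_trans[OF KF.inslot_hom[OF one_Delta] KF.SC.to_completion_hom]
    unfolding KD \<kappa>_def comp_def .
  have \<kappa>_pure: "\<kappa> x = pure_tensor C v \<Delta> K0 K (KF.slot 1 x)" for x
    unfolding \<kappa>_def pure_tensor_def KF.inslot_def KF.tens_def KF.cls_def ..
  let ?\<pi> = "p_elem p C"
  have \<pi>K: "?\<pi> \<in> K 1" using p_K0 K0_subset[OF one_Delta] by blast
  note \<pi>i = K_inv[OF one_Delta \<pi>K p_nonzero]
  have \<phi>h: "\<phi> \<in> ring_hom R K_Delta" and \<phi>b: "bij_betw \<phi> (carrier R) (carrier K_Delta)"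
    using \<phi> by (auto simp: ring_iso_def)
  have \<kappa>c: "\<kappa> x \<in> carrier K_Delta" if "x \<in> K 1" for x
    using ring_hom_closed[OF \<kappa>_hom, of x] that by simp
  obtain l where l: "l \<in> carrier R" "\<phi> l = \<kappa> ?\<pi>"
    using \<phi>b \<kappa>c[OF \<pi>K] by (metis bij_betw_imp_surj_on imageE)
  obtain m where m: "m \<in> carrier R" "\<phi> m = \<kappa> (inv\<^bsub>C\<^esub> ?\<pi>)"
    using \<phi>b \<kappa>c[OF \<pi>i(1)] by (metis bij_betw_imp_surj_on imageE)
  have "\<phi> (l \<otimes>\<^bsub>R\<^esub> m) = \<kappa> (?\<pi> \<otimes>\<^bsub>C\<^esub> inv\<^bsub>C\<^esub> ?\<pi>)"
    using ring_hom_mult[OF \<phi>h l(1) m(1)] ring_hom_mult[OF \<kappa>_hom, of ?\<pi> "inv\<^bsub>C\<^esub> ?\<pi>"] l(2) m(2) \<pi>K \<pi>i(1) by simp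
  also have "\<dots> = \<phi> \<one>\<^bsub>R\<^esub>"
    using ring_hom_one[OF \<kappa>_hom] ring_hom_one[OF \<phi>h] \<pi>i(2) by simp
  finally have "l \<otimes>\<^bsub>R\<^esub> m = \<one>\<^bsub>R\<^esub>"
    using \<phi>b l(1) m(1) by (metis R.m_closed R.one_closed bij_betw_imp_inj_on inj_onD)
  then have lU: "l \<in> Units R" using l(1) m(1) R.m_comm[OF m(1) l(1)] by (auto simp: Units_def)
  have "absR \<sigma> l = v ?\<pi>" if \<sigma>: "\<sigma> \<in> emb_classes" for \<sigma>
  proof -
    obtain s where s: "s \<in> \<sigma>" "s \<in> embeddings" by (rule emb_classes_inhabited[OF \<sigma>])
    have "b s (\<phi> l) = (\<Otimes>\<^bsub>C\<^esub>\<alpha>\<in>\<Delta>. s \<alpha> (KF.slot 1 ?\<pi> \<alpha>))"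
      using b[OF s(2)] KF.slot_closed[OF one_Delta \<pi>K] unfolding is_beta_def l(2) \<kappa>_pure by blast
    also have "\<dots> = ?\<pi>" using finprod_slot[OF s(2) one_Delta \<pi>K] embedding_K0[OF s(2) one_Delta p_K0] by simp
    finally show ?thesis using absR[OF \<sigma> s(1) l(1)] by simp
  qed
  then show ?thesis
    unfolding small_unit_def using lU v_p_pos p_small
    by (intro bexI[OF _ lU] exI[of _ "v ?\<pi>"]) auto
qed

end

section \<open>The equicharacteristic case\<close>

context perfectoid_data
begin

text \<open>The canonical map from the valuation ring of \<open>K \<alpha>\<close> to the completed
  tensor product \<open>K_Delta_int\<close>.\<close>

definition kap :: "nat \<Rightarrow> 'c \<Rightarrow> (nat \<Rightarrow> 'c tensor) set" where
  "kap \<alpha> x = to_completion SF.TR SF.q (SF.inslot \<alpha> x)"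

lemma K_Delta_int_eq: "K_Delta_int = completion SF.TR SF.q"
  unfolding K_Delta_int_def completed_tensor_def O0_eq OK_eq ..

lemma K_Delta_int_cring: "cring K_Delta_int"
  unfolding K_Delta_int_eq by (rule SF.SC.completion_cring)

lemma kap_pure: "kap \<alpha> x = pure_tensor C v \<Delta> O0 OK (SF.slot \<alpha> x)"
  unfolding kap_def pure_tensor_def SF.inslot_def SF.tens_def SF.cls_def O0_eq OK_eq ..

lemma kap_hom: assumes "\<alpha> \<in> \<Delta>" shows "kap \<alpha> \<in> ring_hom (C\<lparr>carrier := SF.OK \<alpha>\<rparr>) K_Delta_int"
  using ring_hom_trans[OF SF.inslot_hom[OF assms] SF.SC.to_completion_hom]
  unfolding K_Delta_int_eq kap_def[abs_def] comp_def .

lemma kap_closed: "\<alpha> \<in> \<Delta> \<Longrightarrow> x \<in> SF.OK \<alpha> \<Longrightarrow> kap \<alpha> x \<in> carrier K_Delta_int"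
  using ring_hom_closed[OF kap_hom, of \<alpha> x] by simp

lemma kap_mult:
  "\<alpha> \<in> \<Delta> \<Longrightarrow> x \<in> SF.OK \<alpha> \<Longrightarrow> y \<in> SF.OK \<alpha> \<Longrightarrow>
    kap \<alpha> (x \<otimes>\<^bsub>C\<^esub> y) = kap \<alpha> x \<otimes>\<^bsub>K_Delta_int\<^esub> kap \<alpha> y"
  using ring_hom_mult[OF kap_hom, of \<alpha> x y] by simp

lemma kap_one: "\<alpha> \<in> \<Delta> \<Longrightarrow> kap \<alpha> \<one>\<^bsub>C\<^esub> = \<one>\<^bsub>K_Delta_int\<^esub>"
  using ring_hom_one[OF kap_hom, of \<alpha>] by simp

lemma OK_pow: "\<alpha> \<in> \<Delta> \<Longrightarrow> x \<in> SF.OK \<alpha> \<Longrightarrow> x [^]\<^bsub>C\<^esub> (n::nat) \<in> SF.OK \<alpha>"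
  by (rule VF.pow_in_subring[OF SF.subring_A])

lemma kap_pow:
  assumes "\<alpha> \<in> \<Delta>" "x \<in> SF.OK \<alpha>"
  shows "kap \<alpha> (x [^]\<^bsub>C\<^esub> (n::nat)) = kap \<alpha> x [^]\<^bsub>K_Delta_int\<^esub> n"
proof (induction n)
  case 0
  then show ?case using kap_one[OF assms(1)] by simp
next
  case (Suc n)
  then show ?case
    using kap_mult[OF assms(1) OK_pow[OF assms] assms(2), of n] by simp
qed

lemma kap_p_compatible:
  assumes "\<And>n. x n \<in> SF.OK 1" "\<And>n. x (Suc n) [^]\<^bsub>C\<^esub> p = x n"
  shows "(\<lambda>n. kap 1 (x n)) \<in> p_compatible p K_Delta_int"
  unfolding p_compatible_def mem_Collect_eq
proof (intro allI conjI)
  fix n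
  show "kap 1 (x n) \<in> carrier K_Delta_int" by (rule kap_closed[OF one_Delta assms(1)])
  show "kap 1 (x (Suc n)) [^]\<^bsub>K_Delta_int\<^esub> p = kap 1 (x n)"
    unfolding kap_pow[OF one_Delta assms(1), symmetric] assms(2) ..
qed

lemma kap_scalar:
  assumes "\<alpha> \<in> \<Delta>" "\<beta> \<in> \<Delta>" "k \<in> K0" "v k \<le> 1" shows "kap \<alpha> k = kap \<beta> k"
proof -
  have "k \<in> SF.O0" using assms(3,4) by simp
  then show ?thesis unfolding kap_def using SF.inslot_scalar[OF assms(1,2)] by simp
qed

lemma kap_nonzerodivisor:
  assumes "\<alpha> \<in> \<Delta>" "x \<in> SF.OK \<alpha>" "x \<noteq> \<zero>\<^bsub>C\<^esub>"
  shows "kap \<alpha> x \<in> non_zero_divisors K_Delta_int"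
  unfolding kap_def K_Delta_int_eq
  by (rule SF.slot_nonzerodivisor[OF assms(1) p_K0 v_p_pos p_small assms(2,3)])

lemma I_varpi_eq: "I_varpi w = Idl\<^bsub>K_Delta_int\<^esub> ((\<lambda>\<alpha>. kap \<alpha> (w \<alpha>)) ` \<Delta>)"
  unfolding I_varpi_def kap_pure SF.slot_def ..

lemma varpiD:
  assumes "varpi_family w" "\<alpha> \<in> \<Delta>"
  shows "w \<alpha> \<in> SF.OK \<alpha>" "w \<alpha> \<in> K \<alpha>" "v (w \<alpha>) < 1" "0 < v (w \<alpha>)"
  using assms v_p_pos unfolding varpi_family_def by force+

lemma I_varpi_ideal:
  assumes "varpi_family w" shows "ideal (I_varpi w) K_Delta_int"
proof -
  interpret A: cring K_Delta_int by (rule K_Delta_int_cring)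
  have "(\<lambda>\<alpha>. kap \<alpha> (w \<alpha>)) ` \<Delta> \<subseteq> carrier K_Delta_int"
    using kap_closed varpiD(1)[OF assms] by blast
  then show ?thesis unfolding I_varpi_eq by (rule A.genideal_ideal)
qed

text \<open>Every generator of \<open>I_varpi w\<close> has a power that is divisible by a high power of \<open>p\<close>, and
  powers of \<open>p\<close> can be moved between the slots.\<close>

lemma I_varpi_pow:
  assumes w: "varpi_family w" and x: "x \<in> SF.OK 1" "x \<noteq> \<zero>\<^bsub>C\<^esub>"
  shows "\<exists>N::nat. \<forall>a\<in>I_varpi w. \<exists>d\<in>I_varpi w. a [^]\<^bsub>K_Delta_int\<^esub> N = kap 1 x \<otimes>\<^bsub>K_Delta_int\<^esub> d"
proof -
  interpret A: cring K_Delta_int by (rule K_Delta_int_cring)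
  interpret I: ideal "I_varpi w" K_Delta_int by (rule I_varpi_ideal[OF w])
  let ?\<pi> = "p_elem p C"
  have kx: "kap 1 x \<in> carrier K_Delta_int" by (rule kap_closed[OF one_Delta x(1)])
  \<comment> \<open>The multiples of x by elements of the ideal, not all multiples of x: after
    cancelling x, an element of the ideal has to remain.\<close>
  define J where "J = (\<lambda>d. kap 1 x \<otimes>\<^bsub>K_Delta_int\<^esub> d) ` I_varpi w"
  have J: "ideal J K_Delta_int"
  proof (rule idealI)
    show "ring K_Delta_int" by (rule A.ring_axioms)
    show "subgroup J (add_monoid K_Delta_int)"
    proof (rule A.add.subgroupI)
      show "J \<subseteq> carrier K_Delta_int" unfolding J_def using kx I.Icarr by auto
      show "J \<noteq> {}" unfolding J_def using I.zero_closed by blast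
      fix a b assume "a \<in> J" "b \<in> J"
      then obtain c d where cd: "c \<in> I_varpi w" "a = kap 1 x \<otimes>\<^bsub>K_Delta_int\<^esub> c"
        "d \<in> I_varpi w" "b = kap 1 x \<otimes>\<^bsub>K_Delta_int\<^esub> d" unfolding J_def by blast
      have "\<ominus>\<^bsub>K_Delta_int\<^esub> a = kap 1 x \<otimes>\<^bsub>K_Delta_int\<^esub> (\<ominus>\<^bsub>K_Delta_int\<^esub> c)"
        using cd kx I.Icarr by (simp add: A.r_minus)
      then show "\<ominus>\<^bsub>K_Delta_int\<^esub> a \<in> J" unfolding J_def using I.a_inv_closed[OF cd(1)] by blast
      have "a \<oplus>\<^bsub>K_Delta_int\<^esub> b = kap 1 x \<otimes>\<^bsub>K_Delta_int\<^esub> (c \<oplus>\<^bsub>K_Delta_int\<^esub> d)"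
        using cd kx I.Icarr by (simp add: A.r_distr)
      then show "a \<oplus>\<^bsub>K_Delta_int\<^esub> b \<in> J" unfolding J_def using I.a_closed[OF cd(1,3)] by blast
    qed
    have m: "y \<otimes>\<^bsub>K_Delta_int\<^esub> a \<in> J" if a: "a \<in> J" and y: "y \<in> carrier K_Delta_int" for a y
    proof -
      obtain c where c: "c \<in> I_varpi w" "a = kap 1 x \<otimes>\<^bsub>K_Delta_int\<^esub> c" using a unfolding J_def by blast
      have "y \<otimes>\<^bsub>K_Delta_int\<^esub> a = kap 1 x \<otimes>\<^bsub>K_Delta_int\<^esub> (y \<otimes>\<^bsub>K_Delta_int\<^esub> c)"
        unfolding c(2) using kx y I.Icarr[OF c(1)] by (simp add: A.m_lcomm)
      then show ?thesis unfolding J_def using I.I_l_closed[OF c(1) y] by blast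
    qed
    show "y \<otimes>\<^bsub>K_Delta_int\<^esub> a \<in> J" if "a \<in> J" "y \<in> carrier K_Delta_int" for a y by (rule m[OF that])
    show "a \<otimes>\<^bsub>K_Delta_int\<^esub> y \<in> J" if "a \<in> J" "y \<in> carrier K_Delta_int" for a y
    proof -
      have "a \<in> carrier K_Delta_int" using that(1) kx I.Icarr unfolding J_def by auto
      then show ?thesis using m[OF that] A.m_comm that(2) by simp
    qed
  qed
  have xw: "0 < v x * v (w 1)"
    using VF.v_pos[OF SF.A_carrier[OF one_Delta x(1)] x(2)] varpiD(4)[OF w one_Delta] by simp
  \<comment> \<open>With |p^M| < |x w_1| the power p^M is divisible by x w_1 in slot 1. The extra
    factor w_1 is what puts the cofactor of x into \<open>I_varpi w\<close>.\<close>
  obtain M where M: "0 < M" "v ?\<pi> ^ M < v x * v (w 1)" by (rule obtain_power_less[OF v_p_pos p_small xw])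
  define k where "k = ?\<pi> [^]\<^bsub>C\<^esub> M"
  have k: "k \<in> K0" "k \<in> carrier C" "v k = v ?\<pi> ^ M" "k \<noteq> \<zero>\<^bsub>C\<^esub>"
  proof -
    show "k \<in> K0" unfolding k_def by (rule VF.pow_in_subring[OF SF.K0_subring p_K0])
    show "k \<in> carrier C" "v k = v ?\<pi> ^ M" using p_carrier by (simp_all add: k_def VF.v_pow)
    then show "k \<noteq> \<zero>\<^bsub>C\<^esub>" using v_p_pos by auto
  qed
  have kO: "v k \<le> 1" using k(3) v_p_pos p_small by (simp add: power_le_one)
  have quotient: "\<exists>r\<in>SF.OK \<alpha>. y = z \<otimes>\<^bsub>C\<^esub> r"
    if \<alpha>: "\<alpha> \<in> \<Delta>" and y: "y \<in> K \<alpha>" and z: "z \<in> K \<alpha>" "z \<noteq> \<zero>\<^bsub>C\<^esub>" and vyz: "v y \<le> v z" for \<alpha> y z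
  proof -
    note zi = K_inv[OF \<alpha> z]
    have c: "y \<in> carrier C" "z \<in> carrier C" "inv\<^bsub>C\<^esub> z \<in> carrier C"
      using K_carrier[OF \<alpha>] y z(1) zi(1) by auto
    have "v (inv\<^bsub>C\<^esub> z \<otimes>\<^bsub>C\<^esub> y) = v y / v z"
      using VF.v_mult[OF c(3,1)] VF.v_inv[OF c(2) z(2)] by (simp add: divide_inverse mult.commute)
    also have "\<dots> \<le> 1" using vyz VF.v_pos[OF c(2) z(2)] by simp
    finally have "inv\<^bsub>C\<^esub> z \<otimes>\<^bsub>C\<^esub> y \<in> SF.OK \<alpha>" using K_mult[OF \<alpha> zi(1) y] by simp
    moreover have "y = z \<otimes>\<^bsub>C\<^esub> (inv\<^bsub>C\<^esub> z \<otimes>\<^bsub>C\<^esub> y)" using c zi(2) by (simp add: VF.m_assoc[symmetric])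
    ultimately show ?thesis by blast
  qed
  have "\<exists>n::nat. g [^]\<^bsub>K_Delta_int\<^esub> n \<in> J" if g: "g \<in> (\<lambda>\<alpha>. kap \<alpha> (w \<alpha>)) ` \<Delta>" for g
  proof -
    \<comment> \<open>This step has its target in slot 1, but the generator sits in slot \<alpha>; a
      high power of it is divisible by k = p^M, which can change slots.\<close>
    obtain \<alpha> where \<alpha>: "\<alpha> \<in> \<Delta>" "g = kap \<alpha> (w \<alpha>)" using g by blast
    note w\<alpha> = varpiD[OF w \<alpha>(1)] and w1 = varpiD[OF w one_Delta]
    obtain n where n: "0 < n" "v (w \<alpha>) ^ n < v k"
      by (rule obtain_power_less[OF w\<alpha>(4,3)]) (use VF.v_pos[OF k(2,4)] in auto)
    have wn: "w \<alpha> [^]\<^bsub>C\<^esub> n \<in> K \<alpha>" "v (w \<alpha> [^]\<^bsub>C\<^esub> n) \<le> v k"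
      using K_pow[OF \<alpha>(1) w\<alpha>(2)] VF.v_pow[OF K_carrier[OF \<alpha>(1) w\<alpha>(2)]] n(2) by auto
    have kK: "k \<in> K \<beta>" "k \<in> SF.OK \<beta>" if "\<beta> \<in> \<Delta>" for \<beta> using k(1) kO K0_subset[OF that] by auto
    obtain r where r: "r \<in> SF.OK \<alpha>" "w \<alpha> [^]\<^bsub>C\<^esub> n = k \<otimes>\<^bsub>C\<^esub> r"
      using quotient[OF \<alpha>(1) wn(1) kK(1)[OF \<alpha>(1)] k(4) wn(2)] by blast
    have xw1: "x \<otimes>\<^bsub>C\<^esub> w 1 \<in> SF.OK 1" by (rule SF.A_mult[OF one_Delta x(1) w1(1)])
    have c1: "x \<in> carrier C" "w 1 \<in> carrier C" using SF.A_carrier[OF one_Delta] x(1) w1(1) by auto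
    have v1: "v (x \<otimes>\<^bsub>C\<^esub> w 1) = v x * v (w 1)" by (rule VF.v_mult[OF c1])
    then have "x \<otimes>\<^bsub>C\<^esub> w 1 \<noteq> \<zero>\<^bsub>C\<^esub>" using xw by auto
    moreover have "v k \<le> v (x \<otimes>\<^bsub>C\<^esub> w 1)" using M(2) k(3) v1 by simp
    moreover have "x \<otimes>\<^bsub>C\<^esub> w 1 \<in> K 1" using xw1 by simp
    ultimately obtain r' where r': "r' \<in> SF.OK 1" "k = (x \<otimes>\<^bsub>C\<^esub> w 1) \<otimes>\<^bsub>C\<^esub> r'"
      using quotient[OF one_Delta kK(1)[OF one_Delta]] by blast
    have e1: "kap 1 k = (kap 1 x \<otimes>\<^bsub>K_Delta_int\<^esub> kap 1 (w 1)) \<otimes>\<^bsub>K_Delta_int\<^esub> kap 1 r'"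
      unfolding r'(2) kap_mult[OF one_Delta xw1 r'(1)] kap_mult[OF one_Delta x(1) w1(1)] ..
    have "g [^]\<^bsub>K_Delta_int\<^esub> n = kap \<alpha> (w \<alpha> [^]\<^bsub>C\<^esub> n)" unfolding \<alpha>(2) kap_pow[OF \<alpha>(1) w\<alpha>(1)] ..
    also have "\<dots> = kap \<alpha> k \<otimes>\<^bsub>K_Delta_int\<^esub> kap \<alpha> r" unfolding r(2) by (rule kap_mult[OF \<alpha>(1) kK(2)[OF \<alpha>(1)] r(1)])
    also have "kap \<alpha> k = kap 1 k" by (rule kap_scalar[OF \<alpha>(1) one_Delta k(1) kO])
    finally have "g [^]\<^bsub>K_Delta_int\<^esub> n =
        kap 1 x \<otimes>\<^bsub>K_Delta_int\<^esub> (kap 1 (w 1) \<otimes>\<^bsub>K_Delta_int\<^esub> (kap 1 r' \<otimes>\<^bsub>K_Delta_int\<^esub> kap \<alpha> r))"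
      unfolding e1 using kx kap_closed[OF one_Delta w1(1)] kap_closed[OF one_Delta r'(1)] kap_closed[OF \<alpha>(1) r(1)]
      by (simp add: A.m_assoc)
    moreover have "kap 1 (w 1) \<in> I_varpi w"
      unfolding I_varpi_eq using kap_closed varpiD(1)[OF w] one_Delta
      by (intro subsetD[OF A.genideal_self]) blast+
    then have "kap 1 (w 1) \<otimes>\<^bsub>K_Delta_int\<^esub> (kap 1 r' \<otimes>\<^bsub>K_Delta_int\<^esub> kap \<alpha> r) \<in> I_varpi w"
      using kap_closed[OF one_Delta r'(1)] kap_closed[OF \<alpha>(1) r(1)] by (intro I.I_r_closed) auto
    ultimately show ?thesis unfolding J_def by blast
  qed
  moreover have "(\<lambda>\<alpha>. kap \<alpha> (w \<alpha>)) ` \<Delta> \<subseteq> carrier K_Delta_int"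
    using kap_closed varpiD(1)[OF w] by blast
  ultimately obtain N :: nat where "\<forall>a\<in>I_varpi w. a [^]\<^bsub>K_Delta_int\<^esub> N \<in> J"
    using A.genideal_pow_subset[OF J, of "(\<lambda>\<alpha>. kap \<alpha> (w \<alpha>)) ` \<Delta>"] unfolding I_varpi_eq by blast
  then show ?thesis unfolding J_def by blast
qed

lemma flat_simps:
  "x \<otimes>\<^bsub>K_Delta_int_flat w\<^esub> y = (\<lambda>n. x n \<otimes>\<^bsub>K_Delta_int Quot I_varpi w\<^esub> y n)"
  "\<one>\<^bsub>K_Delta_int_flat w\<^esub> = (\<lambda>n. \<one>\<^bsub>K_Delta_int Quot I_varpi w\<^esub>)"
  "\<zero>\<^bsub>K_Delta_int_flat w\<^esub> = (\<lambda>n. I_varpi w)"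
  "carrier (K_Delta_int_flat w) = p_compatible p (K_Delta_int Quot I_varpi w)"
  by (simp_all add: K_Delta_int_flat_def frobenius_limit_def)

lemma p_compatible_pow:
  assumes "monoid S" "x \<in> p_compatible p S"
  shows "x (n + k) [^]\<^bsub>S\<^esub> (p ^ k) = x n"
proof (induction k)
  case 0
  interpret S: monoid S by fact
  show ?case using assms(2) by (simp add: p_compatible_def)
next
  case (Suc k)
  interpret S: monoid S by fact
  have c: "x m \<in> carrier S" "x (Suc m) [^]\<^bsub>S\<^esub> p = x m" for m using assms(2) by (simp_all add: p_compatible_def)
  have "x (n + Suc k) [^]\<^bsub>S\<^esub> (p ^ Suc k) = (x (Suc (n + k)) [^]\<^bsub>S\<^esub> p) [^]\<^bsub>S\<^esub> (p ^ k)"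
    unfolding S.nat_pow_pow[OF c(1)] by simp
  also have "\<dots> = x n" unfolding c(2) by (rule Suc)
  finally show ?case .
qed

lemma flat_class_closed:
  assumes w: "varpi_family w" and y: "y \<in> p_compatible p K_Delta_int"
  shows "flat_class w y \<in> carrier (K_Delta_int_flat w)"
proof -
  interpret I: ideal "I_varpi w" K_Delta_int by (rule I_varpi_ideal[OF w])
  interpret h: ring_hom_ring K_Delta_int "K_Delta_int Quot I_varpi w" "(+>\<^bsub>K_Delta_int\<^esub>) (I_varpi w)"
    by (rule I.rcos_ring_hom_ring)
  show ?thesis
    using y h.hom_nat_pow[symmetric] by (simp add: flat_simps p_compatible_def flat_class_def)
qed

lemma flat_class_nonzerodivisor:
  assumes w: "varpi_family w"
    and x: "\<And>n. x n \<in> SF.OK 1" "\<And>n. x n \<noteq> \<zero>\<^bsub>C\<^esub>" "\<And>n. x (Suc n) [^]\<^bsub>C\<^esub> p = x n"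
  shows "flat_class w (\<lambda>n. kap 1 (x n)) \<in> non_zero_divisors (K_Delta_int_flat w)"
proof -
  interpret A: cring K_Delta_int by (rule K_Delta_int_cring)
  interpret I: ideal "I_varpi w" K_Delta_int by (rule I_varpi_ideal[OF w])
  interpret Q: cring "K_Delta_int Quot I_varpi w" by (rule I.quotient_is_cring[OF A.is_cring])
  interpret h: ring_hom_ring K_Delta_int "K_Delta_int Quot I_varpi w" "(+>\<^bsub>K_Delta_int\<^esub>) (I_varpi w)"
    by (rule I.rcos_ring_hom_ring)
  have kc: "kap 1 (x n) \<in> carrier K_Delta_int" for n by (rule kap_closed[OF one_Delta x(1)])
  have yc: "(\<lambda>n. kap 1 (x n)) \<in> p_compatible p K_Delta_int"
    by (rule kap_p_compatible[of x, OF x(1,3)])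
  have "z n = I_varpi w"
    if z: "z \<in> p_compatible p (K_Delta_int Quot I_varpi w)"
      and 0: "\<And>n. flat_class w (\<lambda>n. kap 1 (x n)) n \<otimes>\<^bsub>K_Delta_int Quot I_varpi w\<^esub> z n = I_varpi w" for z n
  proof -
    have "\<forall>n. \<exists>a. a \<in> carrier K_Delta_int \<and> z n = I_varpi w +>\<^bsub>K_Delta_int\<^esub> a"
      using z unfolding p_compatible_def carrier_FactRing_iff by blast
    from choice[OF this] obtain a where a: "\<And>n. a n \<in> carrier K_Delta_int"
      "\<And>n. z n = I_varpi w +>\<^bsub>K_Delta_int\<^esub> a n" by blast
    have ya: "kap 1 (x n) \<otimes>\<^bsub>K_Delta_int\<^esub> a n \<in> I_varpi w" for n
    proof -
      have "I_varpi w +>\<^bsub>K_Delta_int\<^esub> (kap 1 (x n) \<otimes>\<^bsub>K_Delta_int\<^esub> a n) = I_varpi w"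
        using 0[of n] unfolding flat_class_def a(2) I.mult_FactRing[OF kc a(1)] .
      then show ?thesis using I.coset_eq_ideal_iff[OF A.m_closed[OF kc a(1)]] by blast
    qed
    obtain N :: nat where N: "\<And>a. a \<in> I_varpi w \<Longrightarrow>
        \<exists>d\<in>I_varpi w. a [^]\<^bsub>K_Delta_int\<^esub> N = kap 1 (x n) \<otimes>\<^bsub>K_Delta_int\<^esub> d"
      using I_varpi_pow[OF w x(1)[of n] x(2)[of n]] by blast
    have "2 \<le> p" using prime_p by (rule prime_ge_2_nat)
    \<comment> \<open>The shift k of the argument can be N itself, since p^N is at least N.\<close>
    then have kN: "N \<le> p ^ N" using less_exp[of N] power_mono[of 2 p N] by linarith
    define c where "c = a (n + N) [^]\<^bsub>K_Delta_int\<^esub> (p ^ N)"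
    have cc: "c \<in> carrier K_Delta_int" unfolding c_def using a(1) by simp
    define u where "u = kap 1 (x (n + N)) \<otimes>\<^bsub>K_Delta_int\<^esub> a (n + N)"
    have u: "u \<in> I_varpi w" "u \<in> carrier K_Delta_int" unfolding u_def using ya kc a(1) by auto
    obtain d where d: "d \<in> I_varpi w" "u [^]\<^bsub>K_Delta_int\<^esub> N = kap 1 (x n) \<otimes>\<^bsub>K_Delta_int\<^esub> d"
      using N[OF u(1)] by blast
    have dc: "d \<in> carrier K_Delta_int" by (rule I.Icarr[OF d(1)])
    \<comment> \<open>The first N factors of u^(p^N) supply x times an element d of the ideal, and
      the remaining ones only multiply d. Cancelling x then shows c = e.\<close>
    define e where "e = d \<otimes>\<^bsub>K_Delta_int\<^esub> u [^]\<^bsub>K_Delta_int\<^esub> (p ^ N - N)"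
    have e: "e \<in> I_varpi w" unfolding e_def using u(2) by (intro I.I_r_closed[OF d(1)]) simp
    have ec: "e \<in> carrier K_Delta_int" by (rule I.Icarr[OF e])
    have "kap 1 (x n) \<otimes>\<^bsub>K_Delta_int\<^esub> c = u [^]\<^bsub>K_Delta_int\<^esub> (p ^ N)"
      using p_compatible_pow[OF A.is_monoid yc, of n N] kc a(1)
      by (simp add: u_def c_def A.nat_pow_distrib)
    also have "\<dots> = u [^]\<^bsub>K_Delta_int\<^esub> N \<otimes>\<^bsub>K_Delta_int\<^esub> u [^]\<^bsub>K_Delta_int\<^esub> (p ^ N - N)"
      using kN u(2) by (simp add: A.nat_pow_mult)
    also have "\<dots> = kap 1 (x n) \<otimes>\<^bsub>K_Delta_int\<^esub> e"
      unfolding d(2) e_def using kc dc u(2) by (simp add: A.m_assoc)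
    finally have eq: "kap 1 (x n) \<otimes>\<^bsub>K_Delta_int\<^esub> c = kap 1 (x n) \<otimes>\<^bsub>K_Delta_int\<^esub> e" .
    have "kap 1 (x n) \<otimes>\<^bsub>K_Delta_int\<^esub> (c \<ominus>\<^bsub>K_Delta_int\<^esub> e) = \<zero>\<^bsub>K_Delta_int\<^esub>"
      using eq kc cc ec by (simp add: A.minus_eq A.r_distr A.r_minus A.r_neg)
    then have "c \<ominus>\<^bsub>K_Delta_int\<^esub> e = \<zero>\<^bsub>K_Delta_int\<^esub>"
      using kap_nonzerodivisor[OF one_Delta x(1)[of n] x(2)[of n]] cc ec by (simp add: non_zero_divisors_def)
    then have "c \<in> I_varpi w" using e A.r_right_minus_eq cc ec by simp
    then have "I_varpi w +>\<^bsub>K_Delta_int\<^esub> c = I_varpi w" using I.coset_eq_ideal_iff[OF cc] by simp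
    moreover have "I_varpi w +>\<^bsub>K_Delta_int\<^esub> c = z (n + N) [^]\<^bsub>K_Delta_int Quot I_varpi w\<^esub> (p ^ N)"
      unfolding c_def a(2) using h.hom_nat_pow[OF a(1)] by simp
    moreover have "\<dots> = z n" by (rule p_compatible_pow[OF Q.is_monoid z])
    ultimately show ?thesis by simp
  qed
  then show ?thesis
    using flat_class_closed[OF w yc] unfolding non_zero_divisors_def flat_simps by (auto simp: fun_eq_iff)
qed

text \<open>The absolute value of l at s is that of the image of x_0 under the first embedding. It
  is expressed through s, so the constants are taken from \<open>embedding_bounds\<close>. That l is
  a unit is the localisation property applied to a non-zero-divisor.\<close>

lemma equichar_small_unit:
  assumes "equichar_perfectoid_Delta_field R absR"
  shows "small_unit R absR"
proof -
  obtain w i b bf where e: "varpi_family w \<and> total_fraction_ring (K_Delta_int_flat w) R i \<and>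
      (\<forall>s\<in>embeddings. is_beta O0 OK s (b s)) \<and>
      (\<forall>s\<in>embeddings.
         bf s \<in> ring_hom (R\<lparr>carrier := flat_domain w R i (b s)\<rparr>) (tilt_field p C v (K_emb s)) \<and>
         (\<forall>y \<in> p_compatible p K_Delta_int. bf s (i (flat_class w y)) = (\<lambda>n. b s (y n)))) \<and>
      (\<forall>\<sigma>\<in>emb_classes. \<forall>s\<in>\<sigma>. \<forall>l\<in>flat_domain w R i (b s). absR \<sigma> l = tilt_abs v (bf s l))"
    using assms unfolding equichar_perfectoid_Delta_field_def by (elim exE) (rule that)
  note w = conjunct1[OF e] and frac = conjunct1[OF conjunct2[OF e]]
    and b = bspec[OF conjunct1[OF conjunct2[OF conjunct2[OF e]]]]
    and e' = conjunct2[OF conjunct2[OF conjunct2[OF e]]]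
  have bf: "bf s (i (flat_class w y)) = (\<lambda>n. b s (y n))"
    if "s \<in> embeddings" "y \<in> p_compatible p K_Delta_int" for s y
    by (rule bspec[OF conjunct2[OF bspec[OF conjunct1[OF e'] that(1)]] that(2)])
  have absR: "absR \<sigma> l = tilt_abs v (bf s l)"
    if "\<sigma> \<in> emb_classes" "s \<in> \<sigma>" "l \<in> flat_domain w R i (b s)" for \<sigma> s l
    by (rule bspec[OF bspec[OF bspec[OF conjunct2[OF e'] that(1)] that(2)] that(3)])
  interpret A: cring K_Delta_int by (rule K_Delta_int_cring)
  interpret R: cring R using frac unfolding total_fraction_ring_def by simp
  interpret I: ideal "I_varpi w" K_Delta_int by (rule I_varpi_ideal[OF w])
  interpret Q: cring "K_Delta_int Quot I_varpi w" by (rule I.quotient_is_cring[OF A.is_cring])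
  have i: "i \<in> ring_hom (K_Delta_int_flat w) R"
    and units: "i ` non_zero_divisors (K_Delta_int_flat w) \<subseteq> Units R"
    using frac unfolding total_fraction_ring_def by simp_all
  interpret P: perfectoid_subfield C v p "K 1"
    by (intro perfectoid_subfield.intro VF.valued_field_axioms perfectoid_subfield_axioms.intro
        p_pos K_perfectoid one_Delta p_nonzero p_small)
  obtain x where x: "\<And>n. x n \<in> K 1" "\<And>n. v (x n) \<le> 1" "\<And>n. x (Suc n) [^]\<^bsub>C\<^esub> p = x n"
    "0 < v (x 0)" "v (x 0) < 1"
    by (rule P.p_compatible_pseudouniformizer) (rule that)
  have xO: "x n \<in> SF.OK 1" for n using x(1,2) by simp
  have x0: "x n \<noteq> \<zero>\<^bsub>C\<^esub>" for n
  proof (induction n)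
    case 0 then show ?case using x(4) by auto
  next
    case (Suc n)
    then show ?case using x(3)[of n] p_pos VF.nat_pow_zero[of p] by auto
  qed
  define y where "y = (\<lambda>n. kap 1 (x n))"
  have y: "y \<in> p_compatible p K_Delta_int"
    unfolding y_def by (rule kap_p_compatible[of x, OF xO x(3)])
  define l where "l = i (flat_class w y)"
  have lU: "l \<in> Units R"
    using flat_class_nonzerodivisor[of w x, OF w xO x0 x(3)] units unfolding l_def y_def by blast
  \<comment> \<open>The constant sequence 1 as denominator: every beta_s maps it to 1, so l lies in
    \<open>flat_domain\<close> for all embeddings at once.\<close>
  define z where "z = (\<lambda>n::nat. \<one>\<^bsub>K_Delta_int\<^esub>)"
  have z: "z \<in> p_compatible p K_Delta_int" by (simp add: z_def p_compatible_def)
  have fz: "flat_class w z = \<one>\<^bsub>K_Delta_int_flat w\<^esub>"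
    unfolding flat_class_def z_def flat_simps by (simp add: FactRing_def)
  have "flat_class w z \<in> non_zero_divisors (K_Delta_int_flat w)"
    using flat_class_closed[OF w z] unfolding non_zero_divisors_def fz flat_simps
    by (auto simp: p_compatible_def)
  moreover have "i (flat_class w z) = \<one>\<^bsub>R\<^esub>" unfolding fz by (rule ring_hom_one[OF i])
  then have "l = i (flat_class w y) \<otimes>\<^bsub>R\<^esub> inv\<^bsub>R\<^esub> (i (flat_class w z))"
    using R.Units_closed[OF lU] by (simp add: l_def)
  moreover have "(\<lambda>n. b s (z n)) \<noteq> (\<lambda>n. \<zero>\<^bsub>C\<^esub>)" if s: "s \<in> embeddings" for s
  proof -
    have "b s \<in> ring_hom K_Delta_int (C\<lparr>carrier := K_emb s\<rparr>)"
      using b[OF s] unfolding is_beta_def K_Delta_int_def by blast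
    then have "b s \<one>\<^bsub>K_Delta_int\<^esub> = \<one>\<^bsub>C\<^esub>" using ring_hom_one by fastforce
    then show ?thesis by (auto simp: z_def fun_eq_iff)
  qed
  ultimately have dom: "l \<in> flat_domain w R i (b s)" if "s \<in> embeddings" for s
    using y z that unfolding flat_domain_def by blast
  obtain c \<theta> where c: "0 < c" "0 \<le> \<theta>" "\<theta> < 1"
    "\<And>s. s \<in> embeddings \<Longrightarrow> c \<le> v (s 1 (x 0)) \<and> v (s 1 (x 0)) \<le> \<theta>"
    by (rule embedding_bounds[OF one_Delta x(1) x(4,5)]) (rule that)
  have "c \<le> absR \<sigma> l \<and> absR \<sigma> l \<le> \<theta>" if \<sigma>: "\<sigma> \<in> emb_classes" for \<sigma>
  proof -
    obtain s where s: "s \<in> \<sigma>" "s \<in> embeddings" by (rule emb_classes_inhabited[OF \<sigma>])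
    have "SF.slot 1 (x 0) \<in> PiE \<Delta> OK" unfolding OK_eq by (rule SF.slot_closed[OF one_Delta xO])
    then have "b s (y 0) = (\<Otimes>\<^bsub>C\<^esub>\<alpha>\<in>\<Delta>. s \<alpha> (SF.slot 1 (x 0) \<alpha>))"
      using b[OF s(2)] unfolding is_beta_def y_def kap_pure by blast
    also have "\<dots> = s 1 (x 0)" by (rule finprod_slot[OF s(2) one_Delta x(1)])
    finally have "absR \<sigma> l = v (s 1 (x 0))"
      using absR[OF \<sigma> s(1) dom[OF s(2)]] bf[OF s(2) y] by (simp add: l_def tilt_abs_def)
    then show ?thesis using c(4)[OF s(2)] by simp
  qed
  then show ?thesis
    unfolding small_unit_def using c(1-3) lU by blast
qed

end

section \<open>Banach spaces\<close>

lemma normed_spaceD: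
  assumes "normed_space R S absR M nrm"
  shows "module R M"
    "\<sigma> \<in> S \<Longrightarrow> x \<in> carrier M \<Longrightarrow> 0 \<le> nrm \<sigma> x"
    "\<sigma> \<in> S \<Longrightarrow> x \<in> carrier M \<Longrightarrow> y \<in> carrier M \<Longrightarrow> nrm \<sigma> (x \<oplus>\<^bsub>M\<^esub> y) \<le> max (nrm \<sigma> x) (nrm \<sigma> y)"
    "\<sigma> \<in> S \<Longrightarrow> l \<in> carrier R \<Longrightarrow> x \<in> carrier M \<Longrightarrow> nrm \<sigma> (l \<odot>\<^bsub>M\<^esub> x) = absR \<sigma> l * nrm \<sigma> x"
    "(\<Inter>\<sigma>\<in>S. {x \<in> carrier M. nrm \<sigma> x = 0}) = {\<zero>\<^bsub>M\<^esub>}"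
    "x \<in> carrier M \<Longrightarrow> bdd_above ((\<lambda>\<sigma>. nrm \<sigma> x) ` S)"
proof -
  note h = assms[unfolded normed_space_def]
  show "module R M" by (rule conjunct1[OF h])
  note h2 = conjunct2[OF h] note h3 = conjunct2[OF h2] note h4 = conjunct2[OF h3] note h5 = conjunct2[OF h4]
  show "0 \<le> nrm \<sigma> x" if "\<sigma> \<in> S" "x \<in> carrier M"
    by (rule bspec[OF bspec[OF conjunct1[OF h2] that(1)] that(2)])
  show "nrm \<sigma> (x \<oplus>\<^bsub>M\<^esub> y) \<le> max (nrm \<sigma> x) (nrm \<sigma> y)" if "\<sigma> \<in> S" "x \<in> carrier M" "y \<in> carrier M"
    by (rule bspec[OF bspec[OF bspec[OF conjunct1[OF h3] that(1)] that(2)] that(3)])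
  show "nrm \<sigma> (l \<odot>\<^bsub>M\<^esub> x) = absR \<sigma> l * nrm \<sigma> x" if "\<sigma> \<in> S" "l \<in> carrier R" "x \<in> carrier M"
    by (rule bspec[OF bspec[OF bspec[OF conjunct1[OF h4] that(1)] that(2)] that(3)])
  show "(\<Inter>\<sigma>\<in>S. {x \<in> carrier M. nrm \<sigma> x = 0}) = {\<zero>\<^bsub>M\<^esub>}" by (rule conjunct1[OF h5])
  show "bdd_above ((\<lambda>\<sigma>. nrm \<sigma> x) ` S)" if "x \<in> carrier M"
    by (rule bspec[OF conjunct2[OF h5] that])
qed

lemma normed_space_sup_upper:
  assumes "normed_space R S absR M nrm" "\<sigma> \<in> S" "x \<in> carrier M"
  shows "nrm \<sigma> x \<le> sup_norm S nrm x"
  unfolding sup_norm_def by (rule cSUP_upper[OF assms(2) normed_spaceD(6)[OF assms(1,3)]])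

lemma sup_norm_le: "S \<noteq> {} \<Longrightarrow> (\<And>\<sigma>. \<sigma> \<in> S \<Longrightarrow> nrm \<sigma> x \<le> B) \<Longrightarrow> sup_norm S nrm x \<le> B"
  unfolding sup_norm_def by (rule cSUP_least)

text \<open>Put a = |-1|. Negating twice gives a a ||x|| = ||x||, and nonnegativity of the seminorms
  gives a >= 0 when ||x|| > 0; hence a = 1 or ||x|| = 0.\<close>

lemma normed_space_neg:
  assumes N: "normed_space R S absR M nrm" and \<sigma>: "\<sigma> \<in> S" and x: "x \<in> carrier M"
  shows "nrm \<sigma> (\<ominus>\<^bsub>M\<^esub> x) = nrm \<sigma> x"
proof -
  interpret M: module R M by (rule normed_spaceD(1)[OF N])
  have le: "nrm \<sigma> (\<ominus>\<^bsub>M\<^esub> y) = absR \<sigma> (\<ominus>\<^bsub>R\<^esub> \<one>\<^bsub>R\<^esub>) * nrm \<sigma> y" if y: "y \<in> carrier M" for y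
  proof -
    have "(\<ominus>\<^bsub>R\<^esub> \<one>\<^bsub>R\<^esub>) \<odot>\<^bsub>M\<^esub> y = \<ominus>\<^bsub>M\<^esub> y" using M.smult_l_minus[OF M.one_closed y] M.smult_one[OF y] by simp
    then show ?thesis using normed_spaceD(4)[OF N \<sigma> M.R.a_inv_closed[OF M.one_closed] y] by simp
  qed
  define a where "a = absR \<sigma> (\<ominus>\<^bsub>R\<^esub> \<one>\<^bsub>R\<^esub>)"
  have 1: "nrm \<sigma> x = a * (a * nrm \<sigma> x)"
    using le[OF x] le[OF M.M.a_inv_closed[OF x]] x by (simp add: a_def)
  have 2: "0 \<le> a * nrm \<sigma> x" using le[OF x] normed_spaceD(2)[OF N \<sigma> M.M.a_inv_closed[OF x]] by (simp add: a_def)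
  have 3: "0 \<le> nrm \<sigma> x" by (rule normed_spaceD(2)[OF N \<sigma> x])
  have "a * nrm \<sigma> x = nrm \<sigma> x"
  proof (cases "nrm \<sigma> x = 0")
    case False
    then have "0 < nrm \<sigma> x" using 3 by simp
    then have "0 \<le> a" "a * a = 1" using 1 2 by (simp_all add: zero_le_mult_iff)
    then have "a = 1" using square_eq_1_iff[of a] by auto
    then show ?thesis by simp
  qed simp
  then show ?thesis using le[OF x] by (simp add: a_def)
qed

text \<open>The supremum dominates every seminorm, so it vanishes only where all of them do, and
  there the intersection axiom applies. A nonempty index set makes it nonnegative.\<close>

lemma normed_space_ultranormed:
  assumes N: "normed_space R S absR M nrm" and S: "S \<noteq> {}"
  shows "ultranormed_group M (sup_norm S nrm)"
proof -
  interpret M: module R M by (rule normed_spaceD(1)[OF N])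
  obtain \<tau> where \<tau>: "\<tau> \<in> S" using S by blast
  have z: "nrm \<sigma> \<zero>\<^bsub>M\<^esub> = 0" if "\<sigma> \<in> S" for \<sigma> using normed_spaceD(5)[OF N] that by blast
  show ?thesis
  proof unfold_locales
    fix x y assume x: "x \<in> carrier M" and y: "y \<in> carrier M"
    show "0 \<le> sup_norm S nrm x"
      using normed_spaceD(2)[OF N \<tau> x] normed_space_sup_upper[OF N \<tau> x] by linarith
    show "sup_norm S nrm (x \<ominus>\<^bsub>M\<^esub> y) \<le> max (sup_norm S nrm x) (sup_norm S nrm y)"
    proof (rule sup_norm_le[OF S])
      fix \<sigma> assume \<sigma>: "\<sigma> \<in> S"
      have "nrm \<sigma> (x \<ominus>\<^bsub>M\<^esub> y) \<le> max (nrm \<sigma> x) (nrm \<sigma> y)"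
        using normed_spaceD(3)[OF N \<sigma> x M.M.a_inv_closed[OF y]] normed_space_neg[OF N \<sigma> y]
        by (simp add: a_minus_def)
      also have "\<dots> \<le> max (sup_norm S nrm x) (sup_norm S nrm y)"
        using normed_space_sup_upper[OF N \<sigma>] x y by (intro max.mono)
      finally show "nrm \<sigma> (x \<ominus>\<^bsub>M\<^esub> y) \<le> max (sup_norm S nrm x) (sup_norm S nrm y)" .
    qed
  next
    have "sup_norm S nrm \<zero>\<^bsub>M\<^esub> \<le> 0" by (rule sup_norm_le[OF S]) (simp add: z)
    moreover have "0 \<le> sup_norm S nrm \<zero>\<^bsub>M\<^esub>"
      using normed_space_sup_upper[OF N \<tau> M.M.zero_closed] z[OF \<tau>] by simp
    ultimately show "sup_norm S nrm \<zero>\<^bsub>M\<^esub> = 0" by simp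
  next
    fix x assume x: "x \<in> carrier M" "sup_norm S nrm x = 0"
    have "nrm \<sigma> x = 0" if "\<sigma> \<in> S" for \<sigma>
      using normed_spaceD(2)[OF N that x(1)] normed_space_sup_upper[OF N that x(1)] x(2) by linarith
    then show "x = \<zero>\<^bsub>M\<^esub>" using normed_spaceD(5)[OF N] x(1) by blast
  qed
qed

lemma normed_space_smult_le:
  assumes N: "normed_space R S absR M nrm" and S: "S \<noteq> {}" and l: "l \<in> carrier R"
    and \<theta>: "0 \<le> \<theta>" "\<And>\<sigma>. \<sigma> \<in> S \<Longrightarrow> absR \<sigma> l \<le> \<theta>" and x: "x \<in> carrier M"
  shows "sup_norm S nrm (l \<odot>\<^bsub>M\<^esub> x) \<le> \<theta> * sup_norm S nrm x"
proof (rule sup_norm_le[OF S])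
  fix \<sigma> assume \<sigma>: "\<sigma> \<in> S"
  have "nrm \<sigma> (l \<odot>\<^bsub>M\<^esub> x) = absR \<sigma> l * nrm \<sigma> x" by (rule normed_spaceD(4)[OF N \<sigma> l x])
  also have "\<dots> \<le> \<theta> * sup_norm S nrm x"
    using \<theta> \<sigma> normed_space_sup_upper[OF N \<sigma> x] normed_spaceD(2)[OF N \<sigma> x] by (intro mult_mono) auto
  finally show "nrm \<sigma> (l \<odot>\<^bsub>M\<^esub> x) \<le> \<theta> * sup_norm S nrm x" .
qed

lemma normed_space_smult_ge:
  assumes N: "normed_space R S absR M nrm" and S: "S \<noteq> {}" and l: "l \<in> carrier R"
    and c: "0 < c" "\<And>\<sigma>. \<sigma> \<in> S \<Longrightarrow> c \<le> absR \<sigma> l" and x: "x \<in> carrier M"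
  shows "c * sup_norm S nrm x \<le> sup_norm S nrm (l \<odot>\<^bsub>M\<^esub> x)"
proof -
  interpret M: module R M by (rule normed_spaceD(1)[OF N])
  have "sup_norm S nrm x \<le> sup_norm S nrm (l \<odot>\<^bsub>M\<^esub> x) / c"
  proof (rule sup_norm_le[OF S])
    fix \<sigma> assume \<sigma>: "\<sigma> \<in> S"
    have "c * nrm \<sigma> x \<le> absR \<sigma> l * nrm \<sigma> x"
      using c(2)[OF \<sigma>] normed_spaceD(2)[OF N \<sigma> x] by (intro mult_right_mono)
    also have "\<dots> = nrm \<sigma> (l \<odot>\<^bsub>M\<^esub> x)" using normed_spaceD(4)[OF N \<sigma> l x] by simp
    also have "\<dots> \<le> sup_norm S nrm (l \<odot>\<^bsub>M\<^esub> x)"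
      by (rule normed_space_sup_upper[OF N \<sigma> M.smult_closed[OF l x]])
    finally show "nrm \<sigma> x \<le> sup_norm S nrm (l \<odot>\<^bsub>M\<^esub> x) / c" using c(1) by (simp add: field_simps)
  qed
  then show ?thesis using c(1) by (simp add: field_simps)
qed

text \<open>Multiplication by l and by its inverse are the scaling operators of
  \<open>scaled_epimorphism\<close>; T commutes with the first because it is R-linear.\<close>

theorem open_mapping_small_unit:
  assumes S: "S \<noteq> {}" and l: "l \<in> Units R" and c: "0 < c" "0 \<le> \<theta>" "\<theta> < 1"
    and bounds: "\<And>\<sigma>. \<sigma> \<in> S \<Longrightarrow> c \<le> absR \<sigma> l \<and> absR \<sigma> l \<le> \<theta>"
    and E: "banach_space R S absR E nrmE" and F: "banach_space R S absR F nrmF"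
    and T: "normed_morphism R S E nrmE F nrmF T" and surj: "T ` carrier E = carrier F"
  shows "open_map (space_topology S E nrmE) (space_topology S F nrmF) T"
proof -
  have NE: "normed_space R S absR E nrmE" and NF: "normed_space R S absR F nrmF"
    using E F by (auto simp: banach_space_def)
  interpret ME: module R E by (rule normed_spaceD(1)[OF NE])
  interpret MF: module R F by (rule normed_spaceD(1)[OF NF])
  interpret UE: ultranormed_group E "sup_norm S nrmE" by (rule normed_space_ultranormed[OF NE S])
  interpret UF: ultranormed_group F "sup_norm S nrmF" by (rule normed_space_ultranormed[OF NF S])
  have lc: "l \<in> carrier R" "inv\<^bsub>R\<^esub> l \<in> carrier R" "l \<otimes>\<^bsub>R\<^esub> inv\<^bsub>R\<^esub> l = \<one>\<^bsub>R\<^esub>" using l by auto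
  \<comment> \<open>The locale asks for a constant below 1; shrinking c keeps the lower
    bound.\<close>
  define c' where "c' = min c (1 / 2)"
  have c': "0 < c'" "c' < 1" "\<And>\<sigma>. \<sigma> \<in> S \<Longrightarrow> c' \<le> absR \<sigma> l"
    using c(1) bounds by (auto simp: c'_def min_le_iff_disj)
  have cancel: "l \<odot>\<^bsub>F\<^esub> (inv\<^bsub>R\<^esub> l \<odot>\<^bsub>F\<^esub> y) = y" if "y \<in> carrier F" for y
    using MF.smult_assoc1[OF lc(1,2) that] MF.smult_one[OF that] lc(3) by simp
  interpret scaled_epimorphism E "sup_norm S nrmE" F "sup_norm S nrmF" T
    "\<lambda>x. l \<odot>\<^bsub>E\<^esub> x" "\<lambda>y. l \<odot>\<^bsub>F\<^esub> y" "\<lambda>y. inv\<^bsub>R\<^esub> l \<odot>\<^bsub>F\<^esub> y" \<theta> c'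
  proof unfold_locales
    show "norm_complete E (sup_norm S nrmE)" "norm_complete F (sup_norm S nrmF)"
      using E F by (auto simp: banach_space_def)
    show "T ` carrier E = carrier F" by (rule surj)
    show "continuous_map (norm_topology E (sup_norm S nrmE)) (norm_topology F (sup_norm S nrmF)) T"
      using T by (simp add: normed_morphism_def space_topology_def)
    show "T (x \<oplus>\<^bsub>E\<^esub> x') = T x \<oplus>\<^bsub>F\<^esub> T x'" if "x \<in> carrier E" "x' \<in> carrier E" for x x'
      using T that by (simp add: normed_morphism_def)
    show "T (l \<odot>\<^bsub>E\<^esub> x) = l \<odot>\<^bsub>F\<^esub> T x" if "x \<in> carrier E" for x
      using T that lc(1) by (simp add: normed_morphism_def)
    show "l \<odot>\<^bsub>E\<^esub> x \<in> carrier E" if "x \<in> carrier E" for x using lc(1) that by simp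
    show "sup_norm S nrmE (l \<odot>\<^bsub>E\<^esub> x) \<le> \<theta> * sup_norm S nrmE x" if "x \<in> carrier E" for x
      using bounds by (intro normed_space_smult_le[OF NE S lc(1) c(2) _ that]) blast
    show "l \<odot>\<^bsub>F\<^esub> y \<in> carrier F" "inv\<^bsub>R\<^esub> l \<odot>\<^bsub>F\<^esub> y \<in> carrier F" if "y \<in> carrier F" for y
      using lc that by simp_all
    show "l \<odot>\<^bsub>F\<^esub> (y \<ominus>\<^bsub>F\<^esub> z) = l \<odot>\<^bsub>F\<^esub> y \<ominus>\<^bsub>F\<^esub> l \<odot>\<^bsub>F\<^esub> z" if "y \<in> carrier F" "z \<in> carrier F" for y z
      using lc(1) that by (simp add: a_minus_def MF.smult_r_distr MF.smult_r_minus)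
    show "sup_norm S nrmF (l \<odot>\<^bsub>F\<^esub> y) \<le> sup_norm S nrmF y" if y: "y \<in> carrier F" for y
    proof -
      have "sup_norm S nrmF (l \<odot>\<^bsub>F\<^esub> y) \<le> 1 * sup_norm S nrmF y"
        using bounds c(3) by (intro normed_space_smult_le[OF NF S lc(1) _ _ y]) force+
      then show ?thesis by simp
    qed
    show "l \<odot>\<^bsub>F\<^esub> (inv\<^bsub>R\<^esub> l \<odot>\<^bsub>F\<^esub> y) = y" if "y \<in> carrier F" for y by (rule cancel[OF that])
    \<comment> \<open>The lower bound for multiplication by l, taken at the vector divided by l,
      bounds the expansion caused by division.\<close>
    show "c' * sup_norm S nrmF (inv\<^bsub>R\<^esub> l \<odot>\<^bsub>F\<^esub> y) \<le> sup_norm S nrmF y" if y: "y \<in> carrier F" for y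
      using normed_space_smult_ge[OF NF S lc(1) c'(1,3) MF.smult_closed[OF lc(2) y]] cancel[OF y] by simp
  qed (use c c' in auto)
  show ?thesis unfolding space_topology_def by (rule open_map_T)
qed

theorem theorem4p7:
  fixes p t :: nat
    and C :: "'c ring" and v :: "'c \<Rightarrow> real" and K0 :: "'c set" and K :: "nat \<Rightarrow> 'c set"
    and R :: "'r ring" and absR :: "(nat \<Rightarrow> 'c \<Rightarrow> 'c) set \<Rightarrow> 'r \<Rightarrow> real"
    and E :: "('r, 'e) module" and nrmE :: "(nat \<Rightarrow> 'c \<Rightarrow> 'c) set \<Rightarrow> 'e \<Rightarrow> real"
    and F :: "('r, 'f) module" and nrmF :: "(nat \<Rightarrow> 'c \<Rightarrow> 'c) set \<Rightarrow> 'f \<Rightarrow> real"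
    and T :: "'e \<Rightarrow> 'f"
  defines "\<SS> \<equiv> perfectoid_data.emb_classes t C v K0 K"
  assumes "perfectoid_data p t C v K0 K"
    and "perfectoid_data.perfectoid_Delta_field p t C v K0 K R absR"
    and "banach_space R \<SS> absR E nrmE"
    and "banach_space R \<SS> absR F nrmF"
    and "normed_morphism R \<SS> E nrmE F nrmF T"
    and "T ` carrier E = carrier F"
  shows "open_map (space_topology \<SS> E nrmE) (space_topology \<SS> F nrmF) T"
proof -
  note \<SS>_eq = assms(1) and data = assms(2) and R = assms(3) and E = assms(4) and F = assms(5)
    and T = assms(6) and surj = assms(7)
  interpret P: perfectoid_data p t C v K0 K by (rule data)
  \<comment> \<open>The mixed case takes commutativity of \<open>R\<close> as an assumption; the
    module structure of \<open>E\<close> supplies it.\<close>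
  have "module R E" using E by (simp add: banach_space_def normed_space_def)
  then have "cring R" by (rule module.axioms(1))
  then have "P.small_unit R absR"
    using R P.mixed_small_unit P.equichar_small_unit unfolding P.perfectoid_Delta_field_def by blast
  then obtain l c \<theta> where l: "l \<in> Units R" and c: "0 < c" "0 \<le> \<theta>" "\<theta> < 1"
    and bounds: "\<And>\<sigma>. \<sigma> \<in> \<SS> \<Longrightarrow> c \<le> absR \<sigma> l \<and> absR \<sigma> l \<le> \<theta>"
    unfolding P.small_unit_def \<SS>_eq by blast
  have "\<SS> \<noteq> {}" unfolding \<SS>_eq by (rule P.emb_classes_nonempty)
  then show ?thesis by (rule open_mapping_small_unit[OF _ l c bounds E F T surj])
qed

end
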